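(* $A_h(n)$ is the quantum symmetry algebra of the graph $I_n$ formed by $n$ disjoint segments ($2n$ vertices, $n$ edges). That is, with the vertices of $I_n$ labelled so that the $i$-th segment has endpoints $i$ and $n+i$, and with $e$ the adjacency matrix of $I_n$, the quotient of $A_s(2n)$ by the relations coming from $ew=we$ (where $w$ is the magic unitary generating $A_s(2n)$) is $A_h(n)$.
   Context: A square matrix over a unital $C^*$-algebra is a magic unitary if its entries are projections which on each row and each column are mutually orthogonal and sum to $1$. $A_s(N)$ is the universal $C^*$-algebra generated by the entries of an $N\times N$ magic unitary. A sudoku unitary is a magic unitary of the form $w=\begin{pmatrix}a&b\\ b&a\end{pmatrix}$, where $a,b$ are square matrices of the same size. $A_h(n)$ is the universal $C^*$-algebra generated by the entries of a $2n\times2n$ sudoku unitary. For a finite graph $X$ with $N$ vertices and adjacency matrix $d$, the quantum symmetry algebra of $X$ is $A_X=A_s(N)/I$, where $I$ is the ideal generated by the relations coming from $du=ud$, $u$ being the magic unitary generating $A_s(N)$. *)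

theory Defs
  imports Complex_Main "HOL-Library.Poly_Mapping" "HOL-Algebra.QuotRing" "HOL-Algebra.Module"
begin

section \<open>Unital C*-algebras\<close>

text \<open>
  A unital complex *-algebra is a record with a carrier, so that subalgebras, quotients and the zero
  algebra are all available.  It extends the record of modules over the field of complex numbers.
\<close>

definition complex_ring :: "complex ring" where
  "complex_ring = \<lparr>carrier = UNIV, monoid.mult = (*), one = 1, ring.zero = 0, add = (+)\<rparr>"

record 'a cstar = "(complex, 'a) module" +
  adj :: "'a \<Rightarrow> 'a"
  nrm :: "'a \<Rightarrow> real"

locale star_algebra = ring A + C: module complex_ring A for A :: "('a, 'm) cstar_scheme" (structure) +
  assumes smult_mult_l:
      "\<lbrakk>x \<in> carrier A; y \<in> carrier A\<rbrakk> \<Longrightarrow> (c \<odot> x) \<otimes> y = c \<odot> (x \<otimes> y)"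
    and smult_mult_r:
      "\<lbrakk>x \<in> carrier A; y \<in> carrier A\<rbrakk> \<Longrightarrow> x \<otimes> (c \<odot> y) = c \<odot> (x \<otimes> y)"
    and adj_closed: "x \<in> carrier A \<Longrightarrow> adj A x \<in> carrier A"
    and adj_adj: "x \<in> carrier A \<Longrightarrow> adj A (adj A x) = x"
    and adj_add:
      "\<lbrakk>x \<in> carrier A; y \<in> carrier A\<rbrakk> \<Longrightarrow> adj A (x \<oplus> y) = adj A x \<oplus> adj A y"
    and adj_smult: "x \<in> carrier A \<Longrightarrow> adj A (c \<odot> x) = cnj c \<odot> adj A x"
    and adj_mult:
      "\<lbrakk>x \<in> carrier A; y \<in> carrier A\<rbrakk> \<Longrightarrow> adj A (x \<otimes> y) = adj A y \<otimes> adj A x"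

locale cstar_algebra = star_algebra A for A :: "('a, 'm) cstar_scheme" (structure) +
  assumes nrm_eq_0: "x \<in> carrier A \<Longrightarrow> nrm A x = 0 \<longleftrightarrow> x = \<zero>"
    and nrm_add: "\<lbrakk>x \<in> carrier A; y \<in> carrier A\<rbrakk> \<Longrightarrow> nrm A (x \<oplus> y) \<le> nrm A x + nrm A y"
    and nrm_smult: "x \<in> carrier A \<Longrightarrow> nrm A (c \<odot> x) = cmod c * nrm A x"
    and nrm_mult: "\<lbrakk>x \<in> carrier A; y \<in> carrier A\<rbrakk> \<Longrightarrow> nrm A (x \<otimes> y) \<le> nrm A x * nrm A y"
    and nrm_cstar: "x \<in> carrier A \<Longrightarrow> nrm A (adj A x \<otimes> x) = (nrm A x)\<^sup>2"
    and complete: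
      "\<lbrakk>\<forall>k::nat. X k \<in> carrier A;
        \<forall>\<epsilon>>0. \<exists>M. \<forall>k\<ge>M. \<forall>l\<ge>M. nrm A (X k \<ominus> X l) < \<epsilon>\<rbrakk> \<Longrightarrow>
        \<exists>x\<in>carrier A. (\<lambda>k. nrm A (X k \<ominus> x)) \<longlonglongrightarrow> 0"

definition star_hom :: "('a, 'm) cstar_scheme \<Rightarrow> ('b, 'k) cstar_scheme \<Rightarrow> ('a \<Rightarrow> 'b) set" where
  "star_hom A B = {f. f \<in> ring_hom A B \<and>
     (\<forall>c. \<forall>x\<in>carrier A. f (c \<odot>\<^bsub>A\<^esub> x) = c \<odot>\<^bsub>B\<^esub> f x) \<and>
     (\<forall>x\<in>carrier A. f (adj A x) = adj B (f x))}"

definition cstar_iso :: "('a, 'm) cstar_scheme \<Rightarrow> ('b, 'k) cstar_scheme \<Rightarrow> ('a \<Rightarrow> 'b) set" where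
  "cstar_iso A B = {f \<in> star_hom A B. bij_betw f (carrier A) (carrier B) \<and>
     (\<forall>x\<in>carrier A. nrm B (f x) = nrm A x)}"

definition norm_closed :: "('a, 'm) cstar_scheme \<Rightarrow> 'a set \<Rightarrow> bool" where
  "norm_closed A I \<longleftrightarrow> (\<forall>X x. (\<forall>k::nat. X k \<in> I) \<longrightarrow> x \<in> carrier A \<longrightarrow>
     (\<lambda>k. nrm A (X k \<ominus>\<^bsub>A\<^esub> x)) \<longlonglongrightarrow> 0 \<longrightarrow> x \<in> I)"

definition closed_ideal_generated :: "('a, 'm) cstar_scheme \<Rightarrow> 'a set \<Rightarrow> 'a set" where
  "closed_ideal_generated A S = \<Inter>{I. ideal I A \<and> norm_closed A I \<and> S \<subseteq> I}"

text \<open>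
  The quotient by a two-sided *-ideal, with the quotient (semi)norm.  The operations on cosets are
  given in the same style as \<^const>\<open>rcoset_mult\<close>.
\<close>

definition star_quotient :: "('a, 'm) cstar_scheme \<Rightarrow> 'a set \<Rightarrow> 'a set cstar" where
  "star_quotient A I =
    \<lparr>carrier = carrier (A Quot I), monoid.mult = monoid.mult (A Quot I), one = one (A Quot I),
     ring.zero = ring.zero (A Quot I), add = add (A Quot I),
     smult = (\<lambda>c X. \<Union>x\<in>X. I +>\<^bsub>A\<^esub> (c \<odot>\<^bsub>A\<^esub> x)),
     adj = (\<lambda>X. \<Union>x\<in>X. I +>\<^bsub>A\<^esub> adj A x),
     nrm = (\<lambda>X. INF x\<in>X. nrm A x)\<rparr>"


section \<open>Universal C*-algebras\<close>

text \<open>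
  The free unital *-algebra on \<open>G\<close> consists of the finitely supported complex combinations of words
  in letters \<open>(g, False)\<close>, standing for \<open>g\<close>, and \<open>(g, True)\<close>, standing for its adjoint, with
  \<open>g \<in> G\<close>.  Words get their own type because lists have no \<^class>\<open>monoid_add\<close> instance; the product of
  \<^type>\<open>poly_mapping\<close> is then the convolution product.
\<close>

datatype 'g star_word = Word (letters: "('g \<times> bool) list")

instantiation star_word :: (type) monoid_add
begin

definition zero_star_word :: "'a star_word" where "0 = Word []"

definition plus_star_word :: "'a star_word \<Rightarrow> 'a star_word \<Rightarrow> 'a star_word" where
  "v + w = Word (letters v @ letters w)"

instance
  by standard (simp_all add: zero_star_word_def plus_star_word_def)

end

definition word_adj :: "'g star_word \<Rightarrow> 'g star_word" where
  "word_adj w = Word (rev (map (\<lambda>(g, b). (g, \<not> b)) (letters w)))"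

type_synonym 'g star_poly = "'g star_word \<Rightarrow>\<^sub>0 complex"

definition free_star_algebra :: "'g set \<Rightarrow> 'g star_poly set" where
  "free_star_algebra G = {x. \<forall>w\<in>Poly_Mapping.keys x. fst ` set (letters w) \<subseteq> G}"

definition poly_scale :: "complex \<Rightarrow> 'g star_poly \<Rightarrow> 'g star_poly" where
  "poly_scale c x = Poly_Mapping.single 0 c * x"

definition poly_adj :: "'g star_poly \<Rightarrow> 'g star_poly" where
  "poly_adj x = (\<Sum>w\<in>Poly_Mapping.keys x.
     Poly_Mapping.single (word_adj w) (cnj (Poly_Mapping.lookup x w)))"

definition poly_gen :: "'g \<Rightarrow> 'g star_poly" where
  "poly_gen g = Poly_Mapping.single (Word [(g, False)]) 1"

definition cstar_seminorm :: "'g set \<Rightarrow> ('g star_poly \<Rightarrow> real) \<Rightarrow> bool" where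
  "cstar_seminorm G p \<longleftrightarrow> (\<forall>x\<in>free_star_algebra G.
     0 \<le> p x \<and> (\<forall>c. p (poly_scale c x) = cmod c * p x) \<and> p (poly_adj x * x) = (p x)\<^sup>2 \<and>
     (\<forall>y\<in>free_star_algebra G. p (x + y) \<le> p x + p y \<and> p (x * y) \<le> p x * p y))"

text \<open>
  The Hausdorff completion of the free *-algebra in a C*-seminorm: Cauchy sequences modulo null
  sequences.
\<close>

definition cauchy_algebra ::
    "'g set \<Rightarrow> ('g star_poly \<Rightarrow> real) \<Rightarrow> (nat \<Rightarrow> 'g star_poly) cstar" where
  "cauchy_algebra G p =
    \<lparr>carrier = {X. (\<forall>k. X k \<in> free_star_algebra G) \<and>
                   (\<forall>\<epsilon>>0. \<exists>M. \<forall>k\<ge>M. \<forall>l\<ge>M. p (X k - X l) < \<epsilon>)},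
     monoid.mult = (\<lambda>X Y k. X k * Y k), one = (\<lambda>k. 1), ring.zero = (\<lambda>k. 0), add = (\<lambda>X Y k. X k + Y k),
     smult = (\<lambda>c X k. poly_scale c (X k)), adj = (\<lambda>X k. poly_adj (X k)),
     nrm = (\<lambda>X. lim (\<lambda>k. p (X k)))\<rparr>"

definition null_ideal :: "'g set \<Rightarrow> ('g star_poly \<Rightarrow> real) \<Rightarrow> (nat \<Rightarrow> 'g star_poly) set" where
  "null_ideal G p = {X \<in> carrier (cauchy_algebra G p). (\<lambda>k. p (X k)) \<longlonglongrightarrow> 0}"

type_synonym 'g completed = "(nat \<Rightarrow> 'g star_poly) set"

definition completion :: "'g set \<Rightarrow> ('g star_poly \<Rightarrow> real) \<Rightarrow> 'g completed cstar" where
  "completion G p = star_quotient (cauchy_algebra G p) (null_ideal G p)"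

definition to_completion ::
    "'g set \<Rightarrow> ('g star_poly \<Rightarrow> real) \<Rightarrow> 'g star_poly \<Rightarrow> 'g completed" where
  "to_completion G p x = null_ideal G p +>\<^bsub>cauchy_algebra G p\<^esub> (\<lambda>k. x)"

text \<open>
  The universal C*-algebra generated by a family indexed by \<open>G\<close> and having property \<open>P\<close>: complete the
  free *-algebra in the largest C*-seminorm for which the generators have property \<open>P\<close>.  This is
  sensible only if the supremum is finite and itself admissible.  For the two properties used below
  that is the case, see \<open>A_s_universal_property\<close> and \<open>A_h_universal_property\<close>.
\<close>

definition universal_seminorm ::
    "'g set \<Rightarrow> ('g completed cstar \<Rightarrow> ('g \<Rightarrow> 'g completed) \<Rightarrow> bool) \<Rightarrow> 'g star_poly \<Rightarrow> real" where
  "universal_seminorm G P x =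
     (SUP p\<in>{p. cstar_seminorm G p \<and> P (completion G p) (\<lambda>g. to_completion G p (poly_gen g))}. p x)"

definition universal_cstar ::
    "'g set \<Rightarrow> ('g completed cstar \<Rightarrow> ('g \<Rightarrow> 'g completed) \<Rightarrow> bool) \<Rightarrow> 'g completed cstar" where
  "universal_cstar G P = completion G (universal_seminorm G P)"

definition universal_gen ::
    "'g set \<Rightarrow> ('g completed cstar \<Rightarrow> ('g \<Rightarrow> 'g completed) \<Rightarrow> bool) \<Rightarrow> 'g \<Rightarrow> 'g completed" where
  "universal_gen G P g = to_completion G (universal_seminorm G P) (poly_gen g)"


section \<open>Magic and sudoku unitaries, quantum symmetry algebras\<close>

text \<open>Square matrices of size \<open>N\<close> are functions of two indices, evaluated only at indices below \<open>N\<close>.\<close>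

definition projection :: "('a, 'm) cstar_scheme \<Rightarrow> 'a \<Rightarrow> bool" where
  "projection A x \<longleftrightarrow> x \<in> carrier A \<and> adj A x = x \<and> x \<otimes>\<^bsub>A\<^esub> x = x"

definition magic_unitary :: "('a, 'm) cstar_scheme \<Rightarrow> nat \<Rightarrow> (nat \<Rightarrow> nat \<Rightarrow> 'a) \<Rightarrow> bool" where
  "magic_unitary A N u \<longleftrightarrow>
     (\<forall>i<N. \<forall>j<N. projection A (u i j)) \<and>
     (\<forall>i<N. \<forall>j<N. \<forall>k<N. j \<noteq> k \<longrightarrow>
        u i j \<otimes>\<^bsub>A\<^esub> u i k = \<zero>\<^bsub>A\<^esub> \<and> u j i \<otimes>\<^bsub>A\<^esub> u k i = \<zero>\<^bsub>A\<^esub>) \<and>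
     (\<forall>i<N. (\<Oplus>\<^bsub>A\<^esub>j\<in>{..<N}. u i j) = \<one>\<^bsub>A\<^esub> \<and> (\<Oplus>\<^bsub>A\<^esub>j\<in>{..<N}. u j i) = \<one>\<^bsub>A\<^esub>)"

definition sudoku_unitary :: "('a, 'm) cstar_scheme \<Rightarrow> nat \<Rightarrow> (nat \<Rightarrow> nat \<Rightarrow> 'a) \<Rightarrow> bool" where
  "sudoku_unitary A n w \<longleftrightarrow> magic_unitary A (2 * n) w \<and>
     (\<exists>a b. \<forall>i<n. \<forall>j<n. w i j = a i j \<and> w i (n + j) = b i j \<and>
                        w (n + i) j = b i j \<and> w (n + i) (n + j) = a i j)"

definition A_s :: "nat \<Rightarrow> (nat \<times> nat) completed cstar" where
  "A_s N = universal_cstar ({..<N} \<times> {..<N}) (\<lambda>A u. magic_unitary A N (curry u))"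

definition A_s_gen :: "nat \<Rightarrow> nat \<Rightarrow> nat \<Rightarrow> (nat \<times> nat) completed" where
  "A_s_gen N = curry (universal_gen ({..<N} \<times> {..<N}) (\<lambda>A u. magic_unitary A N (curry u)))"

definition A_h :: "nat \<Rightarrow> (nat \<times> nat) completed cstar" where
  "A_h n = universal_cstar ({..<2 * n} \<times> {..<2 * n}) (\<lambda>A w. sudoku_unitary A n (curry w))"

definition A_h_gen :: "nat \<Rightarrow> nat \<Rightarrow> nat \<Rightarrow> (nat \<times> nat) completed" where
  "A_h_gen n = curry (universal_gen ({..<2 * n} \<times> {..<2 * n}) (\<lambda>A w. sudoku_unitary A n (curry w)))"

text \<open>A graph with \<open>N\<close> vertices has vertex set \<^term>\<open>{..<N::nat}\<close> and is given by its set of edges.\<close>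

definition adjacency_matrix :: "nat set set \<Rightarrow> nat \<Rightarrow> nat \<Rightarrow> complex" where
  "adjacency_matrix E i j = (if {i, j} \<in> E then 1 else 0)"

definition segments_graph :: "nat \<Rightarrow> nat set set" where
  "segments_graph n = {{i, n + i} | i. i < n}"

definition commutator_entries ::
    "('a, 'm) cstar_scheme \<Rightarrow> nat \<Rightarrow> (nat \<Rightarrow> nat \<Rightarrow> complex) \<Rightarrow> (nat \<Rightarrow> nat \<Rightarrow> 'a) \<Rightarrow> 'a set" where
  "commutator_entries A N d u =
     {(\<Oplus>\<^bsub>A\<^esub>k\<in>{..<N}. d i k \<odot>\<^bsub>A\<^esub> u k j) \<ominus>\<^bsub>A\<^esub> (\<Oplus>\<^bsub>A\<^esub>k\<in>{..<N}. d k j \<odot>\<^bsub>A\<^esub> u i k) | i j.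
       i < N \<and> j < N}"

definition symmetry_ideal :: "nat \<Rightarrow> nat set set \<Rightarrow> (nat \<times> nat) completed set" where
  "symmetry_ideal N E = closed_ideal_generated (A_s N)
     (commutator_entries (A_s N) N (adjacency_matrix E) (A_s_gen N))"

definition quantum_symmetry_algebra :: "nat \<Rightarrow> nat set set \<Rightarrow> (nat \<times> nat) completed set cstar" where
  "quantum_symmetry_algebra N E = star_quotient (A_s N) (symmetry_ideal N E)"

definition quantum_symmetry_gen ::
    "nat \<Rightarrow> nat set set \<Rightarrow> nat \<Rightarrow> nat \<Rightarrow> (nat \<times> nat) completed set" where
  "quantum_symmetry_gen N E i j = symmetry_ideal N E +>\<^bsub>A_s N\<^esub> A_s_gen N i j"


section \<open>The universal properties\<close>

text \<open>
  The rest of this theory shows that \<^const>\<open>A_s\<close> and \<^const>\<open>A_h\<close> are C*-algebras generated by a magic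
  (respectively sudoku) unitary, and that these are universal: any magic (sudoku) unitary over any
  unital C*-algebra, on any type, is the image of the generating one under a unital *-homomorphism.
\<close>


subsection \<open>The free *-algebra\<close>

lemma letters_zero [simp]: "letters 0 = []"
  by (simp add: zero_star_word_def)

lemma letters_plus [simp]: "letters (v + w) = letters v @ letters w"
  by (simp add: plus_star_word_def)

lemma word_adj_word_adj [simp]: "word_adj (word_adj w) = w"
  by (cases w) (simp add: word_adj_def rev_map comp_def split_def)

lemma word_adj_eq_iff: "word_adj v = w \<longleftrightarrow> v = word_adj w"
  by auto

lemma word_adj_plus [simp]: "word_adj (v + w) = word_adj w + word_adj v"
  by (simp add: word_adj_def plus_star_word_def)

lemma word_adj_0 [simp]: "word_adj 0 = 0"
  by (simp add: word_adj_def zero_star_word_def)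

lemma fst_letters_word_adj [simp]: "fst ` set (letters (word_adj w)) = fst ` set (letters w)"
  by (force simp: word_adj_def image_iff)

lemma lookup_poly_adj: "Poly_Mapping.lookup (poly_adj x) w = cnj (Poly_Mapping.lookup x (word_adj w))"
proof -
  have "Poly_Mapping.lookup (poly_adj x) w =
      (\<Sum>v\<in>Poly_Mapping.keys x. if v = word_adj w then cnj (Poly_Mapping.lookup x v) else 0)"
    unfolding poly_adj_def lookup_sum
    by (intro sum.cong refl) (auto simp: lookup_single when_def word_adj_eq_iff)
  also have "\<dots> = cnj (Poly_Mapping.lookup x (word_adj w))"
    by (auto simp: in_keys_iff)
  finally show ?thesis .
qed

lemma poly_adj_add: "poly_adj (x + y) = poly_adj x + poly_adj y"
  by (rule poly_mapping_eqI) (simp add: lookup_poly_adj lookup_add)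

lemma poly_adj_minus: "poly_adj (x - y) = poly_adj x - poly_adj y"
  by (rule poly_mapping_eqI) (simp add: lookup_poly_adj lookup_minus)

lemma poly_adj_poly_adj [simp]: "poly_adj (poly_adj x) = x"
  by (rule poly_mapping_eqI) (simp add: lookup_poly_adj)

lemma poly_adj_single [simp]: "poly_adj (Poly_Mapping.single w c) = Poly_Mapping.single (word_adj w) (cnj c)"
  by (rule poly_mapping_eqI) (auto simp add: lookup_poly_adj lookup_single when_def word_adj_eq_iff)

lemma poly_eq_sum:
  "x = (\<Sum>w\<in>Poly_Mapping.keys x. Poly_Mapping.single w (Poly_Mapping.lookup x w))"
  by (rule poly_mapping_eqI) (simp add: lookup_sum lookup_single when_def in_keys_iff)

lemma free_0 [simp]: "0 \<in> free_star_algebra G"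
  by (simp add: free_star_algebra_def)

lemma free_single: "fst ` set (letters w) \<subseteq> G \<Longrightarrow> Poly_Mapping.single w c \<in> free_star_algebra G"
  by (simp add: free_star_algebra_def)

lemma free_1 [simp]: "1 \<in> free_star_algebra G"
  by (simp add: free_star_algebra_def)

lemma free_add: "x \<in> free_star_algebra G \<Longrightarrow> y \<in> free_star_algebra G \<Longrightarrow> x + y \<in> free_star_algebra G"
  using Poly_Mapping.keys_add[of x y] by (fastforce simp add: free_star_algebra_def)

lemma free_mult: "x \<in> free_star_algebra G \<Longrightarrow> y \<in> free_star_algebra G \<Longrightarrow> x * y \<in> free_star_algebra G"
  using keys_mult[of x y] by (fastforce simp add: free_star_algebra_def)

lemma free_scale: "x \<in> free_star_algebra G \<Longrightarrow> poly_scale c x \<in> free_star_algebra G"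
  unfolding poly_scale_def by (intro free_mult free_single) auto

lemma free_uminus: "x \<in> free_star_algebra G \<Longrightarrow> - x \<in> free_star_algebra G"
  by (simp add: free_star_algebra_def)

lemma free_minus: "x \<in> free_star_algebra G \<Longrightarrow> y \<in> free_star_algebra G \<Longrightarrow> x - y \<in> free_star_algebra G"
  using free_add[of x G "- y"] free_uminus[of y G] by simp

lemma free_adj: "x \<in> free_star_algebra G \<Longrightarrow> poly_adj x \<in> free_star_algebra G"
proof -
  assume x: "x \<in> free_star_algebra G"
  have "fst ` set (letters w) \<subseteq> G" if "w \<in> Poly_Mapping.keys (poly_adj x)" for w
  proof -
    have "word_adj w \<in> Poly_Mapping.keys x"
      using that by (simp add: in_keys_iff lookup_poly_adj)
    with x have "fst ` set (letters (word_adj w)) \<subseteq> G"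
      unfolding free_star_algebra_def by blast
    then show ?thesis
      by (simp only: fst_letters_word_adj)
  qed
  then show ?thesis
    unfolding free_star_algebra_def by blast
qed

lemma free_gen: "g \<in> G \<Longrightarrow> poly_gen g \<in> free_star_algebra G"
  unfolding poly_gen_def by (rule free_single) auto

lemma free_sum: "(\<And>i. i \<in> I \<Longrightarrow> f i \<in> free_star_algebra G) \<Longrightarrow> sum f I \<in> free_star_algebra G"
  by (induction I rule: infinite_finite_induct) (auto intro: free_add)

lemma free_induct [consumes 1, case_names single add]:
  assumes x: "x \<in> free_star_algebra G"
    and single: "\<And>w c. fst ` set (letters w) \<subseteq> G \<Longrightarrow> Q (Poly_Mapping.single w c)"
    and add: "\<And>x y. \<lbrakk>x \<in> free_star_algebra G; y \<in> free_star_algebra G; Q x; Q y\<rbrakk> \<Longrightarrow> Q (x + y)"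
  shows "Q x"
proof -
  have "finite K \<Longrightarrow> K \<subseteq> Poly_Mapping.keys x \<Longrightarrow>
    (\<Sum>w\<in>K. Poly_Mapping.single w (Poly_Mapping.lookup x w)) \<in> free_star_algebra G \<and>
    Q (\<Sum>w\<in>K. Poly_Mapping.single w (Poly_Mapping.lookup x w))" for K
  proof (induction K rule: finite_induct)
    case empty
    then show ?case using single[of 0 0] by simp
  next
    case (insert w K)
    then have "fst ` set (letters w) \<subseteq> G"
      using x by (auto simp: free_star_algebra_def)
    then show ?case using insert by (auto intro!: add free_add free_single single)
  qed
  from this[of "Poly_Mapping.keys x"] show ?thesis
    by (simp flip: poly_eq_sum)
qed

lemma free_UNIV: "x \<in> free_star_algebra UNIV"
  by (simp add: free_star_algebra_def)

lemma poly_adj_mult: "poly_adj (x * y) = poly_adj y * poly_adj x"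
proof (induction x rule: free_induct[OF free_UNIV])
  case (1 w c)
  show ?case
    by (induction y rule: free_induct[OF free_UNIV])
      (simp_all add: mult_single poly_adj_add algebra_simps)
qed (simp add: poly_adj_add algebra_simps)

lemma poly_adj_1 [simp]: "poly_adj 1 = 1"
  by (simp flip: single_one)

lemma single_0_commute: "Poly_Mapping.single 0 c * x = x * Poly_Mapping.single 0 (c :: complex)"
  for x :: "'g star_poly"
  by (induction x rule: free_induct[OF free_UNIV]) (simp_all add: mult_single algebra_simps)

lemma poly_scale_add: "poly_scale c (x + y) = poly_scale c x + poly_scale c y"
  by (simp add: poly_scale_def distrib_left)

lemma poly_scale_add_left: "poly_scale (c + d) x = poly_scale c x + poly_scale d x"
  by (simp add: poly_scale_def single_add distrib_right)

lemma poly_scale_scale: "poly_scale (c * d) x = poly_scale c (poly_scale d x)"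
  by (simp add: poly_scale_def mult_single flip: mult.assoc)

lemma poly_scale_1 [simp]: "poly_scale 1 x = x"
  by (simp add: poly_scale_def)

lemma poly_scale_neg: "poly_scale (- 1) x = - x"
  by (simp add: poly_scale_def single_uminus)

lemma poly_scale_mult_l: "poly_scale c x * y = poly_scale c (x * y)"
  by (simp add: poly_scale_def mult.assoc)

lemma poly_scale_mult_r: "x * poly_scale c y = poly_scale c (x * y)"
  unfolding poly_scale_def by (metis mult.assoc single_0_commute)

lemma poly_adj_scale: "poly_adj (poly_scale c x) = poly_scale (cnj c) (poly_adj x)"
  by (simp add: poly_scale_def poly_adj_mult single_0_commute)

lemma poly_scale_single: "poly_scale c (Poly_Mapping.single w d) = Poly_Mapping.single w (c * d)"
  by (simp add: poly_scale_def mult_single)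

subsection \<open>Quotients of *-algebras\<close>

lemma complex_ring_simps [simp]:
  "carrier complex_ring = UNIV" "a \<otimes>\<^bsub>complex_ring\<^esub> b = a * b" "\<one>\<^bsub>complex_ring\<^esub> = 1"
  "\<zero>\<^bsub>complex_ring\<^esub> = 0" "a \<oplus>\<^bsub>complex_ring\<^esub> b = a + b"
  by (simp_all add: complex_ring_def)

lemma complex_ring_cring: "cring complex_ring"
proof (rule cringI)
  show "abelian_group complex_ring"
    by (rule abelian_groupI) (auto intro: exI[of _ "- x" for x])
  show "comm_monoid complex_ring"
    by (rule comm_monoidI) auto
qed (simp add: algebra_simps)

lemma complex_ring_neg [simp]: "\<ominus>\<^bsub>complex_ring\<^esub> a = - a"
  by (rule abelian_group.minus_equality[OF ring.is_abelian_group[OF cring.axioms(1)[OF complex_ring_cring]]])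
    simp_all

locale star_ideal = star_algebra A + ideal I A for A :: "('a, 'm) cstar_scheme" (structure) and I +
  assumes adj_in: "x \<in> I \<Longrightarrow> adj A x \<in> I"
begin

abbreviation "Q \<equiv> star_quotient A I"

lemma coset_eq_iff:
  assumes "x \<in> carrier A" "y \<in> carrier A"
  shows "I +> x = I +> y \<longleftrightarrow> x \<ominus> y \<in> I"
proof
  assume "I +> x = I +> y"
  then show "x \<ominus> y \<in> I"
    using a_rcos_self[of x] a_rcos_module_minus[OF ring_axioms, of y x] assms by auto
next
  assume "x \<ominus> y \<in> I"
  then have "x \<in> I +> y"
    using a_rcos_module_minus[OF ring_axioms, of y x] assms by auto
  then show "I +> x = I +> y"
    using a_repr_independence'[of x y] assms by simp
qed

lemma smult_in: "x \<in> I \<Longrightarrow> c \<odot> x \<in> I"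
  using smult_mult_l[of \<one> x c] I_l_closed[of x "c \<odot> \<one>"] C.smult_closed[of c \<one>] Icarr[of x]
  by simp

lemma smult_diff:
  assumes "x \<in> carrier A" "y \<in> carrier A"
  shows "c \<odot> (x \<ominus> y) = c \<odot> x \<ominus> c \<odot> y"
  using assms C.smult_r_distr[of c x "\<ominus> y"] C.smult_r_minus[of c y] by (simp add: a_minus_def)

lemma adj_diff:
  assumes "x \<in> carrier A" "y \<in> carrier A"
  shows "adj A (x \<ominus> y) = adj A x \<ominus> adj A y"
proof -
  have "adj A (x \<ominus> y) \<oplus> adj A y = adj A x"
    using assms adj_add[of "x \<ominus> y" y] by (simp add: a_minus_def a_assoc l_neg)
  then show ?thesis
    using assms adj_closed
    by (metis a_minus_def add.inv_solve_right minus_closed)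
qed

lemma Q_carrier: "carrier Q = (\<lambda>x. I +> x) ` carrier A"
  by (auto simp: star_quotient_def FactRing_simps A_RCOSETS_def')

lemma Q_carrierE:
  assumes "z \<in> carrier Q"
  obtains x where "x \<in> carrier A" "z = I +> x"
  using assms by (auto simp: Q_carrier)

lemma coset_in: "x \<in> carrier A \<Longrightarrow> I +> x \<in> carrier Q"
  by (auto simp: Q_carrier)

lemma Q_mult: "x \<in> carrier A \<Longrightarrow> y \<in> carrier A \<Longrightarrow> (I +> x) \<otimes>\<^bsub>Q\<^esub> (I +> y) = I +> (x \<otimes> y)"
  by (simp add: star_quotient_def FactRing_simps rcoset_mult_add)

lemma Q_add: "x \<in> carrier A \<Longrightarrow> y \<in> carrier A \<Longrightarrow> (I +> x) \<oplus>\<^bsub>Q\<^esub> (I +> y) = I +> (x \<oplus> y)"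
  by (simp add: star_quotient_def FactRing_simps a_rcos_sum)

lemma Q_one: "\<one>\<^bsub>Q\<^esub> = I +> \<one>"
  by (simp add: star_quotient_def FactRing_simps)

lemma Q_zero: "\<zero>\<^bsub>Q\<^esub> = I +> \<zero>"
  using a_coset_add_zero[OF a_subset] by (simp add: star_quotient_def FactRing_simps)

lemma mem_coset:
  assumes "x \<in> carrier A"
  shows "y \<in> I +> x \<longleftrightarrow> y \<in> carrier A \<and> y \<ominus> x \<in> I"
  using assms a_rcos_module_minus[OF ring_axioms, of x y] a_r_coset_subset_G[OF a_subset assms]
  by auto

lemma Q_smult: "x \<in> carrier A \<Longrightarrow> c \<odot>\<^bsub>Q\<^esub> (I +> x) = I +> (c \<odot> x)"
proof -
  assume x: "x \<in> carrier A"
  have "I +> (c \<odot> y) = I +> (c \<odot> x)" if "y \<in> I +> x" for y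
    using that x smult_in[of "y \<ominus> x" c]
    by (simp add: coset_eq_iff mem_coset C.smult_closed smult_diff)
  then have "(\<Union>y\<in>I +> x. I +> (c \<odot> y)) = I +> (c \<odot> x)"
    using a_rcos_self[OF x] by (intro SUP_eq_const) blast+
  then show ?thesis
    by (simp add: star_quotient_def)
qed

lemma Q_adj: "x \<in> carrier A \<Longrightarrow> adj Q (I +> x) = I +> adj A x"
proof -
  assume x: "x \<in> carrier A"
  have "I +> adj A y = I +> adj A x" if "y \<in> I +> x" for y
    using that x adj_in[of "y \<ominus> x"]
    by (simp add: coset_eq_iff mem_coset adj_closed adj_diff)
  then have "(\<Union>y\<in>I +> x. I +> adj A y) = I +> adj A x"
    using a_rcos_self[OF x] by (intro SUP_eq_const) blast+
  then show ?thesis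
    by (simp add: star_quotient_def)
qed

lemmas Q_simps = Q_mult Q_add Q_one Q_zero Q_smult Q_adj

lemma Q_star_algebra: "star_algebra Q"
proof -
  have ag: "abelian_group Q"
  proof (rule abelian_groupI)
    fix x assume "x \<in> carrier Q"
    then obtain x' where x: "x' \<in> carrier A" "x = I +> x'" by (rule Q_carrierE)
    then show "\<exists>y\<in>carrier Q. y \<oplus>\<^bsub>Q\<^esub> x = \<zero>\<^bsub>Q\<^esub>"
      by (intro bexI[of _ "I +> (\<ominus> x')"]) (simp_all add: Q_simps coset_in l_neg)
  qed (auto elim!: Q_carrierE simp: Q_simps coset_in a_ac)
  have mon: "monoid Q"
    by (rule monoidI) (auto elim!: Q_carrierE simp: Q_simps coset_in m_assoc)
  have ring: "ring Q"
    using ag mon by (rule ringI) (auto elim!: Q_carrierE simp: Q_simps l_distr r_distr)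
  have module: "module complex_ring Q"
    using complex_ring_cring ag
    by (rule moduleI)
      (auto elim!: Q_carrierE simp: Q_simps coset_in C.smult_closed C.smult_r_distr
        C.smult_l_distr[simplified] C.smult_assoc1[simplified] C.smult_one[simplified])
  show ?thesis
    by (intro star_algebra.intro ring module star_algebra_axioms.intro)
      (auto elim!: Q_carrierE simp: Q_simps coset_in C.smult_closed adj_closed
        smult_mult_l smult_mult_r adj_adj adj_add adj_smult adj_mult)
qed

lemma Q_minus: "x \<in> carrier A \<Longrightarrow> y \<in> carrier A \<Longrightarrow> (I +> x) \<ominus>\<^bsub>Q\<^esub> (I +> y) = I +> (x \<ominus> y)"
proof -
  assume xy: "x \<in> carrier A" "y \<in> carrier A"
  interpret Q: star_algebra Q by (rule Q_star_algebra)
  have "(I +> (x \<ominus> y)) \<oplus>\<^bsub>Q\<^esub> (I +> y) = I +> x"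
    using xy by (simp add: Q_add a_minus_def a_assoc l_neg)
  then show ?thesis
    using xy coset_in Q.add.inv_solve_right[of "I +> (x \<ominus> y)" "I +> x" "I +> y"]
    by (simp add: a_minus_def[of Q])
qed

end

subsection \<open>The completion is a C*-algebra\<close>

locale star_seminorm =
  fixes G :: "'g set" and p :: "'g star_poly \<Rightarrow> real"
  assumes cstar_seminorm: "cstar_seminorm G p"
begin

abbreviation "F \<equiv> free_star_algebra G"
abbreviation "S \<equiv> cauchy_algebra G p"
abbreviation "N \<equiv> null_ideal G p"

lemma p_nonneg: "x \<in> F \<Longrightarrow> 0 \<le> p x"
  and p_scale: "x \<in> F \<Longrightarrow> p (poly_scale c x) = cmod c * p x"
  and p_cstar: "x \<in> F \<Longrightarrow> p (poly_adj x * x) = (p x)\<^sup>2"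
  and p_add: "x \<in> F \<Longrightarrow> y \<in> F \<Longrightarrow> p (x + y) \<le> p x + p y"
  and p_mult: "x \<in> F \<Longrightarrow> y \<in> F \<Longrightarrow> p (x * y) \<le> p x * p y"
  using cstar_seminorm by (auto simp: cstar_seminorm_def)

lemma p_neg: "x \<in> F \<Longrightarrow> p (- x) = p x"
  using p_scale[of x "- 1"] by (simp add: poly_scale_neg)

lemma p_0: "p 0 = 0"
  using p_scale[of 0 0] by (simp add: poly_scale_def)

lemma p_diff_commute: "x \<in> F \<Longrightarrow> y \<in> F \<Longrightarrow> p (x - y) = p (y - x)"
  using p_neg[of "x - y"] by (simp add: free_minus)

lemma p_diff_triangle: "x \<in> F \<Longrightarrow> y \<in> F \<Longrightarrow> z \<in> F \<Longrightarrow> p (x - z) \<le> p (x - y) + p (y - z)"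
  using p_add[of "x - y" "y - z"] by (simp add: free_minus)

lemma p_abs_diff: "x \<in> F \<Longrightarrow> y \<in> F \<Longrightarrow> \<bar>p x - p y\<bar> \<le> p (x - y)"
  using p_add[of "x - y" y] p_add[of "y - x" x] p_diff_commute[of x y] by (simp add: free_minus)

lemma p_adj_le: "x \<in> F \<Longrightarrow> p x \<le> p (poly_adj x)"
proof -
  assume x: "x \<in> F"
  have "p x * p x \<le> p (poly_adj x) * p x"
    using p_mult[of "poly_adj x" x] p_cstar[of x] x by (simp add: free_adj power2_eq_square)
  then show ?thesis
    using p_nonneg[OF x] p_nonneg[OF free_adj[OF x]] by (cases "p x = 0") auto
qed

lemma p_adj: "x \<in> F \<Longrightarrow> p (poly_adj x) = p x"
  using p_adj_le[of x] p_adj_le[of "poly_adj x"] by (simp add: free_adj)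

lemma S_free: "X \<in> carrier S \<Longrightarrow> X k \<in> F"
  by (simp add: cauchy_algebra_def)

lemma S_cauchy: "X \<in> carrier S \<Longrightarrow> \<epsilon> > 0 \<Longrightarrow> \<exists>M. \<forall>k\<ge>M. \<forall>l\<ge>M. p (X k - X l) < \<epsilon>"
  by (simp add: cauchy_algebra_def)

lemma S_convergent: "X \<in> carrier S \<Longrightarrow> convergent (\<lambda>k. p (X k))"
proof -
  assume X: "X \<in> carrier S"
  have "Cauchy (\<lambda>k. p (X k))"
  proof (rule metric_CauchyI)
    fix e :: real assume "e > 0"
    then obtain M where M: "\<forall>k\<ge>M. \<forall>l\<ge>M. p (X k - X l) < e"
      using S_cauchy[OF X] by blast
    show "\<exists>M. \<forall>m\<ge>M. \<forall>n\<ge>M. dist (p (X m)) (p (X n)) < e"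
    proof (intro exI[of _ M] allI impI)
      fix m n assume "M \<le> m" "M \<le> n"
      then show "dist (p (X m)) (p (X n)) < e"
        using M p_abs_diff[OF S_free[OF X, of m] S_free[OF X, of n]]
        by (metis dist_real_def le_less_trans)
    qed
  qed
  then show ?thesis by (simp add: Cauchy_convergent_iff)
qed

lemma S_nrm: "X \<in> carrier S \<Longrightarrow> (\<lambda>k. p (X k)) \<longlonglongrightarrow> nrm S X"
  using S_convergent by (simp add: cauchy_algebra_def convergent_LIMSEQ_iff)

lemma S_bounded: 
  assumes "X \<in> carrier S"
  obtains K where "K \<ge> 0" "\<And>k. p (X k) \<le> K"
proof -
  have "Bseq (\<lambda>k. p (X k))"
    by (rule convergent_imp_Bseq[OF S_convergent[OF assms]])
  then obtain K where "K > 0" "\<And>k. \<bar>p (X k)\<bar> \<le> K"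
    by (auto simp: Bseq_def)
  then show ?thesis
    using that[of K] by (meson abs_le_D1 less_imp_le)
qed

lemma S_intro:
  assumes "\<And>k. Z k \<in> F" and X: "X \<in> carrier S" and Y: "Y \<in> carrier S" and K: "K \<ge> 0"
    and le: "\<And>k l. p (Z k - Z l) \<le> K * (p (X k - X l) + p (Y k - Y l))"
  shows "Z \<in> carrier S"
proof -
  have "\<exists>M. \<forall>k\<ge>M. \<forall>l\<ge>M. p (Z k - Z l) < \<epsilon>" if e: "\<epsilon> > 0" for \<epsilon> :: real
  proof -
    define d where "d = \<epsilon> / (K + 1) / 2"
    have "d + d = \<epsilon> / (K + 1)" by (simp only: d_def field_sum_of_halves)
    then have d: "d > 0" "(K + 1) * (d + d) = \<epsilon>" using e K by (simp_all add: d_def)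
    obtain M1 where M1: "\<forall>k\<ge>M1. \<forall>l\<ge>M1. p (X k - X l) < d"
      using S_cauchy[OF X d(1)] by blast
    obtain M2 where M2: "\<forall>k\<ge>M2. \<forall>l\<ge>M2. p (Y k - Y l) < d"
      using S_cauchy[OF Y d(1)] by blast
    show ?thesis
    proof (intro exI[of _ "max M1 M2"] allI impI)
      fix k l assume kl: "max M1 M2 \<le> k" "max M1 M2 \<le> l"
      have "0 \<le> p (X k - X l)" "0 \<le> p (Y k - Y l)"
        using X Y by (simp_all add: p_nonneg free_minus S_free)
      then have "K * (p (X k - X l) + p (Y k - Y l)) \<le> (K + 1) * (p (X k - X l) + p (Y k - Y l))"
        by (intro mult_right_mono) auto
      also have "p (X k - X l) < d" "p (Y k - Y l) < d"
        using M1 M2 kl by auto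
      then have "(K + 1) * (p (X k - X l) + p (Y k - Y l)) < (K + 1) * (d + d)"
        using K by (intro mult_strict_left_mono add_strict_mono) auto
      finally show "p (Z k - Z l) < \<epsilon>" using le[of k l] d(2) by simp
    qed
  qed
  then show ?thesis using assms(1) by (simp add: cauchy_algebra_def)
qed

lemma S_const: "x \<in> F \<Longrightarrow> (\<lambda>k. x) \<in> carrier S"
  by (simp add: cauchy_algebra_def p_0)

lemma S_add_in: "X \<in> carrier S \<Longrightarrow> Y \<in> carrier S \<Longrightarrow> (\<lambda>k. X k + Y k) \<in> carrier S"
proof (rule S_intro[of _ X Y 1])
  fix k l assume XY: "X \<in> carrier S" "Y \<in> carrier S"
  have "p ((X k - X l) + (Y k - Y l)) \<le> p (X k - X l) + p (Y k - Y l)"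
    using XY by (intro p_add free_minus S_free)
  then show "p (X k + Y k - (X l + Y l)) \<le> 1 * (p (X k - X l) + p (Y k - Y l))"
    by (simp add: algebra_simps)
qed (auto intro: free_add S_free)

lemma S_scale_in: "X \<in> carrier S \<Longrightarrow> (\<lambda>k. poly_scale c (X k)) \<in> carrier S"
proof (rule S_intro[of _ X X "cmod c"])
  fix k l assume X: "X \<in> carrier S"
  have "poly_scale c (X k) - poly_scale c (X l) = poly_scale c (X k - X l)"
    by (simp add: poly_scale_def right_diff_distrib)
  then show "p (poly_scale c (X k) - poly_scale c (X l)) \<le> cmod c * (p (X k - X l) + p (X k - X l))"
    using X p_nonneg[of "X k - X l"] by (simp add: p_scale free_minus S_free mult_left_mono)
qed (auto intro: free_scale S_free)

lemma S_neg_in: "X \<in> carrier S \<Longrightarrow> (\<lambda>k. - X k) \<in> carrier S"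
  using S_scale_in[of X "- 1"] by (simp add: poly_scale_neg)

lemma S_adj_in: "X \<in> carrier S \<Longrightarrow> (\<lambda>k. poly_adj (X k)) \<in> carrier S"
proof (rule S_intro[of _ X X 1])
  fix k l assume X: "X \<in> carrier S"
  then show "p (poly_adj (X k) - poly_adj (X l)) \<le> 1 * (p (X k - X l) + p (X k - X l))"
    using p_nonneg[of "X k - X l"] by (simp add: p_adj free_minus S_free flip: poly_adj_minus)
qed (auto intro: free_adj S_free)

lemma S_mult_in: 
  assumes X: "X \<in> carrier S" and Y: "Y \<in> carrier S" 
  shows "(\<lambda>k. X k * Y k) \<in> carrier S"
proof -
  obtain K where K: "K \<ge> 0" "\<And>k. p (X k) \<le> K" using S_bounded[OF X] by blast
  obtain L where L: "L \<ge> 0" "\<And>k. p (Y k) \<le> L" using S_bounded[OF Y] by blast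
  show ?thesis
  proof (rule S_intro[of _ X Y "K + L"])
    fix k l
    note [intro] = free_minus free_mult S_free X Y p_nonneg
    have "X k * Y k - X l * Y l = X k * (Y k - Y l) + (X k - X l) * Y l"
      by (simp add: algebra_simps)
    then have "p (X k * Y k - X l * Y l) \<le> p (X k * (Y k - Y l)) + p ((X k - X l) * Y l)"
      by (metis p_add free_minus free_mult S_free X Y)
    also have "p (X k * (Y k - Y l)) \<le> p (X k) * p (Y k - Y l)"
      by (intro p_mult) auto
    also have "\<dots> \<le> (K + L) * p (Y k - Y l)"
      using K(2)[of k] L(1) by (intro mult_right_mono) auto
    also have "p ((X k - X l) * Y l) \<le> p (X k - X l) * p (Y l)"
      by (intro p_mult) auto
    also have "\<dots> \<le> p (X k - X l) * (K + L)"
      using L(2)[of l] K(1) by (intro mult_left_mono) auto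
    finally show "p (X k * Y k - X l * Y l) \<le> (K + L) * (p (X k - X l) + p (Y k - Y l))"
      by (simp add: algebra_simps)
  qed (use K L X Y in \<open>auto intro: free_mult S_free\<close>)
qed

lemma S_simps:
  "X \<otimes>\<^bsub>S\<^esub> Y = (\<lambda>k. X k * Y k)" "\<one>\<^bsub>S\<^esub> = (\<lambda>k. 1)" "\<zero>\<^bsub>S\<^esub> = (\<lambda>k. 0)"
  "X \<oplus>\<^bsub>S\<^esub> Y = (\<lambda>k. X k + Y k)" "c \<odot>\<^bsub>S\<^esub> X = (\<lambda>k. poly_scale c (X k))"
  "adj S X = (\<lambda>k. poly_adj (X k))"
  by (simp_all add: cauchy_algebra_def)

sublocale S: star_algebra S
proof -
  have ag: "abelian_group S"
  proof (rule abelian_groupI)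
    fix X assume "X \<in> carrier S"
    then show "\<exists>Y\<in>carrier S. Y \<oplus>\<^bsub>S\<^esub> X = \<zero>\<^bsub>S\<^esub>"
      by (intro bexI[of _ "\<lambda>k. - X k"]) (simp_all add: S_simps S_neg_in)
  qed (auto simp: S_simps S_const S_add_in algebra_simps)
  have mon: "monoid S"
    by (rule monoidI) (auto simp: S_simps S_const S_mult_in mult.assoc)
  have ring: "ring S"
    using ag mon by (rule ringI) (auto simp: S_simps algebra_simps)
  have module: "module complex_ring S"
    using complex_ring_cring ag
    by (rule moduleI)
      (auto simp: S_simps S_scale_in poly_scale_add poly_scale_add_left poly_scale_scale)
  show "star_algebra S"
    by (intro star_algebra.intro ring module star_algebra_axioms.intro)
      (auto simp: S_simps S_adj_in poly_scale_mult_l poly_scale_mult_r poly_adj_add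
        poly_adj_scale poly_adj_mult)
qed

lemma S_minus: "X \<in> carrier S \<Longrightarrow> Y \<in> carrier S \<Longrightarrow> X \<ominus>\<^bsub>S\<^esub> Y = (\<lambda>k. X k - Y k)"
proof -
  assume XY: "X \<in> carrier S" "Y \<in> carrier S"
  have "(\<lambda>k. X k - Y k) \<in> carrier S"
    using S_add_in[OF XY(1) S_neg_in[OF XY(2)]] by simp
  then show ?thesis
    using XY S.add.inv_solve_right[of "\<lambda>k. X k - Y k" X Y] by (simp add: a_minus_def S_simps)
qed

lemma null_intro:
  assumes "X \<in> carrier S" "g \<longlonglongrightarrow> 0" "\<And>k. p (X k) \<le> g k"
  shows "X \<in> N"
  using assms tendsto_sandwich[of "\<lambda>k. 0" "\<lambda>k. p (X k)" sequentially g 0]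
  by (auto simp: null_ideal_def p_nonneg S_free)

lemma null_lim: "X \<in> N \<Longrightarrow> (\<lambda>k. p (X k)) \<longlonglongrightarrow> 0"
  by (simp add: null_ideal_def)

lemma null_iff: "X \<in> carrier S \<Longrightarrow> X \<in> N \<longleftrightarrow> nrm S X = 0"
  using S_nrm[of X] by (auto simp: null_ideal_def dest: LIMSEQ_unique)

sublocale S: star_ideal S N
proof -
  have sub: "N \<subseteq> carrier S" by (auto simp: null_ideal_def)
  note lim = null_lim
  have "subgroup N (add_monoid S)"
  proof (rule S.add.subgroupI)
    show "N \<noteq> {}"
      using S_const[of 0] by (auto simp: null_ideal_def p_0 intro!: exI[of _ "\<lambda>k. 0"])
    show "\<ominus>\<^bsub>S\<^esub> X \<in> N" if "X \<in> N" for X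
    proof -
      have "X \<in> carrier S" using that sub by auto
      have "\<ominus>\<^bsub>S\<^esub> X = (\<lambda>k. - X k)"
        using S_minus[OF S_const[of 0] \<open>X \<in> carrier S\<close>] \<open>X \<in> carrier S\<close>
        by (simp add: a_minus_def S.l_zero[unfolded S_simps])
          (metis S.a_inv_closed S.l_zero S_simps(3) S_simps(4))
      then show ?thesis
        using that \<open>X \<in> carrier S\<close> by (auto simp: null_ideal_def S_neg_in p_neg S_free)
    qed
    show "X \<oplus>\<^bsub>S\<^esub> Y \<in> N" if XY: "X \<in> N" "Y \<in> N" for X Y
    proof (rule null_intro)
      show "(\<lambda>k. p (X k) + p (Y k)) \<longlonglongrightarrow> 0"
        using tendsto_add[OF lim[OF XY(1)] lim[OF XY(2)]] by simp
    qed (use XY sub in \<open>auto simp: S_simps intro: S_add_in p_add S_free\<close>)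
  qed (use sub in auto)
  moreover have "Y \<otimes>\<^bsub>S\<^esub> X \<in> N" "X \<otimes>\<^bsub>S\<^esub> Y \<in> N" if XY: "X \<in> N" "Y \<in> carrier S" for X Y
  proof -
    have X: "X \<in> carrier S" using XY sub by auto
    obtain K where K: "K \<ge> 0" "\<And>k. p (Y k) \<le> K" using S_bounded[OF XY(2)] by blast
    have lim0: "(\<lambda>k. K * p (X k)) \<longlonglongrightarrow> 0"
      using tendsto_mult_left[OF lim[OF XY(1)], of K] by simp
    show "Y \<otimes>\<^bsub>S\<^esub> X \<in> N"
    proof (rule null_intro[OF _ lim0])
      fix k
      have "p (Y k * X k) \<le> p (Y k) * p (X k)"
        using X XY by (intro p_mult S_free)
      also have "\<dots> \<le> K * p (X k)"
        using X by (intro mult_right_mono K p_nonneg S_free)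
      finally show "p ((Y \<otimes>\<^bsub>S\<^esub> X) k) \<le> K * p (X k)" by (simp add: S_simps)
    qed (use X XY in auto)
    show "X \<otimes>\<^bsub>S\<^esub> Y \<in> N"
    proof (rule null_intro[OF _ lim0])
      fix k
      have "p (X k * Y k) \<le> p (X k) * p (Y k)"
        using X XY by (intro p_mult S_free)
      also have "\<dots> \<le> p (X k) * K"
        using X by (intro mult_left_mono K p_nonneg S_free)
      finally show "p ((X \<otimes>\<^bsub>S\<^esub> Y) k) \<le> K * p (X k)" by (simp add: S_simps mult.commute)
    qed (use X XY in auto)
  qed
  ultimately have "ideal N S"
    by (intro idealI S.ring_axioms) auto
  moreover have "adj S X \<in> N" if "X \<in> N" for X
    using that sub by (auto simp: null_ideal_def S_simps S_adj_in p_adj S_free)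
  ultimately show "star_ideal S N"
    by (intro star_ideal.intro star_ideal_axioms.intro S.star_algebra_axioms)
qed

abbreviation "B \<equiv> completion G p"
abbreviation "\<iota> \<equiv> to_completion G p"
abbreviation "cls X \<equiv> N +>\<^bsub>S\<^esub> X"

lemma B_def: "B = star_quotient S N"
  by (simp add: completion_def)

sublocale B: star_algebra B
  unfolding completion_def by (rule S.Q_star_algebra)

lemma nrm_cls: "X \<in> carrier S \<Longrightarrow> nrm B (cls X) = nrm S X"
proof -
  assume X: "X \<in> carrier S"
  have "nrm S Y = nrm S X" if "Y \<in> cls X" for Y
  proof -
    have Y: "Y \<in> carrier S" "(\<lambda>k. Y k - X k) \<in> N"
      using that X S.mem_coset[of X Y] S_minus[of Y X] by auto
    have "(\<lambda>k. p (Y k) - p (X k)) \<longlonglongrightarrow> 0"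
    proof (rule tendsto_0_le[where K = 1])
      show "(\<lambda>k. p (Y k - X k)) \<longlonglongrightarrow> 0" by (rule null_lim[OF Y(2)])
      have "\<bar>p (Y k) - p (X k)\<bar> \<le> \<bar>p (Y k - X k)\<bar>" for k
        using p_abs_diff[OF S_free[OF Y(1), of k] S_free[OF X, of k]] by linarith
      then show "\<forall>\<^sub>F k in sequentially. norm (p (Y k) - p (X k)) \<le> norm (p (Y k - X k)) * 1"
        by simp
    qed
    then have "(\<lambda>k. (p (Y k) - p (X k)) + p (X k)) \<longlonglongrightarrow> 0 + nrm S X"
      using S_nrm[OF X] by (intro tendsto_add)
    then show ?thesis
      using S_nrm[OF Y(1)] by (auto dest: LIMSEQ_unique)
  qed
  then have "(INF Y\<in>cls X. nrm S Y) = (INF Y\<in>cls X. nrm S X)"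
    by (intro INF_cong refl)
  also have "\<dots> = nrm S X"
    using S.a_rcos_self[OF X] by (intro cINF_const) auto
  finally show ?thesis
    by (simp add: completion_def star_quotient_def)
qed

lemma nrm_cls_lim: "X \<in> carrier S \<Longrightarrow> (\<lambda>k. p (X k)) \<longlonglongrightarrow> nrm B (cls X)"
  by (simp add: nrm_cls S_nrm)

lemmas B_carrierE = S.Q_carrierE[folded completion_def]
lemmas B_in = S.coset_in[folded completion_def]
lemmas B_simps = S.Q_simps[folded completion_def, unfolded S_simps]
lemmas B_minus = S.Q_minus[folded completion_def]

lemma nrm_\<iota>: "x \<in> F \<Longrightarrow> nrm B (\<iota> x) = p x"
  using LIMSEQ_unique[OF nrm_cls_lim[OF S_const[of x]] tendsto_const[of "p x"]]
  by (simp add: to_completion_def)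

lemma \<iota>_in: "x \<in> F \<Longrightarrow> \<iota> x \<in> carrier B"
  by (simp add: to_completion_def B_in S_const)

lemma \<iota>_hom:
  assumes "x \<in> F" "y \<in> F"
  shows "\<iota> (x + y) = \<iota> x \<oplus>\<^bsub>B\<^esub> \<iota> y" "\<iota> (x * y) = \<iota> x \<otimes>\<^bsub>B\<^esub> \<iota> y" 
    "\<iota> (x - y) = \<iota> x \<ominus>\<^bsub>B\<^esub> \<iota> y"
    "\<iota> (poly_scale c x) = c \<odot>\<^bsub>B\<^esub> \<iota> x" "\<iota> (poly_adj x) = adj B (\<iota> x)"
  using assms by (simp_all add: to_completion_def B_simps B_minus S_const S_minus)

lemma \<iota>_1: "\<iota> 1 = \<one>\<^bsub>B\<^esub>" and \<iota>_0: "\<iota> 0 = \<zero>\<^bsub>B\<^esub>"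
  by (simp_all add: to_completion_def B_simps)

lemma nrm_eq_0_aux: "z \<in> carrier B \<Longrightarrow> nrm B z = 0 \<longleftrightarrow> z = \<zero>\<^bsub>B\<^esub>"
proof (elim B_carrierE)
  fix X assume X: "X \<in> carrier S" "z = cls X"
  have "z = \<zero>\<^bsub>B\<^esub> \<longleftrightarrow> X \<ominus>\<^bsub>S\<^esub> \<zero>\<^bsub>S\<^esub> \<in> N"
    using X S.coset_eq_iff[of X "\<zero>\<^bsub>S\<^esub>"] by (simp add: S_simps B_simps S_const)
  also have "\<dots> \<longleftrightarrow> nrm B z = 0"
    using X by (simp add: a_minus_def nrm_cls null_iff)
  finally show ?thesis by simp
qed

lemma nrm_add_aux:
  "x \<in> carrier B \<Longrightarrow> y \<in> carrier B \<Longrightarrow> nrm B (x \<oplus>\<^bsub>B\<^esub> y) \<le> nrm B x + nrm B y"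
proof (elim B_carrierE)
  fix X Y assume XY: "X \<in> carrier S" "x = cls X" "Y \<in> carrier S" "y = cls Y"
  have "nrm B (cls (\<lambda>k. X k + Y k)) \<le> nrm B x + nrm B y"
    unfolding XY
    by (rule LIMSEQ_le[OF nrm_cls_lim tendsto_add[OF nrm_cls_lim nrm_cls_lim]])
      (use XY in \<open>auto intro: S_add_in p_add S_free\<close>)
  then show ?thesis using XY by (simp add: B_simps)
qed

lemma nrm_mult_aux:
  "x \<in> carrier B \<Longrightarrow> y \<in> carrier B \<Longrightarrow> nrm B (x \<otimes>\<^bsub>B\<^esub> y) \<le> nrm B x * nrm B y"
proof (elim B_carrierE)
  fix X Y assume XY: "X \<in> carrier S" "x = cls X" "Y \<in> carrier S" "y = cls Y"
  have "nrm B (cls (\<lambda>k. X k * Y k)) \<le> nrm B x * nrm B y"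
    unfolding XY
    by (rule LIMSEQ_le[OF nrm_cls_lim tendsto_mult[OF nrm_cls_lim nrm_cls_lim]])
      (use XY in \<open>auto intro: S_mult_in p_mult S_free\<close>)
  then show ?thesis using XY by (simp add: B_simps)
qed

lemma nrm_smult_aux: "x \<in> carrier B \<Longrightarrow> nrm B (c \<odot>\<^bsub>B\<^esub> x) = cmod c * nrm B x"
proof (elim B_carrierE)
  fix X assume X: "X \<in> carrier S" "x = cls X"
  have "(\<lambda>k. p (poly_scale c (X k))) \<longlonglongrightarrow> cmod c * nrm B x"
    using tendsto_mult_left[OF nrm_cls_lim[OF X(1)], of "cmod c"] X by (simp add: p_scale S_free)
  then have "nrm B (cls (\<lambda>k. poly_scale c (X k))) = cmod c * nrm B x"
    using nrm_cls_lim[OF S_scale_in[OF X(1)]] by (auto dest: LIMSEQ_unique)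
  then show ?thesis using X by (simp add: B_simps)
qed

lemma nrm_cstar_aux: "x \<in> carrier B \<Longrightarrow> nrm B (adj B x \<otimes>\<^bsub>B\<^esub> x) = (nrm B x)\<^sup>2"
proof (elim B_carrierE)
  fix X assume X: "X \<in> carrier S" "x = cls X"
  have "(\<lambda>k. p (poly_adj (X k) * X k)) \<longlonglongrightarrow> (nrm B x)\<^sup>2"
    using tendsto_power[OF nrm_cls_lim[OF X(1)], of 2] X by (simp add: p_cstar S_free)
  then have "nrm B (cls (\<lambda>k. poly_adj (X k) * X k)) = (nrm B x)\<^sup>2"
    using nrm_cls_lim[OF S_mult_in[OF S_adj_in[OF X(1)] X(1)]] by (auto dest: LIMSEQ_unique)
  then show ?thesis using X by (simp add: B_simps S_adj_in)
qed

lemma B_nonneg: "x \<in> carrier B \<Longrightarrow> 0 \<le> nrm B x"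
  by (elim B_carrierE)
    (auto intro!: LIMSEQ_le_const[OF nrm_cls_lim] exI[of _ 0] p_nonneg S_free)

lemma B_neg: "x \<in> carrier B \<Longrightarrow> nrm B (\<ominus>\<^bsub>B\<^esub> x) = nrm B x"
  using nrm_smult_aux[of x "- 1"] B.C.smult_l_minus[of 1 x] B.C.smult_one[of x] by simp

lemma B_triangle:
  assumes "x \<in> carrier B" "y \<in> carrier B" "z \<in> carrier B"
  shows "nrm B (x \<ominus>\<^bsub>B\<^esub> z) \<le> nrm B (x \<ominus>\<^bsub>B\<^esub> y) + nrm B (y \<ominus>\<^bsub>B\<^esub> z)"
proof -
  have "x \<ominus>\<^bsub>B\<^esub> z = (x \<ominus>\<^bsub>B\<^esub> y) \<oplus>\<^bsub>B\<^esub> (y \<ominus>\<^bsub>B\<^esub> z)"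
    using assms by (simp add: a_minus_def B.a_assoc B.r_neg1 B.r_neg2)
  then show ?thesis
    using assms nrm_add_aux[of "x \<ominus>\<^bsub>B\<^esub> y" "y \<ominus>\<^bsub>B\<^esub> z"] by simp
qed

lemma B_diff_commute:
  assumes "x \<in> carrier B" "y \<in> carrier B"
  shows "nrm B (x \<ominus>\<^bsub>B\<^esub> y) = nrm B (y \<ominus>\<^bsub>B\<^esub> x)"
proof -
  have "y \<ominus>\<^bsub>B\<^esub> x = \<ominus>\<^bsub>B\<^esub> (x \<ominus>\<^bsub>B\<^esub> y)"
    using assms by (simp add: a_minus_def B.minus_add B.a_comm)
  then show ?thesis using assms by (simp add: B_neg)
qed

lemma \<iota>_dense:
  assumes X: "X \<in> carrier S"
  shows "(\<lambda>k. nrm B (\<iota> (X k) \<ominus>\<^bsub>B\<^esub> cls X)) \<longlonglongrightarrow> 0"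
proof (rule LIMSEQ_I)
  fix e :: real assume e: "0 < e"
  obtain M where M: "\<forall>k\<ge>M. \<forall>l\<ge>M. p (X k - X l) < e / 2"
    using S_cauchy[OF X, of "e / 2"] e by auto
  show "\<exists>M. \<forall>k\<ge>M. norm (nrm B (\<iota> (X k) \<ominus>\<^bsub>B\<^esub> cls X) - 0) < e"
  proof (intro exI[of _ M] allI impI)
    fix k assume k: "M \<le> k"
    have c: "(\<lambda>l. X k) \<in> carrier S" using X by (intro S_const S_free)
    have "(\<lambda>l. X k) \<ominus>\<^bsub>S\<^esub> X \<in> carrier S" using c X by simp
    from nrm_cls_lim[OF this] have "(\<lambda>l. p (X k - X l)) \<longlonglongrightarrow> nrm B (\<iota> (X k) \<ominus>\<^bsub>B\<^esub> cls X)"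
      using c X by (simp add: S_minus to_completion_def B_minus)
    then have "nrm B (\<iota> (X k) \<ominus>\<^bsub>B\<^esub> cls X) \<le> e / 2"
      by (rule LIMSEQ_le_const2) (use M k in \<open>auto intro!: exI[of _ M] less_imp_le\<close>)
    moreover have "0 \<le> nrm B (\<iota> (X k) \<ominus>\<^bsub>B\<^esub> cls X)"
      using X by (intro B_nonneg B.minus_closed \<iota>_in B_in S_free)
    ultimately show "norm (nrm B (\<iota> (X k) \<ominus>\<^bsub>B\<^esub> cls X) - 0) < e" using e by simp
  qed
qed

lemma B_complete:
  fixes Z :: "nat \<Rightarrow> 'g completed"
  assumes Z: "\<forall>k. Z k \<in> carrier B"
    and cauchy: "\<forall>\<epsilon>>0. \<exists>M. \<forall>k\<ge>M. \<forall>l\<ge>M. nrm B (Z k \<ominus>\<^bsub>B\<^esub> Z l) < \<epsilon>"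
  shows "\<exists>z\<in>carrier B. (\<lambda>k. nrm B (Z k \<ominus>\<^bsub>B\<^esub> z)) \<longlonglongrightarrow> 0"
proof -
  define r where "r k = inverse (real (Suc k))" for k
  have r: "r k > 0" for k by (simp add: r_def)
  have r0: "r \<longlonglongrightarrow> 0" unfolding r_def by (rule LIMSEQ_inverse_real_of_nat)
  have "\<exists>y. y \<in> F \<and> nrm B (\<iota> y \<ominus>\<^bsub>B\<^esub> Z k) < r k" for k
  proof -
    obtain X where X: "X \<in> carrier S" "Z k = cls X" using Z B_carrierE by blast
    from LIMSEQ_D[OF \<iota>_dense[OF X(1)] r[of k]]
    obtain m where "\<bar>nrm B (\<iota> (X m) \<ominus>\<^bsub>B\<^esub> cls X)\<bar> < r k" by auto
    then show ?thesis using X S_free[OF X(1), of m] by (intro exI[of _ "X m"]) auto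
  qed
  then obtain y where y: "\<And>k. y k \<in> F" "\<And>k. nrm B (\<iota> (y k) \<ominus>\<^bsub>B\<^esub> Z k) < r k" by metis
  have le: "p (y k - y l) \<le> r k + nrm B (Z k \<ominus>\<^bsub>B\<^esub> Z l) + r l" for k l
  proof -
    have "p (y k - y l) = nrm B (\<iota> (y k) \<ominus>\<^bsub>B\<^esub> \<iota> (y l))"
      using y(1) by (simp add: free_minus flip: nrm_\<iota> \<iota>_hom)
    also have "\<dots> \<le> nrm B (\<iota> (y k) \<ominus>\<^bsub>B\<^esub> Z k) + nrm B (Z k \<ominus>\<^bsub>B\<^esub> \<iota> (y l))"
      using y(1) Z by (intro B_triangle \<iota>_in) auto
    also have "nrm B (Z k \<ominus>\<^bsub>B\<^esub> \<iota> (y l)) \<le> nrm B (Z k \<ominus>\<^bsub>B\<^esub> Z l) + nrm B (Z l \<ominus>\<^bsub>B\<^esub> \<iota> (y l))"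
      using y(1) Z by (intro B_triangle \<iota>_in) auto
    finally show ?thesis
      using y(2)[of k] y(2)[of l] B_diff_commute[of "Z l" "\<iota> (y l)"] Z \<iota>_in[OF y(1)] by simp
  qed
  have yS: "y \<in> carrier S"
  proof -
    have "\<exists>M. \<forall>k\<ge>M. \<forall>l\<ge>M. p (y k - y l) < \<epsilon>" if e: "\<epsilon> > 0" for \<epsilon> :: real
    proof -
      obtain M1 where M1: "\<forall>k\<ge>M1. \<forall>l\<ge>M1. nrm B (Z k \<ominus>\<^bsub>B\<^esub> Z l) < \<epsilon> / 3"
        using cauchy e by (meson zero_less_divide_iff zero_less_numeral)
      obtain M2 where M2: "\<forall>k\<ge>M2. \<bar>r k\<bar> < \<epsilon> / 3"
        using LIMSEQ_D[OF r0, of "\<epsilon> / 3"] e by auto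
      show ?thesis
      proof (intro exI[of _ "max M1 M2"] allI impI)
        fix k l assume kl: "max M1 M2 \<le> k" "max M1 M2 \<le> l"
        have "nrm B (Z k \<ominus>\<^bsub>B\<^esub> Z l) < \<epsilon> / 3" "\<bar>r k\<bar> < \<epsilon> / 3" "\<bar>r l\<bar> < \<epsilon> / 3"
          using M1 M2 kl by auto
        then show "p (y k - y l) < \<epsilon>" using le[of k l] by linarith
      qed
    qed
    then show ?thesis using y(1) by (simp add: cauchy_algebra_def)
  qed
  have "(\<lambda>k. nrm B (Z k \<ominus>\<^bsub>B\<^esub> cls y)) \<longlonglongrightarrow> 0"
  proof (rule tendsto_sandwich[of "\<lambda>k. 0"])
    show "(\<lambda>k. r k + nrm B (\<iota> (y k) \<ominus>\<^bsub>B\<^esub> cls y)) \<longlonglongrightarrow> 0"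
      using tendsto_add[OF r0 \<iota>_dense[OF yS]] by simp
    have "nrm B (Z k \<ominus>\<^bsub>B\<^esub> cls y) \<le> r k + nrm B (\<iota> (y k) \<ominus>\<^bsub>B\<^esub> cls y)" for k
      using B_triangle[of "Z k" "\<iota> (y k)" "cls y"] y(2)[of k]
        B_diff_commute[of "Z k" "\<iota> (y k)"] Z \<iota>_in[OF y(1)] B_in[OF yS] by simp
    then show "\<forall>\<^sub>F k in sequentially. nrm B (Z k \<ominus>\<^bsub>B\<^esub> cls y) \<le> r k + nrm B (\<iota> (y k) \<ominus>\<^bsub>B\<^esub> cls y)"
      by simp
    show "\<forall>\<^sub>F k in sequentially. 0 \<le> nrm B (Z k \<ominus>\<^bsub>B\<^esub> cls y)"
      using Z by (auto intro!: always_eventually B_nonneg B.minus_closed B_in yS)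
  qed auto
  then show ?thesis using B_in[OF yS] by blast
qed

sublocale B: cstar_algebra B
  by unfold_locales
    (use nrm_eq_0_aux nrm_add_aux nrm_smult_aux nrm_mult_aux nrm_cstar_aux B_complete in auto)

end

subsection \<open>Evaluation of *-polynomials in a C*-algebra\<close>

context star_algebra
begin

lemma smult_0 [simp]: "x \<in> carrier A \<Longrightarrow> 0 \<odot> x = \<zero>"
  using C.smult_l_null[of x] by simp

lemma smult_1 [simp]: "x \<in> carrier A \<Longrightarrow> 1 \<odot> x = x"
  using C.smult_one[of x] by simp

lemma smult_carrier [simp]: "x \<in> carrier A \<Longrightarrow> c \<odot> x \<in> carrier A"
  by (simp add: C.smult_closed)

lemma smult_zero [simp]: "c \<odot> \<zero> = \<zero>"
  using C.smult_r_null[of c] by simp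

lemma smult_neg1: "x \<in> carrier A \<Longrightarrow> (- 1) \<odot> x = \<ominus> x"
  using C.smult_l_minus[of 1 x] by simp

lemma smult_add: "x \<in> carrier A \<Longrightarrow> y \<in> carrier A \<Longrightarrow> c \<odot> (x \<oplus> y) = c \<odot> x \<oplus> c \<odot> y"
  by (simp add: C.smult_r_distr)

lemma smult_add_left: "x \<in> carrier A \<Longrightarrow> (c + d) \<odot> x = c \<odot> x \<oplus> d \<odot> x"
  using C.smult_l_distr[of c d x] by simp

lemma smult_smult: "x \<in> carrier A \<Longrightarrow> c \<odot> (d \<odot> x) = (c * d) \<odot> x"
  using C.smult_assoc1[of c d x] by simp

declare adj_closed [simp]

lemma eq_diff_zero: "x \<in> carrier A \<Longrightarrow> y \<in> carrier A \<Longrightarrow> x \<ominus> y = \<zero> \<longleftrightarrow> x = y"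
  using add.inv_solve_right[of \<zero> x y] by (auto simp: a_minus_def r_neg)

lemma adj_one: "adj A \<one> = \<one>"
  using adj_mult[of "adj A \<one>" \<one>] adj_adj[of \<one>] by simp

lemma minus_smult: "x \<in> carrier A \<Longrightarrow> y \<in> carrier A \<Longrightarrow> x \<ominus> y = x \<oplus> (- 1) \<odot> y"
  by (simp add: a_minus_def smult_neg1)

lemma smult_diff': "x \<in> carrier A \<Longrightarrow> y \<in> carrier A \<Longrightarrow> c \<odot> (x \<ominus> y) = c \<odot> x \<ominus> c \<odot> y"
  by (simp add: minus_smult smult_add smult_smult)

lemma adj_diff': "x \<in> carrier A \<Longrightarrow> y \<in> carrier A \<Longrightarrow> adj A (x \<ominus> y) = adj A x \<ominus> adj A y"
  by (simp add: minus_smult adj_add adj_smult)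

end

context cstar_algebra
begin

lemma nrm_zero [simp]: "nrm A \<zero> = 0"
  by (simp add: nrm_eq_0)

lemma nrm_neg: "x \<in> carrier A \<Longrightarrow> nrm A (\<ominus> x) = nrm A x"
  using nrm_smult[of x "- 1"] by (simp add: smult_neg1)

lemma nrm_nonneg: "x \<in> carrier A \<Longrightarrow> 0 \<le> nrm A x"
  using nrm_add[of x "\<ominus> x"] by (simp add: nrm_neg r_neg)

lemma nrm_diff_commute: "x \<in> carrier A \<Longrightarrow> y \<in> carrier A \<Longrightarrow> nrm A (x \<ominus> y) = nrm A (y \<ominus> x)"
  using nrm_neg[of "x \<ominus> y"] by (simp add: a_minus_def minus_add a_comm)

lemma nrm_diff_triangle:
  assumes "x \<in> carrier A" "y \<in> carrier A" "z \<in> carrier A"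
  shows "nrm A (x \<ominus> z) \<le> nrm A (x \<ominus> y) + nrm A (y \<ominus> z)"
proof -
  have "x \<ominus> z = (x \<ominus> y) \<oplus> (y \<ominus> z)"
    using assms by (simp add: a_minus_def a_assoc r_neg1 r_neg2)
  then show ?thesis
    using assms nrm_add[of "x \<ominus> y" "y \<ominus> z"] by simp
qed

lemma nrm_adj_le: "x \<in> carrier A \<Longrightarrow> nrm A x \<le> nrm A (adj A x)"
proof -
  assume x: "x \<in> carrier A"
  have "nrm A x * nrm A x \<le> nrm A (adj A x) * nrm A x"
    using nrm_mult[of "adj A x" x] nrm_cstar[of x] x by (simp add: power2_eq_square)
  then show ?thesis
    using nrm_nonneg[OF x] nrm_nonneg[OF adj_closed[OF x]] by (cases "nrm A x = 0") auto
qed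

lemma nrm_adj: "x \<in> carrier A \<Longrightarrow> nrm A (adj A x) = nrm A x"
  using nrm_adj_le[of x] nrm_adj_le[of "adj A x"] by (simp add: adj_adj)

lemma nrm_projection_le: "projection A x \<Longrightarrow> nrm A x \<le> 1"
proof -
  assume "projection A x"
  then have x: "x \<in> carrier A" "adj A x \<otimes> x = x" unfolding projection_def by metis+
  have "nrm A x * nrm A x = nrm A x"
    using nrm_cstar[OF x(1)] x(2) by (simp add: power2_eq_square)
  then show ?thesis by (cases "nrm A x = 0") simp_all
qed

abbreviation tends :: "(nat \<Rightarrow> 'a) \<Rightarrow> 'a \<Rightarrow> bool" where
  "tends X a \<equiv> (\<lambda>k. nrm A (X k \<ominus> a)) \<longlonglongrightarrow> 0"

lemma tends_compare:
  assumes "g \<longlonglongrightarrow> 0" "\<And>k. nrm A (X k \<ominus> a) \<le> g k" "\<And>k. X k \<in> carrier A" "a \<in> carrier A"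
  shows "tends X a"
proof (rule tendsto_sandwich[OF _ _ tendsto_const assms(1)])
  show "\<forall>\<^sub>F k in sequentially. 0 \<le> nrm A (X k \<ominus> a)"
    using assms(3,4) by (simp add: nrm_nonneg)
  show "\<forall>\<^sub>F k in sequentially. nrm A (X k \<ominus> a) \<le> g k"
    using assms(2) by simp
qed

lemma tends_unique:
  assumes "tends X a" "tends X b" "\<And>k. X k \<in> carrier A" "a \<in> carrier A" "b \<in> carrier A"
  shows "a = b"
proof -
  have le: "nrm A (a \<ominus> b) \<le> nrm A (X k \<ominus> a) + nrm A (X k \<ominus> b)" for k
    using nrm_diff_triangle[of a "X k" b] nrm_diff_commute[of a "X k"] assms by simp
  have "(\<lambda>k. nrm A (X k \<ominus> a) + nrm A (X k \<ominus> b)) \<longlonglongrightarrow> 0"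
    using tendsto_add[OF assms(1,2)] by simp
  then have "nrm A (a \<ominus> b) \<le> 0"
    by (rule LIMSEQ_le_const) (use le in auto)
  then have "a \<ominus> b = \<zero>"
    using nrm_eq_0[of "a \<ominus> b"] nrm_nonneg[of "a \<ominus> b"] assms(4,5) by simp
  then show ?thesis
    using assms(4,5) by (simp add: eq_diff_zero)
qed

lemma tends_add:
  assumes "tends X a" "tends Y b" "\<And>k. X k \<in> carrier A" "\<And>k. Y k \<in> carrier A"
    "a \<in> carrier A" "b \<in> carrier A"
  shows "tends (\<lambda>k. X k \<oplus> Y k) (a \<oplus> b)"
proof (rule tends_compare)
  show "(\<lambda>k. nrm A (X k \<ominus> a) + nrm A (Y k \<ominus> b)) \<longlonglongrightarrow> 0"
    using tendsto_add[OF assms(1,2)] by simp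
  show "nrm A (X k \<oplus> Y k \<ominus> (a \<oplus> b)) \<le> nrm A (X k \<ominus> a) + nrm A (Y k \<ominus> b)" for k
  proof -
    have "X k \<oplus> Y k \<ominus> (a \<oplus> b) = (X k \<ominus> a) \<oplus> (Y k \<ominus> b)"
      using assms by (simp add: a_minus_def minus_add a_ac)
    then show ?thesis using assms nrm_add[of "X k \<ominus> a" "Y k \<ominus> b"] by simp
  qed
qed (use assms in auto)

lemma tends_smult:
  assumes "tends X a" "\<And>k. X k \<in> carrier A" "a \<in> carrier A"
  shows "tends (\<lambda>k. c \<odot> X k) (c \<odot> a)"
  using tendsto_mult_left[OF assms(1), of "cmod c"] assms
  by (simp add: nrm_smult flip: smult_diff')

lemma tends_adj:
  assumes "tends X a" "\<And>k. X k \<in> carrier A" "a \<in> carrier A"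
  shows "tends (\<lambda>k. adj A (X k)) (adj A a)"
  using assms by (simp add: nrm_adj flip: adj_diff')

lemma nrm_tendsto:
  assumes "tends X a" "\<And>k. X k \<in> carrier A" "a \<in> carrier A"
  shows "(\<lambda>k. nrm A (X k)) \<longlonglongrightarrow> nrm A a"
proof -
  have "\<bar>nrm A (X k) - nrm A a\<bar> \<le> nrm A (X k \<ominus> a)" for k
    using nrm_diff_triangle[of "X k" a \<zero>] nrm_diff_triangle[of a "X k" \<zero>]
      nrm_diff_commute[of "X k" a] assms by (simp add: a_minus_def)
  then have "\<forall>\<^sub>F k in sequentially. norm (nrm A (X k) - nrm A a) \<le> norm (nrm A (X k \<ominus> a)) * 1"
    by (intro always_eventually allI) (metis abs_ge_self mult_1_right order_trans real_norm_def)
  then have "(\<lambda>k. nrm A (X k) - nrm A a) \<longlonglongrightarrow> 0"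
    by (rule tendsto_0_le[OF assms(1)])
  then show ?thesis by (simp add: LIM_zero_cancel)
qed

lemma tends_mult:
  assumes X: "tends X a" and Y: "tends Y b"
    and c: "\<And>k. X k \<in> carrier A" "\<And>k. Y k \<in> carrier A" "a \<in> carrier A" "b \<in> carrier A"
  shows "tends (\<lambda>k. X k \<otimes> Y k) (a \<otimes> b)"
proof (rule tends_compare)
  show "(\<lambda>k. nrm A (X k) * nrm A (Y k \<ominus> b) + nrm A (X k \<ominus> a) * nrm A b) \<longlonglongrightarrow> 0"
    using tendsto_add[OF tendsto_mult[OF nrm_tendsto[OF X c(1,3)] Y] tendsto_mult_right[OF X, of "nrm A b"]]
    by simp
  show "nrm A (X k \<otimes> Y k \<ominus> a \<otimes> b) \<le> nrm A (X k) * nrm A (Y k \<ominus> b) + nrm A (X k \<ominus> a) * nrm A b" for k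
  proof -
    have "X k \<otimes> Y k \<ominus> a \<otimes> b = X k \<otimes> (Y k \<ominus> b) \<oplus> (X k \<ominus> a) \<otimes> b"
      using c by (simp add: a_minus_def l_distr r_distr l_minus r_minus a_assoc r_neg1 r_neg2)
    then have "nrm A (X k \<otimes> Y k \<ominus> a \<otimes> b) \<le> nrm A (X k \<otimes> (Y k \<ominus> b)) + nrm A ((X k \<ominus> a) \<otimes> b)"
      using c by (simp add: nrm_add)
    also have "\<dots> \<le> nrm A (X k) * nrm A (Y k \<ominus> b) + nrm A (X k \<ominus> a) * nrm A b"
      using c by (intro add_mono nrm_mult) auto
    finally show ?thesis .
  qed
qed (use c in auto)

end

definition word_eval :: "('a, 'm) cstar_scheme \<Rightarrow> ('g \<Rightarrow> 'a) \<Rightarrow> 'g star_word \<Rightarrow> 'a" where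
  "word_eval A v w =
     foldr (\<lambda>(g, b) x. (if b then adj A (v g) else v g) \<otimes>\<^bsub>A\<^esub> x) (letters w) \<one>\<^bsub>A\<^esub>"

definition poly_eval :: "('a, 'm) cstar_scheme \<Rightarrow> ('g \<Rightarrow> 'a) \<Rightarrow> 'g star_poly \<Rightarrow> 'a" where
  "poly_eval A v x =
     (\<Oplus>\<^bsub>A\<^esub>w\<in>Poly_Mapping.keys x. Poly_Mapping.lookup x w \<odot>\<^bsub>A\<^esub> word_eval A v w)"

locale star_family = star_algebra A for A :: "('a, 'm) cstar_scheme" (structure) +
  fixes G :: "'g set" and v :: "'g \<Rightarrow> 'a"
  assumes v_in: "g \<in> G \<Longrightarrow> v g \<in> carrier A"
begin

abbreviation "wev \<equiv> word_eval A v"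
abbreviation "ev \<equiv> poly_eval A v"
abbreviation "FG \<equiv> free_star_algebra G"

abbreviation "wordG w \<equiv> fst ` set (letters w) \<subseteq> G"

lemma wev_in [simp]: "wordG w \<Longrightarrow> wev w \<in> carrier A"
proof (induction "letters w" arbitrary: w)
  case Nil
  then show ?case by (simp add: word_eval_def)
next
  case (Cons l ls)
  then have "wev (Word ls) \<in> carrier A" by (metis star_word.sel set_subset_Cons image_mono subset_trans)
  moreover have "fst l \<in> G" using Cons.prems Cons.hyps(2) by (metis list.set_intros(1) image_subset_iff)
  ultimately show ?case
    using Cons.hyps(2) v_in[of "fst l"] by (simp add: word_eval_def split_def flip: Cons.hyps(2))
qed

lemma wev_0: "wev 0 = \<one>"
  by (simp add: word_eval_def)

lemma wev_Cons: "wev (Word ((g, b) # ls)) = (if b then adj A (v g) else v g) \<otimes> wev (Word ls)"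
  by (simp add: word_eval_def)

lemma wev_plus: "wordG w \<Longrightarrow> wordG w' \<Longrightarrow> wev (w + w') = wev w \<otimes> wev w'"
proof (induction "letters w" arbitrary: w)
  case Nil
  then have "w = 0" by (metis star_word.collapse zero_star_word_def)
  then show ?case using Nil by (simp add: wev_0)
next
  case (Cons l ls)
  obtain g b where l: "l = (g, b)" by (cases l)
  have w: "w = Word ((g, b) # ls)" using Cons.hyps(2) l by (metis star_word.collapse)
  have g: "g \<in> G" "wordG (Word ls)" using Cons.prems w by auto
  have "w + w' = Word ((g, b) # ls @ letters w')" "Word ls + w' = Word (ls @ letters w')"
    by (simp_all add: w plus_star_word_def)
  then have "wev (w + w') = (if b then adj A (v g) else v g) \<otimes> wev (Word ls + w')"
    by (simp only: wev_Cons)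
  also have "\<dots> = (if b then adj A (v g) else v g) \<otimes> (wev (Word ls) \<otimes> wev w')"
    using Cons.hyps(1)[of "Word ls"] g(2) Cons.prems by simp
  also have "\<dots> = wev w \<otimes> wev w'"
    unfolding w wev_Cons using g Cons.prems v_in[of g] by (simp add: m_assoc)
  finally show ?case .
qed

lemma wev_adj: "wordG w \<Longrightarrow> wev (word_adj w) = adj A (wev w)"
proof (induction "letters w" arbitrary: w)
  case Nil
  then have "w = 0" by (metis star_word.collapse zero_star_word_def)
  then show ?case by (simp add: wev_0 adj_one)
next
  case (Cons l ls)
  obtain g b where l: "l = (g, b)" by (cases l)
  have w: "w = Word ((g, b) # ls)" using Cons.hyps(2) l by (metis star_word.collapse)
  have g: "g \<in> G" "wordG (Word ls)" using Cons.prems w by auto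
  have "word_adj w = word_adj (Word ls) + Word [(g, \<not> b)]"
    by (simp add: w word_adj_def plus_star_word_def)
  then have "wev (word_adj w) = wev (word_adj (Word ls)) \<otimes> wev (Word [(g, \<not> b)])"
    using wev_plus[of "word_adj (Word ls)" "Word [(g, \<not> b)]"] g
    by (simp only: fst_letters_word_adj) simp
  also have "wev (word_adj (Word ls)) = adj A (wev (Word ls))"
    using Cons.hyps(1)[of "Word ls"] g by simp
  also have "wev (Word [(g, \<not> b)]) = adj A (if b then adj A (v g) else v g)"
    using v_in[OF g(1)] by (simp add: word_eval_def adj_adj)
  finally show ?case
    using g v_in[OF g(1)] unfolding w wev_Cons by (simp add: adj_mult)
qed

lemma ev_superset:
  assumes "finite K" "Poly_Mapping.keys x \<subseteq> K" "\<And>w. w \<in> K \<Longrightarrow> wordG w"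
  shows "ev x = (\<Oplus>w\<in>K. Poly_Mapping.lookup x w \<odot> wev w)"
  unfolding poly_eval_def
  by (rule add.finprod_mono_neutral_cong_left) (use assms in \<open>auto simp: in_keys_iff\<close>)

lemma FG_keys: "x \<in> FG \<Longrightarrow> w \<in> Poly_Mapping.keys x \<Longrightarrow> wordG w"
  unfolding free_star_algebra_def by blast

lemma ev_in [simp]: "x \<in> FG \<Longrightarrow> ev x \<in> carrier A"
  unfolding poly_eval_def by (rule finsum_closed) (auto dest!: FG_keys)

lemma ev_add:
  assumes "x \<in> FG" "y \<in> FG"
  shows "ev (x + y) = ev x \<oplus> ev y"
proof -
  define K where "K = Poly_Mapping.keys x \<union> Poly_Mapping.keys y"
  have K: "finite K" "Poly_Mapping.keys x \<subseteq> K" "Poly_Mapping.keys y \<subseteq> K"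
    "Poly_Mapping.keys (x + y) \<subseteq> K" "\<And>w. w \<in> K \<Longrightarrow> wordG w"
    using assms FG_keys Poly_Mapping.keys_add[of x y] unfolding K_def by auto
  have e: "ev x = (\<Oplus>w\<in>K. Poly_Mapping.lookup x w \<odot> wev w)"
    "ev y = (\<Oplus>w\<in>K. Poly_Mapping.lookup y w \<odot> wev w)"
    "ev (x + y) = (\<Oplus>w\<in>K. Poly_Mapping.lookup (x + y) w \<odot> wev w)"
    by (rule ev_superset; use K in blast)+
  have "ev (x + y) = (\<Oplus>w\<in>K. Poly_Mapping.lookup x w \<odot> wev w \<oplus> Poly_Mapping.lookup y w \<odot> wev w)"
    unfolding e(3)
    by (rule finsum_cong') (use K in \<open>auto simp: lookup_add smult_add_left\<close>)
  also have "\<dots> = ev x \<oplus> ev y"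
    unfolding e(1,2)
    by (rule finsum_addf) (use K in auto)
  finally show ?thesis .
qed

lemma ev_single: "wordG w \<Longrightarrow> ev (Poly_Mapping.single w c) = c \<odot> wev w"
  by (subst ev_superset[of "{w}"]) auto

lemma ev_scale: "x \<in> FG \<Longrightarrow> ev (poly_scale c x) = c \<odot> ev x"
  by (induction x rule: free_induct)
    (simp_all add: poly_scale_single ev_single smult_smult poly_scale_add ev_add free_scale smult_add)

lemma ev_minus: "x \<in> FG \<Longrightarrow> y \<in> FG \<Longrightarrow> ev (x - y) = ev x \<ominus> ev y"
  using ev_add[of x "poly_scale (- 1) y"]
  by (simp add: ev_scale minus_smult free_scale) (simp add: poly_scale_neg)

lemma ev_mult: "x \<in> FG \<Longrightarrow> y \<in> FG \<Longrightarrow> ev (x * y) = ev x \<otimes> ev y"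
proof (induction x rule: free_induct)
  case (single w c)
  note w = single(1)
  from single(2) show ?case
  proof (induction y rule: free_induct)
    case (single w' d)
    then have "wordG (w + w')" using w by auto
    then show ?case
      using single w
      by (simp add: mult_single ev_single wev_plus smult_mult_l smult_mult_r smult_smult mult.commute)
  next
    case (add y z)
    then show ?case
      using w by (simp add: distrib_left ev_add free_mult free_single r_distr)
  qed
next
  case (add x z)
  then show ?case by (simp add: distrib_right ev_add free_mult l_distr)
qed

lemma ev_adj: "x \<in> FG \<Longrightarrow> ev (poly_adj x) = adj A (ev x)"
  by (induction x rule: free_induct)
    (simp_all add: ev_single wev_adj adj_smult poly_adj_add ev_add free_adj adj_add)

lemma ev_0: "ev 0 = \<zero>"
  by (simp add: poly_eval_def)

lemma ev_1: "ev 1 = \<one>"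
  using ev_single[of 0 1] by (simp add: wev_0)

lemma ev_gen: "g \<in> G \<Longrightarrow> ev (poly_gen g) = v g"
  using v_in[of g] by (simp add: poly_gen_def ev_single) (simp add: word_eval_def)

lemma ev_sum:
  assumes "\<And>i. i \<in> K \<Longrightarrow> f i \<in> FG" "finite K"
  shows "ev (sum f K) = (\<Oplus>i\<in>K. ev (f i))"
  using assms(2,1)
  by (induction K rule: finite_induct) (simp_all add: ev_0 ev_add free_sum finsum_insert Pi_def)

end

subsection \<open>Universal C*-algebras given by relations\<close>

locale cstar_family = cstar_algebra A + star_family A G v
  for A :: "('a, 'm) cstar_scheme" (structure) and G :: "'g set" and v :: "'g \<Rightarrow> 'a"
begin

lemma ev_seminorm: "cstar_seminorm G (\<lambda>x. nrm A (ev x))"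
  unfolding cstar_seminorm_def
  by (auto simp: ev_scale ev_add ev_mult ev_adj free_adj nrm_nonneg nrm_smult nrm_cstar nrm_add nrm_mult)

lemma completion_extend:
  assumes p: "cstar_seminorm G p" and le: "\<And>x. x \<in> FG \<Longrightarrow> nrm A (ev x) \<le> p x"
  shows "\<exists>\<phi>\<in>star_hom (completion G p) A.
    (\<forall>x\<in>FG. \<phi> (to_completion G p x) = ev x) \<and>
    (\<forall>z\<in>carrier (completion G p). nrm A (\<phi> z) \<le> nrm (completion G p) z)"
proof -
  interpret p: star_seminorm G p by unfold_locales (rule p)
  have le': "nrm A (ev x \<ominus> ev y) \<le> p (x - y)" if "x \<in> FG" "y \<in> FG" for x y
    using le[of "x - y"] that by (simp add: ev_minus free_minus)
  have conv: "\<exists>a\<in>carrier A. tends (\<lambda>k. ev (X k)) a" if X: "X \<in> carrier p.S" for X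
  proof (rule complete)
    show "\<forall>k. ev (X k) \<in> carrier A" using p.S_free[OF X] by simp
    show "\<forall>\<epsilon>>0. \<exists>M. \<forall>k\<ge>M. \<forall>l\<ge>M. nrm A (ev (X k) \<ominus> ev (X l)) < \<epsilon>"
    proof (intro allI impI)
      fix \<epsilon> :: real assume "\<epsilon> > 0"
      then obtain M where M: "\<forall>k\<ge>M. \<forall>l\<ge>M. p (X k - X l) < \<epsilon>"
        using p.S_cauchy[OF X] by blast
      show "\<exists>M. \<forall>k\<ge>M. \<forall>l\<ge>M. nrm A (ev (X k) \<ominus> ev (X l)) < \<epsilon>"
      proof (intro exI[of _ M] allI impI)
        fix k l assume "M \<le> k" "M \<le> l"
        then have "p (X k - X l) < \<epsilon>" using M by blast
        then show "nrm A (ev (X k) \<ominus> ev (X l)) < \<epsilon>"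
          using le'[OF p.S_free[OF X, of k] p.S_free[OF X, of l]] by linarith
      qed
    qed
  qed
  define \<phi> where "\<phi> z = (SOME a. a \<in> carrier A \<and>
    (\<exists>X\<in>carrier p.S. z = p.cls X \<and> tends (\<lambda>k. ev (X k)) a))" for z
  have \<phi>: "\<phi> (p.cls X) \<in> carrier A \<and> tends (\<lambda>k. ev (X k)) (\<phi> (p.cls X))"
    if X: "X \<in> carrier p.S" for X
  proof -
    obtain a0 where a0: "a0 \<in> carrier A" "tends (\<lambda>k. ev (X k)) a0"
      using conv[OF X] by blast
    have "\<phi> (p.cls X) \<in> carrier A \<and>
      (\<exists>Y\<in>carrier p.S. p.cls X = p.cls Y \<and> tends (\<lambda>k. ev (Y k)) (\<phi> (p.cls X)))"
      unfolding \<phi>_def by (rule someI[where x = a0]) (intro conjI bexI[OF _ X] refl a0)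
    then obtain Y where a: "\<phi> (p.cls X) \<in> carrier A" and Y: "Y \<in> carrier p.S"
        "p.cls X = p.cls Y" "tends (\<lambda>k. ev (Y k)) (\<phi> (p.cls X))"
      by blast
    have XY: "(\<lambda>k. X k - Y k) \<in> p.N"
      using Y X p.S.coset_eq_iff[OF X Y(1)] by (simp add: p.S_minus)
    have "tends (\<lambda>k. ev (X k)) (\<phi> (p.cls X))"
    proof (rule tends_compare)
      show "(\<lambda>k. p (X k - Y k) + nrm A (ev (Y k) \<ominus> \<phi> (p.cls X))) \<longlonglongrightarrow> 0"
        using tendsto_add[OF p.null_lim[OF XY] Y(3)] by simp
      fix k
      show "ev (X k) \<in> carrier A" using p.S_free[OF X] by simp
      show "nrm A (ev (X k) \<ominus> \<phi> (p.cls X)) \<le> p (X k - Y k) + nrm A (ev (Y k) \<ominus> \<phi> (p.cls X))"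
        using nrm_diff_triangle[of "ev (X k)" "ev (Y k)" "\<phi> (p.cls X)"]
          le'[OF p.S_free[OF X, of k] p.S_free[OF Y(1), of k]] p.S_free[OF X, of k]
          p.S_free[OF Y(1), of k] a by simp
    qed (rule a)
    then show ?thesis using a by blast
  qed
  have \<phi>_eq: "\<phi> (p.cls X) = a"
    if "X \<in> carrier p.S" "a \<in> carrier A" "tends (\<lambda>k. ev (X k)) a" for X a
    using \<phi>[OF that(1)] that p.S_free[OF that(1)] tends_unique[of "\<lambda>k. ev (X k)"] by simp
  note [simp] = p.B_simps p.S_add_in p.S_mult_in p.S_adj_in p.S_scale_in p.S_const
  have \<phi>_in: "\<phi> z \<in> carrier A" if "z \<in> carrier p.B" for z
    using that by (elim p.B_carrierE) (simp add: \<phi>)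
  have \<phi>_add: "\<phi> (y \<oplus>\<^bsub>p.B\<^esub> z) = \<phi> y \<oplus> \<phi> z" if "y \<in> carrier p.B" "z \<in> carrier p.B" for y z
    using that
  proof (elim p.B_carrierE)
    fix Y Z assume YZ: "Y \<in> carrier p.S" "y = p.cls Y" "Z \<in> carrier p.S" "z = p.cls Z"
    have "tends (\<lambda>k. ev (Y k) \<oplus> ev (Z k)) (\<phi> y \<oplus> \<phi> z)"
      using YZ \<phi>[OF YZ(1)] \<phi>[OF YZ(3)] by (intro tends_add) (auto simp: p.S_free)
    then have "\<phi> (p.cls (\<lambda>k. Y k + Z k)) = \<phi> y \<oplus> \<phi> z"
      using YZ \<phi>[OF YZ(1)] \<phi>[OF YZ(3)] by (intro \<phi>_eq) (auto simp: ev_add p.S_free)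
    then show ?thesis using YZ by simp
  qed
  have \<phi>_mult: "\<phi> (y \<otimes>\<^bsub>p.B\<^esub> z) = \<phi> y \<otimes> \<phi> z" if "y \<in> carrier p.B" "z \<in> carrier p.B" for y z
    using that
  proof (elim p.B_carrierE)
    fix Y Z assume YZ: "Y \<in> carrier p.S" "y = p.cls Y" "Z \<in> carrier p.S" "z = p.cls Z"
    have "tends (\<lambda>k. ev (Y k) \<otimes> ev (Z k)) (\<phi> y \<otimes> \<phi> z)"
      using YZ \<phi>[OF YZ(1)] \<phi>[OF YZ(3)] by (intro tends_mult) (auto simp: p.S_free)
    then have "\<phi> (p.cls (\<lambda>k. Y k * Z k)) = \<phi> y \<otimes> \<phi> z"
      using YZ \<phi>[OF YZ(1)] \<phi>[OF YZ(3)] by (intro \<phi>_eq) (auto simp: ev_mult p.S_free)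
    then show ?thesis using YZ by simp
  qed
  have \<phi>_smult: "\<phi> (c \<odot>\<^bsub>p.B\<^esub> y) = c \<odot> \<phi> y" if "y \<in> carrier p.B" for c y
    using that
  proof (elim p.B_carrierE)
    fix Y assume Y: "Y \<in> carrier p.S" "y = p.cls Y"
    have "tends (\<lambda>k. c \<odot> ev (Y k)) (c \<odot> \<phi> y)"
      using Y \<phi>[OF Y(1)] by (intro tends_smult) (auto simp: p.S_free)
    then have "\<phi> (p.cls (\<lambda>k. poly_scale c (Y k))) = c \<odot> \<phi> y"
      using Y \<phi>[OF Y(1)] by (intro \<phi>_eq) (auto simp: ev_scale p.S_free)
    then show ?thesis using Y by simp
  qed
  have \<phi>_adj: "\<phi> (adj p.B y) = adj A (\<phi> y)" if "y \<in> carrier p.B" for y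
    using that
  proof (elim p.B_carrierE)
    fix Y assume Y: "Y \<in> carrier p.S" "y = p.cls Y"
    have "tends (\<lambda>k. adj A (ev (Y k))) (adj A (\<phi> y))"
      using Y \<phi>[OF Y(1)] by (intro tends_adj) (auto simp: p.S_free)
    then have "\<phi> (p.cls (\<lambda>k. poly_adj (Y k))) = adj A (\<phi> y)"
      using Y \<phi>[OF Y(1)] by (intro \<phi>_eq) (auto simp: ev_adj p.S_free)
    then show ?thesis using Y by simp
  qed
  have \<phi>_\<iota>: "\<phi> (p.\<iota> x) = ev x" if "x \<in> FG" for x
    unfolding to_completion_def using that by (intro \<phi>_eq) (auto simp: a_minus_def r_neg)
  have "\<phi> \<one>\<^bsub>p.B\<^esub> = \<one>"
    using \<phi>_\<iota>[of 1] by (simp add: ev_1 p.\<iota>_1 del: p.B_simps)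
  moreover have "nrm A (\<phi> z) \<le> nrm p.B z" if "z \<in> carrier p.B" for z
    using that
  proof (elim p.B_carrierE)
    fix X assume X: "X \<in> carrier p.S" "z = p.cls X"
    have "(\<lambda>k. nrm A (ev (X k))) \<longlonglongrightarrow> nrm A (\<phi> z)"
      using X \<phi>[OF X(1)] by (intro nrm_tendsto) (auto simp: p.S_free)
    then show ?thesis
      unfolding X(2) by (rule LIMSEQ_le[OF _ p.nrm_cls_lim[OF X(1)]]) (auto simp: le p.S_free[OF X(1)])
  qed
  ultimately show ?thesis
    using \<phi>_in \<phi>_add \<phi>_mult \<phi>_smult \<phi>_adj \<phi>_\<iota>
    by (intro bexI[of _ \<phi>]) (auto simp: star_hom_def ring_hom_def simp del: p.B_simps)
qed

end

context star_seminorm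
begin

abbreviation "gens \<equiv> \<lambda>g. \<iota> (poly_gen g)"

sublocale gens: cstar_family B G gens
  by unfold_locales (simp add: \<iota>_in free_gen)

lemma ev_gens_word: "fst ` set (letters w) \<subseteq> G \<Longrightarrow> word_eval B gens w = \<iota> (Poly_Mapping.single w 1)"
proof (induction "letters w" arbitrary: w)
  case Nil
  then have "w = 0" by (metis star_word.collapse zero_star_word_def)
  then show ?case by (simp add: gens.wev_0 \<iota>_1)
next
  case (Cons l ls)
  obtain g b where l: "l = (g, b)" by (cases l)
  have w: "w = Word ((g, b) # ls)" using Cons.hyps(2) l by (metis star_word.collapse)
  have g: "g \<in> G" "fst ` set ls \<subseteq> G" using Cons.prems w by auto
  have s: "Poly_Mapping.single w (1 :: complex) =
      Poly_Mapping.single (Word [(g, b)]) 1 * Poly_Mapping.single (Word ls) 1"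
    by (simp add: w mult_single plus_star_word_def)
  have "\<iota> (Poly_Mapping.single w 1) = \<iota> (Poly_Mapping.single (Word [(g, b)]) 1) \<otimes>\<^bsub>B\<^esub> \<iota> (Poly_Mapping.single (Word ls) 1)"
    unfolding s using g by (intro \<iota>_hom free_single) auto
  also have "\<iota> (Poly_Mapping.single (Word [(g, b)]) 1) = (if b then adj B (gens g) else gens g)"
    using \<iota>_hom(5)[OF free_gen free_gen, OF g(1) g(1)] by (simp add: poly_gen_def word_adj_def)
  also have "\<iota> (Poly_Mapping.single (Word ls) 1) = word_eval B gens (Word ls)"
    using Cons.hyps(1)[of "Word ls"] g by simp
  finally show ?case by (simp add: w gens.wev_Cons)
qed

lemma ev_gens: "x \<in> F \<Longrightarrow> poly_eval B gens x = \<iota> x"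
proof (induction x rule: free_induct)
  case (single w c)
  have "Poly_Mapping.single w c = poly_scale c (Poly_Mapping.single w 1)"
    by (simp add: poly_scale_single)
  then show ?case
    using single \<iota>_hom(4)[OF free_single[OF single, of 1] free_single[OF single, of 1], of c] gens.ev_single[of w c]
    by (simp add: ev_gens_word)
qed (simp add: gens.ev_add \<iota>_hom)

lemma ev_gens_eq_0: "x \<in> F \<Longrightarrow> poly_eval B gens x = \<zero>\<^bsub>B\<^esub> \<longleftrightarrow> p x = 0"
  by (simp add: ev_gens \<iota>_in nrm_\<iota> flip: B.nrm_eq_0)

lemma ev_gens_all_0: "R \<subseteq> F \<Longrightarrow> (\<forall>r\<in>R. poly_eval B gens r = \<zero>\<^bsub>B\<^esub>) \<longleftrightarrow> (\<forall>r\<in>R. p r = 0)"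
  by (metis ev_gens_eq_0 subsetD)

end

locale universal_relations =
  fixes G :: "'g set" and P :: "'g completed cstar \<Rightarrow> ('g \<Rightarrow> 'g completed) \<Rightarrow> bool"
    and R :: "'g star_poly set"
  assumes R_free: "R \<subseteq> free_star_algebra G"
    and P_iff: "cstar_seminorm G p \<Longrightarrow>
      P (completion G p) (\<lambda>g. to_completion G p (poly_gen g)) \<longleftrightarrow> (\<forall>r\<in>R. p r = 0)"
    and gen_le: "cstar_seminorm G p \<Longrightarrow> \<forall>r\<in>R. p r = 0 \<Longrightarrow> g \<in> G \<Longrightarrow> p (poly_gen g) \<le> 1"
begin

abbreviation "U \<equiv> universal_seminorm G P"
definition "adm = {p. cstar_seminorm G p \<and> (\<forall>r\<in>R. p r = 0)}"

lemma U_def: "U x = (SUP p\<in>adm. p x)"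
  unfolding universal_seminorm_def adm_def by (rule arg_cong[where f = Sup]) (auto simp: P_iff)

lemma adm_word_le:
  assumes "p \<in> adm" "fst ` set (letters w) \<subseteq> G"
  shows "p (Poly_Mapping.single w 1) \<le> 1"
proof -
  interpret star_seminorm G p using assms by unfold_locales (simp add: adm_def)
  show ?thesis
    using assms(2)
  proof (induction "letters w" arbitrary: w)
    case Nil
    then have "w = 0" by (metis star_word.collapse zero_star_word_def)
    moreover have "p 1 * p 1 = p 1" using p_cstar[of 1] by (simp add: power2_eq_square)
    then have "p 1 \<le> 1" by (cases "p 1 = 0") simp_all
    ultimately show ?case by simp
  next
    case (Cons l ls)
    obtain g b where l: "l = (g, b)" by (cases l)
    have w: "w = Word ((g, b) # ls)" using Cons.hyps(2) l by (metis star_word.collapse)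
    have g: "g \<in> G" "fst ` set ls \<subseteq> G" using Cons.prems w by auto
    have s: "Poly_Mapping.single w (1 :: complex) =
        Poly_Mapping.single (Word [(g, b)]) 1 * Poly_Mapping.single (Word ls) 1"
      by (simp add: w mult_single plus_star_word_def)
    have F: "Poly_Mapping.single (Word [(g, b)]) 1 \<in> F" "Poly_Mapping.single (Word ls) 1 \<in> F"
      using g by (simp_all add: free_single)
    have "p (Poly_Mapping.single (Word [(g, b)]) 1) = p (poly_gen g)"
      using p_adj[OF free_gen[OF g(1)]] by (cases b) (simp_all add: poly_gen_def word_adj_def)
    then have "p (Poly_Mapping.single (Word [(g, b)]) 1) \<le> 1"
      using gen_le[of p g] assms(1) g by (simp add: adm_def)
    moreover have "p (Poly_Mapping.single (Word ls) 1) \<le> 1"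
      using Cons.hyps(1)[of "Word ls"] g by simp
    ultimately have "p (Poly_Mapping.single (Word [(g, b)]) 1) * p (Poly_Mapping.single (Word ls) 1) \<le> 1"
      using F p_nonneg by (simp add: mult_le_one)
    then show ?case using p_mult[OF F] by (simp add: s)
  qed
qed

lemma adm_bound:
  assumes "x \<in> free_star_algebra G"
  shows "\<exists>K. \<forall>p\<in>adm. p x \<le> K"
  using assms
proof (induction x rule: free_induct)
  case (single w c)
  have "p (Poly_Mapping.single w c) \<le> cmod c" if "p \<in> adm" for p
  proof -
    interpret star_seminorm G p using that by unfold_locales (simp add: adm_def)
    have "p (Poly_Mapping.single w c) = cmod c * p (Poly_Mapping.single w 1)"
      using p_scale[OF free_single[OF single, of 1], of c] by (simp add: poly_scale_single)
    also have "\<dots> \<le> cmod c * 1"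
      using adm_word_le[OF that single] by (intro mult_left_mono) auto
    finally show ?thesis by simp
  qed
  then show ?case by blast
next
  case (add x y)
  then obtain K L where "\<forall>p\<in>adm. p x \<le> K" "\<forall>p\<in>adm. p y \<le> L" by blast
  then have "\<forall>p\<in>adm. p (x + y) \<le> K + L"
    using add(1,2) by (fastforce simp: adm_def cstar_seminorm_def)
  then show ?case by blast
qed

lemma adm_bdd: "x \<in> free_star_algebra G \<Longrightarrow> bdd_above ((\<lambda>p. p x) ` adm)"
  using adm_bound[of x] by (auto simp: bdd_above_def)

lemma adm_le_U: "p \<in> adm \<Longrightarrow> x \<in> free_star_algebra G \<Longrightarrow> p x \<le> U x"
  unfolding U_def by (intro cSUP_upper adm_bdd)

lemma zero_adm: "(\<lambda>x. 0) \<in> adm"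
  by (simp add: adm_def cstar_seminorm_def)

lemma U_le: "(\<And>p. p \<in> adm \<Longrightarrow> p x \<le> K) \<Longrightarrow> U x \<le> K"
  unfolding U_def using zero_adm by (intro cSUP_least) auto

lemma U_nonneg: "x \<in> free_star_algebra G \<Longrightarrow> 0 \<le> U x"
  using adm_le_U[OF zero_adm] .

lemma U_seminorm: "cstar_seminorm G U"
proof -
  have 1: "U (poly_scale c x) = cmod c * U x" if x: "x \<in> free_star_algebra G" for c x
  proof (rule antisym)
    show "U (poly_scale c x) \<le> cmod c * U x"
    proof (rule U_le)
      fix p assume p: "p \<in> adm"
      then interpret star_seminorm G p by unfold_locales (simp add: adm_def)
      show "p (poly_scale c x) \<le> cmod c * U x"
        using p x by (simp add: p_scale mult_left_mono adm_le_U)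
    qed
    show "cmod c * U x \<le> U (poly_scale c x)"
    proof (cases "c = 0")
      case False
      have "U x \<le> U (poly_scale c x) / cmod c"
      proof (rule U_le)
        fix p assume p: "p \<in> adm"
        then interpret star_seminorm G p by unfold_locales (simp add: adm_def)
        have "cmod c * p x \<le> U (poly_scale c x)"
          using adm_le_U[OF p free_scale[OF x, of c]] x by (simp add: p_scale)
        then show "p x \<le> U (poly_scale c x) / cmod c"
          using False by (simp add: field_simps)
      qed
      then show ?thesis using False by (simp add: field_simps)
    qed (simp add: U_nonneg free_scale x)
  qed
  have 2: "U (x + y) \<le> U x + U y" "U (x * y) \<le> U x * U y"
    if xy: "x \<in> free_star_algebra G" "y \<in> free_star_algebra G" for x y
  proof -
    show "U (x + y) \<le> U x + U y"
    proof (rule U_le)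
      fix p assume p: "p \<in> adm"
      then interpret star_seminorm G p by unfold_locales (simp add: adm_def)
      show "p (x + y) \<le> U x + U y"
        using p_add[OF xy] adm_le_U[OF p xy(1)] adm_le_U[OF p xy(2)] by simp
    qed
    show "U (x * y) \<le> U x * U y"
    proof (rule U_le)
      fix p assume p: "p \<in> adm"
      then interpret star_seminorm G p by unfold_locales (simp add: adm_def)
      have "p x * p y \<le> U x * U y"
        using p xy by (intro mult_mono adm_le_U U_nonneg p_nonneg)
      then show "p (x * y) \<le> U x * U y" using p_mult[OF xy] by simp
    qed
  qed
  have 3: "U (poly_adj x * x) = (U x)\<^sup>2" if x: "x \<in> free_star_algebra G" for x
  proof (rule antisym)
    have ax: "poly_adj x * x \<in> free_star_algebra G" using x by (intro free_mult free_adj)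
    show "U (poly_adj x * x) \<le> (U x)\<^sup>2"
    proof (rule U_le)
      fix p assume p: "p \<in> adm"
      then interpret star_seminorm G p by unfold_locales (simp add: adm_def)
      show "p (poly_adj x * x) \<le> (U x)\<^sup>2"
        using p x by (simp add: p_cstar power_mono adm_le_U p_nonneg)
    qed
    have "U x \<le> sqrt (U (poly_adj x * x))"
    proof (rule U_le)
      fix p assume p: "p \<in> adm"
      then interpret star_seminorm G p by unfold_locales (simp add: adm_def)
      show "p x \<le> sqrt (U (poly_adj x * x))"
        using adm_le_U[OF p ax] p_cstar[OF x] by (intro real_le_rsqrt) simp
    qed
    then have "(U x)\<^sup>2 \<le> (sqrt (U (poly_adj x * x)))\<^sup>2"
      using U_nonneg[OF x] by (intro power_mono)
    then show "(U x)\<^sup>2 \<le> U (poly_adj x * x)"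
      using U_nonneg[OF ax] by simp
  qed
  show ?thesis
    unfolding cstar_seminorm_def using U_nonneg 1 2 3 by blast
qed

lemma U_R: "r \<in> R \<Longrightarrow> U r = 0"
  using U_nonneg[of r] R_free U_le[of r 0] by (fastforce simp: adm_def)

lemma universal_property:
  fixes A :: "('a, 'm) cstar_scheme"
  assumes "cstar_algebra A" "\<And>g. g \<in> G \<Longrightarrow> v g \<in> carrier A"
    and rel: "\<And>r. r \<in> R \<Longrightarrow> poly_eval A v r = \<zero>\<^bsub>A\<^esub>"
  shows "\<exists>\<phi>\<in>star_hom (universal_cstar G P) A. \<forall>g\<in>G. \<phi> (universal_gen G P g) = v g"
proof -
  interpret A: cstar_algebra A by fact
  interpret A: cstar_family A G v by unfold_locales (rule assms(2))
  have "(\<lambda>x. nrm A (A.ev x)) \<in> adm"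
    using A.ev_seminorm rel by (simp add: adm_def)
  then have "nrm A (A.ev x) \<le> U x" if "x \<in> free_star_algebra G" for x
    using adm_le_U that by blast
  from A.completion_extend[OF U_seminorm this] show ?thesis
    unfolding universal_cstar_def universal_gen_def
    using A.ev_gen by (metis (no_types, lifting) free_gen)
qed

lemma universal_cstar_algebra: "cstar_algebra (universal_cstar G P)"
proof -
  interpret star_seminorm G U by unfold_locales (rule U_seminorm)
  show ?thesis unfolding universal_cstar_def by (rule B.cstar_algebra_axioms)
qed

lemma universal_gens: "P (universal_cstar G P) (universal_gen G P)"
proof -
  have "universal_gen G P = (\<lambda>g. to_completion G U (poly_gen g))"
    by (rule ext) (rule universal_gen_def)
  then show ?thesis
    unfolding universal_cstar_def using P_iff[OF U_seminorm] U_R by simp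
qed

lemma universal_generated:
  assumes "z \<in> carrier (universal_cstar G P)"
  shows "\<exists>X. (\<forall>k. X k \<in> free_star_algebra G) \<and>
    (\<lambda>k. nrm (universal_cstar G P) (poly_eval (universal_cstar G P) (universal_gen G P) (X k)
      \<ominus>\<^bsub>universal_cstar G P\<^esub> z)) \<longlonglongrightarrow> 0"
proof -
  interpret star_seminorm G U by unfold_locales (rule U_seminorm)
  have g: "universal_gen G P = gens"
    by (rule ext) (rule universal_gen_def)
  obtain X where X: "X \<in> carrier S" "z = cls X"
    using assms B_carrierE unfolding universal_cstar_def by blast
  show ?thesis
    unfolding universal_cstar_def g using \<iota>_dense[OF X(1)] X
    by (intro exI[of _ X]) (simp add: S_free ev_gens)
qed

end

subsection \<open>The universal properties of A_s and A_h\<close>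

definition magic_relators :: "nat \<Rightarrow> (nat \<times> nat) star_poly set" where
  "magic_relators N = (let u = \<lambda>i j. poly_gen (i, j) in
     {poly_adj (u i j) - u i j | i j. i < N \<and> j < N} \<union>
     {u i j * u i j - u i j | i j. i < N \<and> j < N} \<union>
     {u i j * u i k | i j k. i < N \<and> j < N \<and> k < N \<and> j \<noteq> k} \<union>
     {u j i * u k i | i j k. i < N \<and> j < N \<and> k < N \<and> j \<noteq> k} \<union>
     {(\<Sum>j<N. u i j) - 1 | i. i < N} \<union> {(\<Sum>j<N. u j i) - 1 | i. i < N})"

definition sudoku_relators :: "nat \<Rightarrow> (nat \<times> nat) star_poly set" where
  "sudoku_relators n = (let u = \<lambda>i j. poly_gen (i, j) in
     magic_relators (2 * n) \<union>
     {u i j - u (n + i) (n + j) | i j. i < n \<and> j < n} \<union>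
     {u i (n + j) - u (n + i) j | i j. i < n \<and> j < n})"

lemma gen_in: "i < N \<Longrightarrow> j < N \<Longrightarrow> poly_gen (i, j) \<in> free_star_algebra ({..<N} \<times> {..<N})" for i j N :: nat
  by (rule free_gen) simp

lemma magic_relators_free: "magic_relators N \<subseteq> free_star_algebra ({..<N} \<times> {..<N})"
  unfolding magic_relators_def Let_def
  by (auto intro!: free_minus free_adj free_mult gen_in free_sum)

lemma sudoku_relators_free: "sudoku_relators n \<subseteq> free_star_algebra ({..<2 * n} \<times> {..<2 * n})"
  unfolding sudoku_relators_def Let_def using magic_relators_free[of "2 * n"]
  by (auto intro!: free_minus gen_in)

lemma ball_relators1: "(\<forall>r\<in>{f i | i. i < N}. Q r) \<longleftrightarrow> (\<forall>i<N. Q (f i))"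
  and ball_relators2: "(\<forall>r\<in>{f' i j | i j. i < N \<and> j < N}. Q r) \<longleftrightarrow> (\<forall>i<N. \<forall>j<N. Q (f' i j))"
  and ball_relators3: "(\<forall>r\<in>{f'' i j k | i j k. i < N \<and> j < N \<and> k < N \<and> j \<noteq> k}. Q r) \<longleftrightarrow>
    (\<forall>i<N. \<forall>j<N. \<forall>k<N. j \<noteq> k \<longrightarrow> Q (f'' i j k))"
  for N :: nat
  by blast+

lemma magic_unitary_iff:
  assumes "star_family A ({..<N} \<times> {..<N}) v"
  shows "magic_unitary A N (curry v) \<longleftrightarrow> (\<forall>r\<in>magic_relators N. poly_eval A v r = \<zero>\<^bsub>A\<^esub>)"
proof -
  interpret star_family A "{..<N} \<times> {..<N}" v by fact
  let ?u = "\<lambda>i j. poly_gen (i, j)"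
  have v: "v (i, j) \<in> carrier A" if "i < N" "j < N" for i j
    using that v_in[of "(i, j)"] by simp
  have g: "ev (?u i j) = v (i, j)" if "i < N" "j < N" for i j
    using that ev_gen[of "(i, j)"] by simp
  have 1: "ev (poly_adj (?u i j) - ?u i j) = \<zero>\<^bsub>A\<^esub> \<longleftrightarrow> adj A (v (i, j)) = v (i, j)"
    "ev (?u i j * ?u i j - ?u i j) = \<zero>\<^bsub>A\<^esub> \<longleftrightarrow> v (i, j) \<otimes>\<^bsub>A\<^esub> v (i, j) = v (i, j)"
    if "i < N" "j < N" for i j
    using that by (simp_all add: ev_minus ev_adj ev_mult free_adj free_mult gen_in g v eq_diff_zero)
  have 2: "ev (?u i j * ?u k l) = v (i, j) \<otimes>\<^bsub>A\<^esub> v (k, l)"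
    if "i < N" "j < N" "k < N" "l < N" for i j k l
    using that by (simp add: ev_mult gen_in g)
  have 3: "ev ((\<Sum>j<N. ?u i j) - 1) = \<zero>\<^bsub>A\<^esub> \<longleftrightarrow> (\<Oplus>\<^bsub>A\<^esub>j\<in>{..<N}. v (i, j)) = \<one>\<^bsub>A\<^esub>"
    "ev ((\<Sum>j<N. ?u j i) - 1) = \<zero>\<^bsub>A\<^esub> \<longleftrightarrow> (\<Oplus>\<^bsub>A\<^esub>j\<in>{..<N}. v (j, i)) = \<one>\<^bsub>A\<^esub>"
    if i: "i < N" for i
  proof -
    have "ev (\<Sum>j<N. ?u i j) = (\<Oplus>\<^bsub>A\<^esub>j\<in>{..<N}. ev (?u i j))"
      "ev (\<Sum>j<N. ?u j i) = (\<Oplus>\<^bsub>A\<^esub>j\<in>{..<N}. ev (?u j i))"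
      using i by (auto intro!: ev_sum gen_in)
    moreover have "(\<Sum>j<N. ?u i j) \<in> FG" "(\<Sum>j<N. ?u j i) \<in> FG"
      using i by (auto intro!: free_sum gen_in)
    moreover have "(\<Oplus>\<^bsub>A\<^esub>j\<in>{..<N}. ev (?u i j)) = (\<Oplus>\<^bsub>A\<^esub>j\<in>{..<N}. v (i, j))"
      "(\<Oplus>\<^bsub>A\<^esub>j\<in>{..<N}. ev (?u j i)) = (\<Oplus>\<^bsub>A\<^esub>j\<in>{..<N}. v (j, i))"
      using i by (auto intro!: finsum_cong' simp: g v)
    ultimately show "ev ((\<Sum>j<N. ?u i j) - 1) = \<zero>\<^bsub>A\<^esub> \<longleftrightarrow> (\<Oplus>\<^bsub>A\<^esub>j\<in>{..<N}. v (i, j)) = \<one>\<^bsub>A\<^esub>"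
      "ev ((\<Sum>j<N. ?u j i) - 1) = \<zero>\<^bsub>A\<^esub> \<longleftrightarrow> (\<Oplus>\<^bsub>A\<^esub>j\<in>{..<N}. v (j, i)) = \<one>\<^bsub>A\<^esub>"
      using i by (simp_all add: ev_minus ev_1 eq_diff_zero finsum_closed v Pi_def)
  qed
  have "(\<forall>r\<in>magic_relators N. ev r = \<zero>\<^bsub>A\<^esub>) \<longleftrightarrow>
    (\<forall>i<N. \<forall>j<N. ev (poly_adj (?u i j) - ?u i j) = \<zero>\<^bsub>A\<^esub>) \<and>
    (\<forall>i<N. \<forall>j<N. ev (?u i j * ?u i j - ?u i j) = \<zero>\<^bsub>A\<^esub>) \<and>
    (\<forall>i<N. \<forall>j<N. \<forall>k<N. j \<noteq> k \<longrightarrow> ev (?u i j * ?u i k) = \<zero>\<^bsub>A\<^esub>) \<and>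
    (\<forall>i<N. \<forall>j<N. \<forall>k<N. j \<noteq> k \<longrightarrow> ev (?u j i * ?u k i) = \<zero>\<^bsub>A\<^esub>) \<and>
    (\<forall>i<N. ev ((\<Sum>j<N. ?u i j) - 1) = \<zero>\<^bsub>A\<^esub>) \<and> (\<forall>i<N. ev ((\<Sum>j<N. ?u j i) - 1) = \<zero>\<^bsub>A\<^esub>)"
    unfolding magic_relators_def Let_def ball_Un ball_relators1 ball_relators2 ball_relators3 conj_assoc by (rule refl)
  also have "\<dots> \<longleftrightarrow> (\<forall>i<N. \<forall>j<N. adj A (v (i, j)) = v (i, j)) \<and>
    (\<forall>i<N. \<forall>j<N. v (i, j) \<otimes>\<^bsub>A\<^esub> v (i, j) = v (i, j)) \<and>
    (\<forall>i<N. \<forall>j<N. \<forall>k<N. j \<noteq> k \<longrightarrow> v (i, j) \<otimes>\<^bsub>A\<^esub> v (i, k) = \<zero>\<^bsub>A\<^esub>) \<and>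
    (\<forall>i<N. \<forall>j<N. \<forall>k<N. j \<noteq> k \<longrightarrow> v (j, i) \<otimes>\<^bsub>A\<^esub> v (k, i) = \<zero>\<^bsub>A\<^esub>) \<and>
    (\<forall>i<N. (\<Oplus>\<^bsub>A\<^esub>j\<in>{..<N}. v (i, j)) = \<one>\<^bsub>A\<^esub>) \<and> (\<forall>i<N. (\<Oplus>\<^bsub>A\<^esub>j\<in>{..<N}. v (j, i)) = \<one>\<^bsub>A\<^esub>)"
    by (simp add: 1 2 3)
  also have "\<dots> \<longleftrightarrow> magic_unitary A N (curry v)"
    unfolding magic_unitary_def projection_def curry_conv by (intro iffI conjI allI impI; simp add: v)
  finally show ?thesis by simp
qed

lemma sudoku_unitary_iff:
  assumes "star_family A ({..<2 * n} \<times> {..<2 * n}) v"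
  shows "sudoku_unitary A n (curry v) \<longleftrightarrow> (\<forall>r\<in>sudoku_relators n. poly_eval A v r = \<zero>\<^bsub>A\<^esub>)"
proof -
  interpret star_family A "{..<2 * n} \<times> {..<2 * n}" v by fact
  let ?u = "\<lambda>i j. poly_gen (i, j)"
  have v: "v (i, j) \<in> carrier A" "ev (?u i j) = v (i, j)" if "i < 2 * n" "j < 2 * n" for i j
    using that v_in[of "(i, j)"] ev_gen[of "(i, j)"] by simp_all
  have d: "ev (?u i j - ?u k l) = \<zero>\<^bsub>A\<^esub> \<longleftrightarrow> v (i, j) = v (k, l)"
    if "i < 2 * n" "j < 2 * n" "k < 2 * n" "l < 2 * n" for i j k l
    using that by (simp add: ev_minus gen_in v eq_diff_zero)
  have "(\<forall>r\<in>sudoku_relators n. ev r = \<zero>\<^bsub>A\<^esub>) \<longleftrightarrow>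
    (\<forall>r\<in>magic_relators (2 * n). ev r = \<zero>\<^bsub>A\<^esub>) \<and>
    (\<forall>i<n. \<forall>j<n. ev (?u i j - ?u (n + i) (n + j)) = \<zero>\<^bsub>A\<^esub>) \<and>
    (\<forall>i<n. \<forall>j<n. ev (?u i (n + j) - ?u (n + i) j) = \<zero>\<^bsub>A\<^esub>)"
    unfolding sudoku_relators_def Let_def ball_Un ball_relators2 conj_assoc by (rule refl)
  also have "\<dots> \<longleftrightarrow> magic_unitary A (2 * n) (curry v) \<and>
    (\<forall>i<n. \<forall>j<n. v (i, j) = v (n + i, n + j)) \<and> (\<forall>i<n. \<forall>j<n. v (i, n + j) = v (n + i, j))"
    by (simp add: magic_unitary_iff[OF assms] d)
  also have "\<dots> \<longleftrightarrow> sudoku_unitary A n (curry v)"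
    unfolding sudoku_unitary_def
  proof
    assume *: "magic_unitary A (2 * n) (curry v) \<and>
      (\<forall>i<n. \<forall>j<n. v (i, j) = v (n + i, n + j)) \<and> (\<forall>i<n. \<forall>j<n. v (i, n + j) = v (n + i, j))"
    show "magic_unitary A (2 * n) (curry v) \<and> (\<exists>a b. \<forall>i<n. \<forall>j<n. curry v i j = a i j \<and>
      curry v i (n + j) = b i j \<and> curry v (n + i) j = b i j \<and> curry v (n + i) (n + j) = a i j)"
      by (intro conjI exI[of _ "\<lambda>i j. v (i, j)"] exI[of _ "\<lambda>i j. v (i, n + j)"]) (simp_all add: *)
  next
    assume "magic_unitary A (2 * n) (curry v) \<and> (\<exists>a b. \<forall>i<n. \<forall>j<n. curry v i j = a i j \<and>
      curry v i (n + j) = b i j \<and> curry v (n + i) j = b i j \<and> curry v (n + i) (n + j) = a i j)"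
    then show "magic_unitary A (2 * n) (curry v) \<and>
      (\<forall>i<n. \<forall>j<n. v (i, j) = v (n + i, n + j)) \<and> (\<forall>i<n. \<forall>j<n. v (i, n + j) = v (n + i, j))"
      by (elim conjE exE) (simp add: curry_def)
  qed
  finally show ?thesis by simp
qed

lemma magic_gen_le:
  assumes "cstar_seminorm ({..<N} \<times> {..<N}) p" "\<forall>r\<in>magic_relators N. p r = 0"
    "g \<in> {..<N} \<times> {..<N}"
  shows "p (poly_gen g) \<le> 1"
proof -
  interpret star_seminorm "{..<N} \<times> {..<N}" p by unfold_locales fact
  have "magic_unitary B N (curry gens)"
    using assms(2) magic_relators_free[of N]
    by (simp add: magic_unitary_iff[OF gens.star_family_axioms] ev_gens_all_0)
  then have "projection B (gens g)"
    using assms(3) by (auto simp: magic_unitary_def)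
  then show ?thesis
    using B.nrm_projection_le[of "gens g"] nrm_\<iota>[OF free_gen[OF assms(3)]] by simp
qed

interpretation A_s: universal_relations "{..<N} \<times> {..<N}" "\<lambda>A u. magic_unitary A N (curry u)"
  "magic_relators N" for N
proof
  fix p assume "cstar_seminorm ({..<N} \<times> {..<N}) p"
  then interpret star_seminorm "{..<N} \<times> {..<N}" p by unfold_locales
  show "magic_unitary B N (curry gens) \<longleftrightarrow> (\<forall>r\<in>magic_relators N. p r = 0)"
    using magic_relators_free[of N]
    by (simp add: magic_unitary_iff[OF gens.star_family_axioms] ev_gens_all_0)
qed (use magic_relators_free magic_gen_le in auto)

interpretation A_h: universal_relations "{..<2 * n} \<times> {..<2 * n}" "\<lambda>A w. sudoku_unitary A n (curry w)"
  "sudoku_relators n" for n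
proof
  fix p assume "cstar_seminorm ({..<2 * n} \<times> {..<2 * n}) p"
  then interpret star_seminorm "{..<2 * n} \<times> {..<2 * n}" p by unfold_locales
  show "sudoku_unitary B n (curry gens) \<longleftrightarrow> (\<forall>r\<in>sudoku_relators n. p r = 0)"
    using sudoku_relators_free[of n]
    by (simp add: sudoku_unitary_iff[OF gens.star_family_axioms] ev_gens_all_0)
next
  fix p g
  assume "cstar_seminorm ({..<2 * n} \<times> {..<2 * n}) p" "\<forall>r\<in>sudoku_relators n. p r = 0"
    "g \<in> {..<2 * n} \<times> {..<2 * n}"
  moreover have "magic_relators (2 * n) \<subseteq> sudoku_relators n"
    by (auto simp: sudoku_relators_def)
  ultimately show "p (poly_gen g) \<le> 1"
    using magic_gen_le[of "2 * n" p g] by auto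
qed (rule sudoku_relators_free)

theorem A_s_cstar_algebra: "cstar_algebra (A_s N)"
  and A_s_magic_unitary: "magic_unitary (A_s N) N (A_s_gen N)"
  using A_s.universal_cstar_algebra[of N] A_s.universal_gens[of N] by (simp_all add: A_s_def A_s_gen_def)

theorem A_h_cstar_algebra: "cstar_algebra (A_h n)"
  and A_h_sudoku_unitary: "sudoku_unitary (A_h n) n (A_h_gen n)"
  using A_h.universal_cstar_algebra[of n] A_h.universal_gens[of n] by (simp_all add: A_h_def A_h_gen_def)

theorem A_s_universal_property:
  assumes A: "cstar_algebra A" and u: "magic_unitary A N u"
  shows "\<exists>\<phi>\<in>star_hom (A_s N) A. \<forall>i<N. \<forall>j<N. \<phi> (A_s_gen N i j) = u i j"
proof -
  interpret cstar_algebra A by (rule A)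
  interpret star_family A "{..<N} \<times> {..<N}" "case_prod u"
    by unfold_locales (use u in \<open>auto simp: magic_unitary_def projection_def\<close>)
  have rel: "poly_eval A (case_prod u) r = \<zero>\<^bsub>A\<^esub>" if "r \<in> magic_relators N" for r
    using magic_unitary_iff[OF star_family_axioms] u that by simp
  have "\<exists>\<phi>\<in>star_hom (A_s N) A. \<forall>g\<in>{..<N} \<times> {..<N}.
      \<phi> (universal_gen ({..<N} \<times> {..<N}) (\<lambda>A u. magic_unitary A N (curry u)) g) = case_prod u g"
    unfolding A_s_def by (rule A_s.universal_property[OF A v_in rel])
  then obtain \<phi> where \<phi>: "\<phi> \<in> star_hom (A_s N) A"
    "\<And>g. g \<in> {..<N} \<times> {..<N} \<Longrightarrow>
      \<phi> (universal_gen ({..<N} \<times> {..<N}) (\<lambda>A u. magic_unitary A N (curry u)) g) = case_prod u g"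
    by metis
  show ?thesis
    by (intro bexI[OF _ \<phi>(1)]) (simp add: A_s_gen_def \<phi>(2))
qed

theorem A_h_universal_property:
  assumes A: "cstar_algebra A" and w: "sudoku_unitary A n w"
  shows "\<exists>\<phi>\<in>star_hom (A_h n) A. \<forall>i<2 * n. \<forall>j<2 * n. \<phi> (A_h_gen n i j) = w i j"
proof -
  interpret cstar_algebra A by (rule A)
  interpret star_family A "{..<2 * n} \<times> {..<2 * n}" "case_prod w"
    by unfold_locales (use w in \<open>auto simp: sudoku_unitary_def magic_unitary_def projection_def\<close>)
  have rel: "poly_eval A (case_prod w) r = \<zero>\<^bsub>A\<^esub>" if "r \<in> sudoku_relators n" for r
    using sudoku_unitary_iff[OF star_family_axioms] w that by simp
  have "\<exists>\<phi>\<in>star_hom (A_h n) A. \<forall>g\<in>{..<2 * n} \<times> {..<2 * n}.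
      \<phi> (universal_gen ({..<2 * n} \<times> {..<2 * n}) (\<lambda>A w. sudoku_unitary A n (curry w)) g) = case_prod w g"
    unfolding A_h_def by (rule A_h.universal_property[OF A v_in rel])
  then obtain \<phi> where \<phi>: "\<phi> \<in> star_hom (A_h n) A"
    "\<And>g. g \<in> {..<2 * n} \<times> {..<2 * n} \<Longrightarrow>
      \<phi> (universal_gen ({..<2 * n} \<times> {..<2 * n}) (\<lambda>A w. sudoku_unitary A n (curry w)) g) = case_prod w g"
    by metis
  show ?thesis
    by (intro bexI[OF _ \<phi>(1)]) (simp add: A_h_gen_def \<phi>(2))
qed

text \<open>Polynomials in the generators and their adjoints are dense.\<close>

theorem A_s_generated:
  assumes "z \<in> carrier (A_s N)"
  shows "\<exists>X. (\<forall>k. X k \<in> free_star_algebra ({..<N} \<times> {..<N})) \<and>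
    (\<lambda>k. nrm (A_s N) (poly_eval (A_s N) (case_prod (A_s_gen N)) (X k) \<ominus>\<^bsub>A_s N\<^esub> z)) \<longlonglongrightarrow> 0"
  using A_s.universal_generated[of z N] assms by (simp add: A_s_def A_s_gen_def)

theorem A_h_generated:
  assumes "z \<in> carrier (A_h n)"
  shows "\<exists>X. (\<forall>k. X k \<in> free_star_algebra ({..<2 * n} \<times> {..<2 * n})) \<and>
    (\<lambda>k. nrm (A_h n) (poly_eval (A_h n) (case_prod (A_h_gen n)) (X k) \<ominus>\<^bsub>A_h n\<^esub> z)) \<longlonglongrightarrow> 0"
  using A_h.universal_generated[of z n] assms by (simp add: A_h_def A_h_gen_def)

end

theory Submission
  imports Defs "HOL-Algebra.UnivPoly"
begin

text \<open>
  For the matrix \<open>e\<close> of disjoint segments, left and right multiplication by \<open>e\<close> exchange the two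
  halves of the rows and of the columns, so \<open>ew = we\<close> says exactly that a magic unitary \<open>w\<close> is
  sudoku.  Hence the canonical map from \<open>A_s(2n)\<close> to \<open>A_h(n)\<close> descends to the quotient, and the
  universal property of \<open>A_h(n)\<close> gives an inverse, once the quotient is known to be a C*-algebra.
  Both maps are contractive, hence isometric.

  The C*-identity of the quotient norm is obtained without functional calculus.  Given a
  self-adjoint \<open>h\<close> in the ideal with \<open>x*x + h\<close> almost of minimal norm, one needs \<open>g \<in> 1 + I\<close> with
  \<open>\<parallel>g\<parallel>\<close> close to 1 and \<open>\<parallel>hg\<parallel>\<close> small; then \<open>\<parallel>xg\<parallel>\<^sup>2 = \<parallel>g*(x*x)g\<parallel>\<close> is at most about \<open>\<parallel>x*x + h\<parallel>\<close>.
  Such a \<open>g\<close> is the average of \<open>1, z, \<dots>, z\<^sup>m\<^sup>-\<^sup>1\<close> for \<open>z = 1 + ich\<close> with real \<open>c\<close>, because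
  \<open>\<parallel>z\<parallel>\<^sup>2 = \<parallel>1 + c\<^sup>2h\<^sup>2\<parallel>\<close> and \<open>ich\<close> times the average is \<open>(z\<^sup>m - 1)/m\<close>.
\<close>

section \<open>The norm on the quotient by a closed star ideal\<close>

text \<open>Lets the slack \<open>e\<close> of nearly optimal representatives tend to 0;
  \<open>f\<close> may be any expression with a limit at 0, such as a product of two
  estimates.\<close>

lemma le_at_right_limit:
  fixes a b :: real and f :: "real \<Rightarrow> real"
  assumes "\<And>e. e > 0 \<Longrightarrow> a \<le> f e" "(f \<longlongrightarrow> b) (at_right 0)"
  shows "a \<le> b"
  by (rule tendsto_lowerbound[OF assms(2)])
    (use assms(1) in \<open>auto simp: eventually_at_filter\<close>)

text \<open>Closedness is what turns the quotient seminorm into a norm, see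
  \<open>Q_nrm_eq_0\<close>.\<close>

locale closed_star_ideal = cstar_algebra A + star_ideal A I
  for A :: "('a, 'm) cstar_scheme" (structure) and I +
  assumes closed: "norm_closed A I"
begin

interpretation Q: star_algebra Q
  by (rule Q_star_algebra)

lemma Q_nrm: "nrm Q X = (INF x\<in>X. nrm A x)"
  by (simp add: star_quotient_def)

lemma coset_eqD:
  assumes "x \<in> carrier A" "y \<in> I +> x"
  shows "y \<in> carrier A" "I +> y = I +> x"
  using assms by (auto simp: mem_coset coset_eq_iff)

lemma Q_nrm_le: "x \<in> carrier A \<Longrightarrow> nrm Q (I +> x) \<le> nrm A x"
  unfolding Q_nrm
  by (rule cINF_lower) (auto simp: a_rcos_self mem_coset intro!: bdd_belowI[of _ 0] nrm_nonneg)

text \<open>The quotient norm is an infimum over the coset, so estimates are made on a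
  representative within \<open>e\<close> of it and return to the quotient through
  \<open>Q_nrm_le\<close>.\<close>

lemma Q_nrm_lift:
  assumes "X \<in> carrier Q" "e > 0"
  obtains y where "y \<in> carrier A" "I +> y = X" "nrm A y < nrm Q X + e"
proof -
  obtain x where x: "x \<in> carrier A" "X = I +> x"
    using assms(1) by (rule Q_carrierE)
  have "(INF y\<in>X. nrm A y) < nrm Q X + e"
    using assms(2) by (simp add: Q_nrm)
  moreover have "X \<noteq> {}"
    using a_rcos_self[OF x(1)] x(2) by blast
  ultimately obtain y where "y \<in> X" "nrm A y < nrm Q X + e"
    using cInf_lessD[of "nrm A ` X"] by blast
  then show ?thesis
    using that coset_eqD[OF x(1), of y] x(2) by auto
qed

lemma Q_nrm_nonneg: "X \<in> carrier Q \<Longrightarrow> 0 \<le> nrm Q X"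
  unfolding Q_nrm by (rule cINF_greatest) (auto elim!: Q_carrierE simp: mem_coset nrm_nonneg dest: a_rcos_self)

lemma Q_nrm_add:
  assumes "X \<in> carrier Q" "Y \<in> carrier Q"
  shows "nrm Q (X \<oplus>\<^bsub>Q\<^esub> Y) \<le> nrm Q X + nrm Q Y"
proof (rule le_at_right_limit)
  fix e :: real assume e: "e > 0"
  obtain x where x: "x \<in> carrier A" "I +> x = X" "nrm A x < nrm Q X + e"
    using Q_nrm_lift[OF assms(1) e] .
  obtain y where y: "y \<in> carrier A" "I +> y = Y" "nrm A y < nrm Q Y + e"
    using Q_nrm_lift[OF assms(2) e] .
  have "nrm Q (X \<oplus>\<^bsub>Q\<^esub> Y) \<le> nrm A (x \<oplus> y)"
    using Q_nrm_le[of "x \<oplus> y"] x y by (simp flip: Q_add)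
  also have "\<dots> \<le> nrm A x + nrm A y"
    using x y by (simp add: nrm_add)
  finally show "nrm Q (X \<oplus>\<^bsub>Q\<^esub> Y) \<le> (nrm Q X + e) + (nrm Q Y + e)"
    using x y by simp
qed (auto intro!: tendsto_eq_intros)

lemma Q_nrm_mult:
  assumes "X \<in> carrier Q" "Y \<in> carrier Q"
  shows "nrm Q (X \<otimes>\<^bsub>Q\<^esub> Y) \<le> nrm Q X * nrm Q Y"
proof (rule le_at_right_limit)
  fix e :: real assume e: "e > 0"
  obtain x where x: "x \<in> carrier A" "I +> x = X" "nrm A x < nrm Q X + e"
    using Q_nrm_lift[OF assms(1) e] .
  obtain y where y: "y \<in> carrier A" "I +> y = Y" "nrm A y < nrm Q Y + e"
    using Q_nrm_lift[OF assms(2) e] .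
  have "nrm Q (X \<otimes>\<^bsub>Q\<^esub> Y) \<le> nrm A (x \<otimes> y)"
    using Q_nrm_le[of "x \<otimes> y"] x y by (simp flip: Q_mult)
  also have "\<dots> \<le> nrm A x * nrm A y"
    using x y by (simp add: nrm_mult)
  also have "\<dots> \<le> (nrm Q X + e) * (nrm Q Y + e)"
    using x y nrm_nonneg by (intro mult_mono) (auto intro: order_trans less_imp_le)
  finally show "nrm Q (X \<otimes>\<^bsub>Q\<^esub> Y) \<le> (nrm Q X + e) * (nrm Q Y + e)" .
qed (auto intro!: tendsto_eq_intros)

lemma Q_nrm_smult_le:
  assumes "X \<in> carrier Q"
  shows "nrm Q (c \<odot>\<^bsub>Q\<^esub> X) \<le> cmod c * nrm Q X"
proof (rule le_at_right_limit)
  fix e :: real assume e: "e > 0"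
  obtain x where x: "x \<in> carrier A" "I +> x = X" "nrm A x < nrm Q X + e"
    using Q_nrm_lift[OF assms(1) e] .
  have "nrm Q (c \<odot>\<^bsub>Q\<^esub> X) \<le> nrm A (c \<odot> x)"
    using Q_nrm_le[of "c \<odot> x"] x by (simp flip: Q_smult)
  then show "nrm Q (c \<odot>\<^bsub>Q\<^esub> X) \<le> cmod c * (nrm Q X + e)"
    using x by (simp add: nrm_smult) (meson less_imp_le mult_left_mono norm_ge_zero order_trans)
qed (auto intro!: tendsto_eq_intros)

lemma Q_nrm_smult:
  assumes "X \<in> carrier Q"
  shows "nrm Q (c \<odot>\<^bsub>Q\<^esub> X) = cmod c * nrm Q X"
proof (cases "c = 0")
  case True
  then show ?thesis
    using assms Q_nrm_smult_le[of X 0] Q_nrm_nonneg[of "\<zero>\<^bsub>Q\<^esub>"] by simp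
next
  case False
  \<comment> \<open>The reverse inequality is the one already proved, for the scalar
    \<open>inverse c\<close>.\<close>
  have "nrm Q (inverse c \<odot>\<^bsub>Q\<^esub> (c \<odot>\<^bsub>Q\<^esub> X)) \<le> cmod (inverse c) * nrm Q (c \<odot>\<^bsub>Q\<^esub> X)"
    using assms by (intro Q_nrm_smult_le) simp
  then have "cmod c * nrm Q X \<le> nrm Q (c \<odot>\<^bsub>Q\<^esub> X)"
    using False assms by (simp add: Q.smult_smult norm_inverse) (simp add: field_simps)
  with Q_nrm_smult_le[OF assms, of c] show ?thesis by simp
qed

lemma Q_nrm_adj_le:
  assumes "X \<in> carrier Q"
  shows "nrm Q (adj Q X) \<le> nrm Q X"
proof (rule le_at_right_limit)
  fix e :: real assume e: "e > 0"
  obtain x where x: "x \<in> carrier A" "I +> x = X" "nrm A x < nrm Q X + e"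
    using Q_nrm_lift[OF assms(1) e] .
  have "nrm Q (adj Q X) \<le> nrm A (adj A x)"
    using Q_nrm_le[of "adj A x"] x by (simp add: adj_closed flip: Q_adj)
  then show "nrm Q (adj Q X) \<le> nrm Q X + e"
    using x by (simp add: nrm_adj)
qed (auto intro!: tendsto_eq_intros)

lemma Q_nrm_eq_0:
  assumes "X \<in> carrier Q"
  shows "nrm Q X = 0 \<longleftrightarrow> X = \<zero>\<^bsub>Q\<^esub>"
proof
  assume 0: "nrm Q X = 0"
  obtain x where x: "x \<in> carrier A" "X = I +> x"
    using assms by (rule Q_carrierE)
  have "\<exists>y\<in>carrier A. I +> y = X \<and> nrm A y < inverse (real (Suc k))" for k
    using Q_nrm_lift[OF assms, of "inverse (real (Suc k))"] 0 by (auto simp del: of_nat_Suc)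
  then obtain y where y: "\<And>k. y k \<in> carrier A" "\<And>k. I +> y k = X"
    "\<And>k. nrm A (y k) < inverse (real (Suc k))" by metis
  have "(\<lambda>k. nrm A (y k)) \<longlonglongrightarrow> 0"
    by (rule tendsto_sandwich[OF _ _ tendsto_const LIMSEQ_inverse_real_of_nat])
      (use y in \<open>auto simp: nrm_nonneg less_imp_le simp del: of_nat_Suc\<close>)
  \<comment> \<open>The elements \<open>x \<ominus> y k\<close> lie in \<open>I\<close> and converge
    to \<open>x\<close>, so closedness puts \<open>x\<close> in \<open>I\<close>.\<close>
  then have "(\<lambda>k. nrm A ((x \<ominus> y k) \<ominus> x)) \<longlonglongrightarrow> 0"
    using x y by (simp add: a_minus_def a_assoc a_comm[of _ "\<ominus> x"] r_neg1 nrm_neg)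
  moreover have "x \<ominus> y k \<in> I" for k
    using x y by (simp flip: coset_eq_iff)
  ultimately have "x \<in> I"
    using closed[unfolded norm_closed_def, rule_format, of "\<lambda>k. x \<ominus> y k" x] x(1) by blast
  then show "X = \<zero>\<^bsub>Q\<^esub>"
    using x coset_eq_iff[of x \<zero>] by (simp add: Q_zero a_minus_def)
next
  assume "X = \<zero>\<^bsub>Q\<^esub>"
  then show "nrm Q X = 0"
    using Q_nrm_le[of \<zero>] Q_nrm_nonneg[OF assms] by (simp add: Q_zero)
qed

section \<open>The C*-identity in the quotient\<close>

lemma nrm_one_le: "nrm A \<one> \<le> 1"
  by (rule nrm_projection_le) (simp add: projection_def adj_one)

text \<open>Here \<open>w = z\<^sup>m\<close> and \<open>g = 1 + z + \<dots> + z\<^sup>m\<^sup>-\<^sup>1\<close>.\<close>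

lemma geometric_sum:
  assumes z: "z \<in> carrier A" "I +> z = \<one>\<^bsub>Q\<^esub>" and s: "nrm A z \<le> s" "s \<ge> 1"
  shows "\<exists>w g. w \<in> carrier A \<and> g \<in> carrier A \<and> nrm A w \<le> s ^ m \<and> nrm A g \<le> of_nat m * s ^ m \<and>
    I +> w = \<one>\<^bsub>Q\<^esub> \<and> I +> g = of_nat m \<odot>\<^bsub>Q\<^esub> \<one>\<^bsub>Q\<^esub> \<and> (z \<ominus> \<one>) \<otimes> g = w \<ominus> \<one>"
proof (induction m)
  case 0
  show ?case
    by (rule exI[of _ \<one>], rule exI[of _ \<zero>])
      (simp add: z(1) nrm_one_le a_minus_def r_neg flip: Q_one Q_zero)
next
  case (Suc m)
  then obtain w g where wg: "w \<in> carrier A" "g \<in> carrier A" "nrm A w \<le> s ^ m"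
    "nrm A g \<le> of_nat m * s ^ m" "I +> w = \<one>\<^bsub>Q\<^esub>" "I +> g = of_nat m \<odot>\<^bsub>Q\<^esub> \<one>\<^bsub>Q\<^esub>"
    "(z \<ominus> \<one>) \<otimes> g = w \<ominus> \<one>" by blast
  \<comment> \<open>The next witnesses are \<open>z \<otimes> w\<close> and
    \<open>g \<oplus> w\<close>. As \<open>s\<close> is at least 1, the old bound on
    \<open>g\<close> may be relaxed to the power \<open>s ^ Suc m\<close>.\<close>
  have 1: "nrm A (z \<otimes> w) \<le> s ^ Suc m"
    using nrm_mult[OF z(1) wg(1)] mult_mono[OF s(1) wg(3)] s nrm_nonneg[OF wg(1)] by simp
  have "s ^ m \<le> s ^ Suc m" using s(2) by simp
  then have 2: "nrm A (g \<oplus> w) \<le> of_nat (Suc m) * s ^ Suc m"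
    using nrm_add[OF wg(2,1)] wg(3,4) mult_left_mono[of "s ^ m" "s ^ Suc m" "of_nat m"]
    by (simp add: algebra_simps)
  have 3: "(z \<ominus> \<one>) \<otimes> (g \<oplus> w) = z \<otimes> w \<ominus> \<one>"
  proof -
    have "(z \<ominus> \<one>) \<otimes> w = z \<otimes> w \<ominus> w"
      using z wg by (simp add: a_minus_def l_distr l_minus)
    then have "(z \<ominus> \<one>) \<otimes> (g \<oplus> w) = (w \<ominus> \<one>) \<oplus> (z \<otimes> w \<ominus> w)"
      using z wg by (simp add: r_distr)
    also have "\<dots> = z \<otimes> w \<ominus> \<one>"
      using z wg by (simp add: a_minus_def a_ac r_neg1 r_neg2)
    finally show ?thesis .
  qed
  have 4: "I +> (z \<otimes> w) = \<one>\<^bsub>Q\<^esub>"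
    using z wg by (simp flip: Q_mult)
  have 5: "I +> (g \<oplus> w) = of_nat (Suc m) \<odot>\<^bsub>Q\<^esub> \<one>\<^bsub>Q\<^esub>"
    using z wg Q.smult_add_left[of "\<one>\<^bsub>Q\<^esub>" "of_nat m" 1] by (simp add: add.commute flip: Q_add)
  show ?case
    using 1 2 3 4 5 z wg by (intro exI[of _ "z \<otimes> w"] exI[of _ "g \<oplus> w"]) simp
qed

text \<open>As \<open>N\<close> grows the first bound tends to 1 and the second to 0, so
  \<open>g\<close> behaves like 1 minus an approximate unit of the ideal.\<close>

lemma almost_annihilator_seq:
  assumes h: "h \<in> I" "adj A h = h" and N: "N > 0"
  shows "\<exists>g\<in>carrier A. I +> g = \<one>\<^bsub>Q\<^esub> \<and> nrm A g \<le> exp ((nrm A h)\<^sup>2 / real N ^ 2) \<and>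
    nrm A (h \<otimes> g) \<le> (exp ((nrm A h)\<^sup>2 / real N ^ 2) + 1) / real N"
proof -
  have hA: "h \<in> carrier A" using h Icarr by blast
  \<comment> \<open>\<open>c\<^sup>2 m \<rightarrow> 0\<close> keeps \<open>z\<^sup>m\<close> bounded by about 1, while \<open>c m \<rightarrow> \<infinity>\<close> makes \<open>\<parallel>hg\<parallel>\<close> small.\<close>
  define c where "c = 1 / real N ^ 3"
  define m where "m = N ^ 4"
  define a where "a = nrm A h"
  \<comment> \<open>The exponent is \<open>c\<^sup>2 * a\<^sup>2\<close>. An exponential dominates
    \<open>1 + c\<^sup>2 * a\<^sup>2\<close> and has a simple \<open>m\<close>-th power, since
    \<open>m / N ^ 6 = 1 / N ^ 2\<close>.\<close>
  define s where "s = exp (a\<^sup>2 / real N ^ 6)"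
  have c: "c > 0" using N by (simp add: c_def)
  define z where "z = \<one> \<oplus> (\<i> * of_real c) \<odot> h"
  have zA: "z \<in> carrier A" using hA by (simp add: z_def)
  have zI: "I +> z = \<one>\<^bsub>Q\<^esub>"
    using hA smult_in[OF h(1)] unfolding Q_one z_def
    by (subst coset_eq_iff) (simp_all add: a_minus_def a_comm[of \<one>] a_assoc r_neg)
  have s: "s \<ge> 1" by (simp add: s_def)
  \<comment> \<open>The terms of first order in \<open>c\<close> cancel because \<open>h\<close> is
    self-adjoint and its coefficient in \<open>z\<close> is purely imaginary.\<close>
  have "adj A z \<otimes> z = \<one> \<oplus> (of_real (c\<^sup>2)) \<odot> (h \<otimes> h)"
  proof -
    have "adj A z = \<one> \<oplus> (- (\<i> * of_real c)) \<odot> h"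
      using hA h(2) by (simp add: z_def adj_add adj_one adj_smult)
    moreover have "- (\<i> * of_real c * (\<i> * of_real c)) = (of_real c * of_real c :: complex)"
      by (simp add: algebra_simps)
    ultimately have "adj A z \<otimes> z = \<one> \<oplus> (\<i> * of_real c) \<odot> h \<oplus>
        ((- (\<i> * of_real c)) \<odot> h \<oplus> (of_real (c\<^sup>2)) \<odot> (h \<otimes> h))"
      using hA by (simp add: z_def l_distr r_distr smult_mult_l smult_mult_r smult_smult smult_add power2_eq_square a_ac)
    also have "\<dots> = \<one> \<oplus> (((\<i> * of_real c) \<odot> h \<oplus> (- (\<i> * of_real c)) \<odot> h) \<oplus> (of_real (c\<^sup>2)) \<odot> (h \<otimes> h))"
      using hA by (simp add: a_assoc)
    also have "(\<i> * of_real c) \<odot> h \<oplus> (- (\<i> * of_real c)) \<odot> h = \<zero>"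
      using hA by (simp flip: smult_add_left)
    finally show ?thesis using hA by simp
  qed
  then have "(nrm A z)\<^sup>2 \<le> nrm A \<one> + c\<^sup>2 * nrm A (h \<otimes> h)"
    using nrm_cstar[OF zA] nrm_add[of \<one> "(of_real (c\<^sup>2)) \<odot> (h \<otimes> h)"] hA
    by (simp add: nrm_smult norm_power)
  also have "\<dots> \<le> 1 + c\<^sup>2 * (a * a)"
    using nrm_one_le nrm_mult[OF hA hA] by (intro add_mono mult_left_mono) (simp_all add: a_def)
  also have "\<dots> = 1 + a\<^sup>2 / real N ^ 6"
    by (simp add: c_def power2_eq_square power_divide flip: power_add)
  also have "\<dots> \<le> s" unfolding s_def by (rule exp_ge_add_one_self)
  \<comment> \<open>Wasteful, but it avoids taking a square root of \<open>s\<close>.\<close>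
  also have "\<dots> \<le> s\<^sup>2" using s by (simp add: power2_eq_square)
  finally have zs: "nrm A z \<le> s"
    by (rule power2_le_imp_le) (use s in simp)
  obtain w g where wg: "w \<in> carrier A" "g \<in> carrier A" "nrm A w \<le> s ^ m"
    "nrm A g \<le> of_nat m * s ^ m" "I +> g = of_nat m \<odot>\<^bsub>Q\<^esub> \<one>\<^bsub>Q\<^esub>" "(z \<ominus> \<one>) \<otimes> g = w \<ominus> \<one>"
    using geometric_sum[OF zA zI zs s, of m] by blast
  have m: "m > 0" "real m = real N ^ 4" using N by (simp_all add: m_def)
  have sm: "s ^ m = exp (a\<^sup>2 / real N ^ 2)"
    using N unfolding s_def m_def exp_of_nat_mult[symmetric]
    by (simp add: field_simps flip: power_add)
  \<comment> \<open>The geometric sum identity now reads \<open>\<i> c h g = w - 1\<close>, which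
    bounds \<open>h \<otimes> g\<close> by the norm of \<open>w\<close>.\<close>
  have "(z \<ominus> \<one>) = (\<i> * of_real c) \<odot> h"
    using hA by (simp add: z_def a_minus_def a_comm[of \<one>] a_assoc r_neg)
  then have "c * nrm A (h \<otimes> g) = nrm A (w \<ominus> \<one>)"
    using wg(6) hA wg(2) c by (simp add: smult_mult_l nrm_smult norm_mult flip: wg(6))
  also have "\<dots> \<le> s ^ m + 1"
    using nrm_add[OF wg(1), of "\<ominus> \<one>"] nrm_one_le wg(3) by (simp add: a_minus_def nrm_neg)
  finally have hg: "c * nrm A (h \<otimes> g) \<le> s ^ m + 1" .
  \<comment> \<open>Averaging instead of summing brings the coset back to that of 1.\<close>
  define g' where "g' = (1 / of_nat m) \<odot> g"
  have "g' \<in> carrier A" using wg by (simp add: g'_def)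
  moreover have "I +> g' = \<one>\<^bsub>Q\<^esub>"
    using wg(2,5) m(1) by (simp add: g'_def Q.smult_smult flip: Q_smult)
  moreover have "nrm A g' \<le> s ^ m"
    using wg(2,4) m(1) by (simp add: g'_def nrm_smult norm_divide field_simps)
  moreover have "nrm A (h \<otimes> g') \<le> (s ^ m + 1) / real N"
  proof -
    have "nrm A (h \<otimes> g') = nrm A (h \<otimes> g) / real m"
      using wg hA by (simp add: g'_def smult_mult_r nrm_smult norm_divide)
    \<comment> \<open>Here \<open>1 / m = c / N\<close>, by the choice of \<open>c\<close> and
      \<open>m\<close>.\<close>
    also have "\<dots> = (c * nrm A (h \<otimes> g)) / real N"
      using N by (simp add: c_def m(2) field_simps power_numeral_reduce)
    also have "\<dots> \<le> (s ^ m + 1) / real N"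
      using hg by (rule divide_right_mono) simp
    finally show ?thesis .
  qed
  ultimately show ?thesis by (auto simp: sm a_def)
qed

text \<open>One half is submultiplicativity with \<open>Q_nrm_adj_le\<close>. In the other half
  \<open>N\<close> tends to infinity first, for a fixed representative, and only then
  \<open>e\<close> to 0.\<close>

lemma Q_nrm_cstar:
  assumes X: "X \<in> carrier Q"
  shows "nrm Q (adj Q X \<otimes>\<^bsub>Q\<^esub> X) = (nrm Q X)\<^sup>2"
proof (rule antisym)
  have "nrm Q (adj Q X \<otimes>\<^bsub>Q\<^esub> X) \<le> nrm Q (adj Q X) * nrm Q X"
    using X by (simp add: Q_nrm_mult Q.adj_closed)
  also have "\<dots> \<le> nrm Q X * nrm Q X"
    using X by (simp add: Q_nrm_adj_le Q_nrm_nonneg mult_right_mono)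
  finally show "nrm Q (adj Q X \<otimes>\<^bsub>Q\<^esub> X) \<le> (nrm Q X)\<^sup>2"
    by (simp add: power2_eq_square)
next
  obtain x where x: "x \<in> carrier A" "X = I +> x"
    using X by (rule Q_carrierE)
  let ?X2 = "adj Q X \<otimes>\<^bsub>Q\<^esub> X"
  let ?x2 = "adj A x \<otimes> x"
  have x2: "?x2 \<in> carrier A" "adj A ?x2 = ?x2" "I +> ?x2 = ?X2"
    using x by (simp_all add: adj_mult adj_adj adj_closed Q_adj Q_mult)
  show "(nrm Q X)\<^sup>2 \<le> nrm Q ?X2"
  proof (rule le_at_right_limit)
    fix e :: real assume "e > 0"
    then obtain y0 where y0: "y0 \<in> carrier A" "I +> y0 = ?X2" "nrm A y0 < nrm Q ?X2 + e"
      using Q_nrm_lift[of ?X2 e] X by (auto simp: Q.adj_closed)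
    \<comment> \<open>a self-adjoint representative that is no longer than \<open>y0\<close>\<close>
    define y where "y = (1 / 2) \<odot> (y0 \<oplus> adj A y0)"
    have y: "y \<in> carrier A" "adj A y = y"
      using y0 by (simp_all add: y_def adj_smult adj_add adj_closed adj_adj a_comm)
    have "adj Q ?X2 = ?X2"
      using X by (simp add: Q.adj_mult Q.adj_adj Q.adj_closed)
    then have "I +> y = (1 / 2) \<odot>\<^bsub>Q\<^esub> (?X2 \<oplus>\<^bsub>Q\<^esub> ?X2)"
      using y0 by (simp add: y_def adj_closed flip: Q_smult Q_add Q_adj)
    also have "\<dots> = ?X2"
      using X Q.smult_add_left[of ?X2 "1 / 2" "1 / 2"] by (simp add: Q.smult_add)
    finally have yX: "I +> y = I +> ?x2" by (simp add: x2)
    have "nrm A y \<le> (1 / 2) * (nrm A y0 + nrm A (adj A y0))"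
      using y0 nrm_add[of y0 "adj A y0"] by (simp add: y_def adj_closed nrm_smult norm_divide)
    then have yn: "nrm A y \<le> nrm Q ?X2 + e"
      using y0 by (simp add: nrm_adj)
    define h where "h = y \<ominus> ?x2"
    have h: "h \<in> I" "adj A h = h" "h \<in> carrier A"
      using yX y x2 x(1) by (simp_all add: h_def adj_diff' adj_closed flip: coset_eq_iff)
    have xx: "?x2 = y \<ominus> h"
      unfolding h_def using y x2(1) by (simp add: a_minus_def minus_add minus_minus r_neg1 r_neg2 a_assoc[symmetric] r_neg)
    define K where "K N = exp ((nrm A h)\<^sup>2 / real N ^ 2)" for N :: nat
    have bound: "(nrm Q X)\<^sup>2 \<le> K N * (nrm Q ?X2 + e) * K N + K N * ((K N + 1) / real N)" if N: "N > 0" for N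
    proof -
      obtain g where g: "g \<in> carrier A" "I +> g = \<one>\<^bsub>Q\<^esub>" "nrm A g \<le> K N"
        "nrm A (h \<otimes> g) \<le> (K N + 1) / real N"
        using almost_annihilator_seq[OF h(1,2) N] unfolding K_def by blast
      \<comment> \<open>Since \<open>g\<close> is 1 modulo \<open>I\<close>, the product
        \<open>x \<otimes> g\<close> still represents \<open>X\<close>.\<close>
      have "I +> (x \<otimes> g) = X"
        using x g X by (simp flip: Q_mult)
      then have "nrm Q X \<le> nrm A (x \<otimes> g)"
        using Q_nrm_le[of "x \<otimes> g"] x g by simp
      then have "(nrm Q X)\<^sup>2 \<le> (nrm A (x \<otimes> g))\<^sup>2"
        using Q_nrm_nonneg[OF X] by (rule power_mono)
      also have "\<dots> = nrm A (adj A g \<otimes> (?x2 \<otimes> g))"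
        using x g by (simp add: adj_mult adj_closed m_assoc flip: nrm_cstar)
      \<comment> \<open>Replacing \<open>?x2\<close> by \<open>y \<ominus> h\<close> leaves a term
        controlled by the short \<open>y\<close> and one controlled by the small
        \<open>h \<otimes> g\<close>.\<close>
      also have "adj A g \<otimes> (?x2 \<otimes> g) = adj A g \<otimes> (y \<otimes> g) \<oplus> adj A g \<otimes> (\<ominus> (h \<otimes> g))"
        unfolding xx using y h g by (simp add: a_minus_def l_distr r_distr l_minus adj_closed)
      also have "nrm A \<dots> \<le> nrm A (adj A g \<otimes> (y \<otimes> g)) + nrm A (adj A g \<otimes> (\<ominus> (h \<otimes> g)))"
        using y h g by (intro nrm_add) (simp_all add: adj_closed)
      also have "nrm A (adj A g \<otimes> (y \<otimes> g)) \<le> nrm A (adj A g) * nrm A (y \<otimes> g)"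
        using y g by (intro nrm_mult) (simp_all add: adj_closed)
      also have "\<dots> \<le> nrm A g * (nrm A y * nrm A g)"
        using y g by (simp add: nrm_adj nrm_mult nrm_nonneg mult_left_mono)
      also have "\<dots> \<le> K N * ((nrm Q ?X2 + e) * K N)"
        using y g yn nrm_nonneg by (intro mult_mono mult_nonneg_nonneg) (auto intro: order_trans)
      also have "nrm A (adj A g \<otimes> (\<ominus> (h \<otimes> g))) \<le> nrm A (adj A g) * nrm A (\<ominus> (h \<otimes> g))"
        using h g by (intro nrm_mult) (simp_all add: adj_closed)
      also have "\<dots> \<le> K N * ((K N + 1) / real N)"
        using h g by (intro mult_mono) (auto simp: nrm_adj nrm_neg nrm_nonneg K_def)
      finally show ?thesis by (simp add: mult.assoc)
    qed
    have "(\<lambda>N. (nrm A h)\<^sup>2 / real N ^ 2) \<longlonglongrightarrow> 0"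
      by (intro tendsto_divide_0[OF tendsto_const] filterlim_at_top_imp_at_infinity
          filterlim_pow_at_top filterlim_real_sequentially) simp
    from tendsto_exp[OF this] have K: "K \<longlonglongrightarrow> 1"
      by (simp add: K_def[abs_def])
    have K': "(\<lambda>N. (K N + 1) / real N) \<longlonglongrightarrow> 0"
      by (rule tendsto_divide_0[OF tendsto_add[OF K tendsto_const]])
        (intro filterlim_at_top_imp_at_infinity filterlim_real_sequentially)
    have "(\<lambda>N. K N * (nrm Q ?X2 + e) * K N + K N * ((K N + 1) / real N)) \<longlonglongrightarrow> 1 * (nrm Q ?X2 + e) * 1 + 1 * 0"
      by (intro tendsto_intros K K')
    then show "(nrm Q X)\<^sup>2 \<le> nrm Q ?X2 + e"
      using bound by (intro LIMSEQ_le_const[where a = "(nrm Q X)\<^sup>2"]) (auto intro!: exI[of _ 1])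
  qed (auto intro!: tendsto_eq_intros)
qed

section \<open>Completeness of the quotient\<close>

lemma Q_nrm_triangle:
  assumes "X \<in> carrier Q" "Y \<in> carrier Q" "Z \<in> carrier Q"
  shows "nrm Q (X \<ominus>\<^bsub>Q\<^esub> Z) \<le> nrm Q (X \<ominus>\<^bsub>Q\<^esub> Y) + nrm Q (Y \<ominus>\<^bsub>Q\<^esub> Z)"
proof -
  have "X \<ominus>\<^bsub>Q\<^esub> Z = (X \<ominus>\<^bsub>Q\<^esub> Y) \<oplus>\<^bsub>Q\<^esub> (Y \<ominus>\<^bsub>Q\<^esub> Z)"
    using assms by (simp add: a_minus_def Q.a_assoc Q.r_neg1 Q.r_neg2)
  then show ?thesis
    using assms Q_nrm_add[of "X \<ominus>\<^bsub>Q\<^esub> Y" "Y \<ominus>\<^bsub>Q\<^esub> Z"] by simp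
qed

text \<open>Increments are lifted, not terms: \<open>y (Suc k)\<close> is \<open>y k\<close> plus a
  short representative of the difference, so the lifted sequence is Cauchy in
  \<open>A\<close>.\<close>

lemma lift_summable:
  assumes W: "\<And>k. W k \<in> carrier Q" and le: "\<And>k. nrm Q (W (Suc k) \<ominus>\<^bsub>Q\<^esub> W k) < (1 / 2) ^ k"
  shows "\<exists>y. \<forall>k. (y k \<in> carrier A \<and> I +> y k = W k) \<and> nrm A (y (Suc k) \<ominus> y k) < (1 / 2) ^ k"
proof (rule dependent_nat_choice)
  show "\<exists>x. x \<in> carrier A \<and> I +> x = W 0"
    using Q_carrierE[OF W[of 0]] by metis
next
  fix x k assume x: "x \<in> carrier A \<and> I +> x = W k"
  obtain d where d: "d \<in> carrier A" "I +> d = W (Suc k) \<ominus>\<^bsub>Q\<^esub> W k" "nrm A d < (1 / 2) ^ k"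
    \<comment> \<open>The strict inequality in \<open>le\<close> leaves exactly this positive slack
      for the lift.\<close>
    using Q_nrm_lift[of "W (Suc k) \<ominus>\<^bsub>Q\<^esub> W k" "(1 / 2) ^ k - nrm Q (W (Suc k) \<ominus>\<^bsub>Q\<^esub> W k)"]
      W le[of k] by auto
  have "I +> (d \<oplus> x) = W (Suc k)"
    using d x W by (simp add: a_minus_def Q.a_assoc Q.l_neg flip: Q_add)
  then show "\<exists>y. (y \<in> carrier A \<and> I +> y = W (Suc k)) \<and> nrm A (y \<ominus> x) < (1 / 2) ^ k"
    using d x by (intro exI[of _ "d \<oplus> x"]) (simp add: a_minus_def a_assoc r_neg)
qed

end

lemma (in cstar_algebra) geometric_convergent:
  assumes y: "\<And>k. y k \<in> carrier A" and le: "\<And>k. nrm A (y (Suc k) \<ominus> y k) < (1 / 2) ^ k"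
  shows "\<exists>a\<in>carrier A. tends y a"
proof (rule complete)
  \<comment> \<open>The right side is the finite geometric sum in closed form; keeping the
    subtracted term makes the induction on \<open>p\<close> go through.\<close>
  have step: "nrm A (y (k + p) \<ominus> y k) \<le> 2 * (1 / 2) ^ k - 2 * (1 / 2) ^ (k + p)" for k p
  proof (induction p)
    case 0
    then show ?case using y by (simp add: a_minus_def r_neg)
  next
    case (Suc p)
    have "nrm A (y (k + Suc p) \<ominus> y k) \<le> nrm A (y (Suc (k + p)) \<ominus> y (k + p)) + nrm A (y (k + p) \<ominus> y k)"
      using y nrm_diff_triangle[of "y (Suc (k + p))" "y (k + p)" "y k"] by simp
    then show ?case using Suc le[of "k + p"] by simp
  qed
  have dist: "nrm A (y k \<ominus> y M) \<le> 2 * (1 / 2) ^ M" if "k \<ge> M" for k M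
  proof -
    have "nrm A (y k \<ominus> y M) \<le> 2 * (1 / 2) ^ M - 2 * (1 / 2) ^ k"
      using step[of M "k - M"] that by simp
    moreover have "0 \<le> (1 / 2 :: real) ^ k" by simp
    ultimately show ?thesis by linarith
  qed
  show "\<forall>\<epsilon>>0. \<exists>M. \<forall>k\<ge>M. \<forall>l\<ge>M. nrm A (y k \<ominus> y l) < \<epsilon>"
  proof (intro allI impI)
    fix \<epsilon> :: real assume "\<epsilon> > 0"
    \<comment> \<open>Two distances to \<open>y M\<close> are added, each at most
      \<open>2 * (1 / 2) ^ M\<close>, hence the quarter.\<close>
    then obtain M where M: "(1 / 2) ^ M < \<epsilon> / 4"
      using real_arch_pow_inv[of "\<epsilon> / 4" "1 / 2"] by auto
    have "nrm A (y k \<ominus> y l) < \<epsilon>" if "k \<ge> M" "l \<ge> M" for k l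
      using nrm_diff_triangle[of "y k" "y M" "y l"] nrm_diff_commute[of "y M" "y l"]
        dist[OF that(1)] dist[OF that(2)] M y by simp
    then show "\<exists>M. \<forall>k\<ge>M. \<forall>l\<ge>M. nrm A (y k \<ominus> y l) < \<epsilon>" by blast
  qed
qed (use y in simp)

context closed_star_ideal
begin

interpretation Q: star_algebra Q
  by (rule Q_star_algebra)

lemma Q_complete:
  fixes Z :: "nat \<Rightarrow> 'a set"
  assumes Z: "\<forall>k. Z k \<in> carrier Q"
    and cauchy: "\<forall>\<epsilon>>0. \<exists>M. \<forall>k\<ge>M. \<forall>l\<ge>M. nrm Q (Z k \<ominus>\<^bsub>Q\<^esub> Z l) < \<epsilon>"
  shows "\<exists>z\<in>carrier Q. (\<lambda>k. nrm Q (Z k \<ominus>\<^bsub>Q\<^esub> z)) \<longlonglongrightarrow> 0"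
proof -
  have "\<forall>n. \<exists>M. \<forall>k\<ge>M. \<forall>l\<ge>M. nrm Q (Z k \<ominus>\<^bsub>Q\<^esub> Z l) < (1 / 2) ^ n"
    using cauchy by simp
  then obtain M where M: "\<And>n k l. k \<ge> M n \<Longrightarrow> l \<ge> M n \<Longrightarrow> nrm Q (Z k \<ominus>\<^bsub>Q\<^esub> Z l) < (1 / 2) ^ n"
    by metis
  \<comment> \<open>A running maximum ensures that both \<open>r n\<close> and
    \<open>r (Suc n)\<close> are past \<open>M n\<close>, so consecutive chosen terms differ by less
    than \<open>(1 / 2) ^ n\<close>.\<close>
  define r where "r n = Max (M ` {..n})" for n
  have r: "M n \<le> r n" "M n \<le> r (Suc n)" for n
    unfolding r_def by (auto intro!: Max_ge)
  obtain y where y: "\<And>k. y k \<in> carrier A" "\<And>k. I +> y k = Z (r k)"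
    "\<And>k. nrm A (y (Suc k) \<ominus> y k) < (1 / 2) ^ k"
    using lift_summable[of "\<lambda>k. Z (r k)"] Z M r by (metis (no_types, lifting))
  obtain a where a: "a \<in> carrier A" "tends y a"
    using geometric_convergent[OF y(1,3)] by blast
  \<comment> \<open>The chosen terms converge to the coset of \<open>a\<close>; the Cauchy condition
    carries this over to all of \<open>Z\<close>.\<close>
  have "(\<lambda>k. nrm Q (Z k \<ominus>\<^bsub>Q\<^esub> (I +> a))) \<longlonglongrightarrow> 0"
  proof (rule LIMSEQ_I)
    fix e :: real assume e: "0 < e"
    obtain n1 where n1: "(1 / 2) ^ n1 < e / 2"
      using real_arch_pow_inv[of "e / 2" "1 / 2"] e by auto
    obtain n2 where n2: "\<And>n. n \<ge> n2 \<Longrightarrow> nrm A (y n \<ominus> a) < e / 2"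
      using LIMSEQ_D[OF a(2), of "e / 2"] e
      by (metis abs_ge_self diff_zero half_gt_zero le_less_trans real_norm_def)
    define n where "n = max n1 n2"
    have "(1 / 2 :: real) ^ n \<le> (1 / 2) ^ n1"
      by (rule power_decreasing) (simp_all add: n_def)
    then have n: "(1 / 2) ^ n < e / 2" using n1 by linarith
    have "nrm Q (Z (r n) \<ominus>\<^bsub>Q\<^esub> (I +> a)) \<le> nrm A (y n \<ominus> a)"
      using Q_nrm_le[of "y n \<ominus> a"] y a by (simp flip: Q_minus)
    also have "\<dots> < e / 2" by (rule n2) (simp add: n_def)
    finally have lim: "nrm Q (Z (r n) \<ominus>\<^bsub>Q\<^esub> (I +> a)) < e / 2" .
    show "\<exists>M. \<forall>k\<ge>M. norm (nrm Q (Z k \<ominus>\<^bsub>Q\<^esub> (I +> a)) - 0) < e"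
    proof (intro exI[of _ "M n"] allI impI)
      fix k assume "M n \<le> k"
      then have "nrm Q (Z k \<ominus>\<^bsub>Q\<^esub> Z (r n)) < (1 / 2) ^ n"
        using M r by blast
      then have "nrm Q (Z k \<ominus>\<^bsub>Q\<^esub> (I +> a)) < e"
        using lim n Q_nrm_triangle[of "Z k" "Z (r n)" "I +> a"] Z a coset_in by fastforce
      moreover have "0 \<le> nrm Q (Z k \<ominus>\<^bsub>Q\<^esub> (I +> a))"
        using Z a by (intro Q_nrm_nonneg) (simp add: coset_in)
      ultimately show "norm (nrm Q (Z k \<ominus>\<^bsub>Q\<^esub> (I +> a)) - 0) < e" by simp
    qed
  qed
  then show ?thesis using a coset_in by blast
qed

section \<open>The quotient C*-algebra and maps out of it\<close>

theorem Q_cstar_algebra: "cstar_algebra Q"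
  by (intro cstar_algebra.intro cstar_algebra_axioms.intro Q_star_algebra)
    (fact Q_nrm_eq_0 Q_nrm_add Q_nrm_smult Q_nrm_mult Q_nrm_cstar Q_complete)+

lemma coset_star_hom: "(\<lambda>x. I +> x) \<in> star_hom A Q"
  by (auto simp: star_hom_def ring_hom_def Q_simps coset_in)

text \<open>All representatives of a coset have the same image, so the bound \<open>le\<close> holds
  for each of them and passes to the infimum.\<close>

lemma Q_factor:
  assumes f: "f \<in> star_hom A B" and le: "\<And>x. x \<in> carrier A \<Longrightarrow> nrm B (f x) \<le> nrm A x"
    and B: "cstar_algebra B" and ker: "\<And>x. x \<in> I \<Longrightarrow> f x = \<zero>\<^bsub>B\<^esub>"
  obtains g where "g \<in> star_hom Q B" "\<And>x. x \<in> carrier A \<Longrightarrow> g (I +> x) = f x"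
    "\<And>X. X \<in> carrier Q \<Longrightarrow> nrm B (g X) \<le> nrm Q X"
proof -
  interpret B: cstar_algebra B by (rule B)
  have fh: "f x \<in> carrier B" "f (x \<oplus> y) = f x \<oplus>\<^bsub>B\<^esub> f y" "f (x \<otimes> y) = f x \<otimes>\<^bsub>B\<^esub> f y"
    "f (c \<odot> x) = c \<odot>\<^bsub>B\<^esub> f x" "f (adj A x) = adj B (f x)"
    if "x \<in> carrier A" "y \<in> carrier A" for x y c
    using f that by (auto simp: star_hom_def ring_hom_def)
  have f1: "f \<one> = \<one>\<^bsub>B\<^esub>"
    using f by (auto simp: star_hom_def ring_hom_def)
  define g where "g X = f (SOME x. x \<in> carrier A \<and> I +> x = X)" for X
  have g: "g (I +> x) = f x" if x: "x \<in> carrier A" for x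
  proof -
    define y where "y = (SOME y. y \<in> carrier A \<and> I +> y = I +> x)"
    have y: "y \<in> carrier A" "I +> y = I +> x"
      using someI[of "\<lambda>y. y \<in> carrier A \<and> I +> y = I +> x" x] x by (simp_all add: y_def)
    have "f (y \<ominus> x) = \<zero>\<^bsub>B\<^esub>"
      using x y by (intro ker) (simp flip: coset_eq_iff)
    moreover have "f y = f (y \<ominus> x) \<oplus>\<^bsub>B\<^esub> f x"
      using x y by (simp add: a_minus_def a_assoc l_neg flip: fh(2))
    ultimately show ?thesis
      using x y fh by (simp add: g_def y_def[symmetric])
  qed
  have "g \<in> star_hom Q B"
    unfolding star_hom_def ring_hom_def
    by (auto elim!: Q_carrierE simp: Q_simps g fh f1)
  moreover have "nrm B (g X) \<le> nrm Q X" if X: "X \<in> carrier Q" for X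
  proof (rule le_at_right_limit)
    fix e :: real assume "e > 0"
    then obtain x where x: "x \<in> carrier A" "I +> x = X" "nrm A x < nrm Q X + e"
      using Q_nrm_lift[OF X] by blast
    then show "nrm B (g X) \<le> nrm Q X + e"
      using g[OF x(1)] le[OF x(1)] by simp
  qed (auto intro!: tendsto_eq_intros)
  ultimately show ?thesis using that g by blast
qed

end

section \<open>Closed ideals generated by sets stable under the adjoint\<close>

text \<open>The generated ideal is an intersection of ideals that need not be closed under the
  adjoint. But the preimage of each under the adjoint is again one of them, so the intersection
  is.\<close>

lemma (in cstar_algebra) closed_ideal_generated_closed_star_ideal:
  assumes S: "S \<subseteq> carrier A" "\<And>s. s \<in> S \<Longrightarrow> adj A s \<in> S"
  shows "closed_star_ideal A (closed_ideal_generated A S)"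
proof -
  define F where "F = {I. ideal I A \<and> norm_closed A I \<and> S \<subseteq> I}"
  have F: "closed_ideal_generated A S = \<Inter>F"
    by (simp add: closed_ideal_generated_def F_def)
  \<comment> \<open>The family is nonempty, as \<open>i_Intersect\<close> requires.\<close>
  have "carrier A \<in> F"
    using S oneideal by (simp add: F_def norm_closed_def)
  then have id: "ideal (\<Inter>F) A"
    by (intro i_Intersect) (auto simp: F_def)
  have "norm_closed A (\<Inter>F)"
    unfolding norm_closed_def
  proof (intro allI impI InterI)
    fix X x I assume "\<forall>k. X k \<in> \<Inter>F" "x \<in> carrier A" "tends X x" "I \<in> F"
    then show "x \<in> I"
      unfolding F_def norm_closed_def by blast
  qed
  moreover have "adj A x \<in> \<Inter>F" if x: "x \<in> \<Inter>F" for x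
  proof (rule InterI)
    fix I assume I: "I \<in> F"
    then interpret I: ideal I A by (simp add: F_def)
    have closed: "norm_closed A I" using I by (simp add: F_def)
    define I' where "I' = {x \<in> carrier A. adj A x \<in> I}"
    have "ideal I' A"
    proof (rule idealI[OF ring_axioms])
      show "subgroup I' (add_monoid A)"
      proof (rule add.subgroupI)
        show "I' \<noteq> {}"
          using adj_smult[of \<zero> 0] I.zero_closed by (auto simp: I'_def intro!: exI[of _ \<zero>])
        show "\<ominus> x \<in> I'" if "x \<in> I'" for x
          using that I.a_inv_closed[of "adj A x"] by (simp add: I'_def adj_smult flip: smult_neg1)
      qed (auto simp: I'_def adj_add I.a_closed)
    qed (auto simp: I'_def adj_mult I.I_l_closed I.I_r_closed)
    moreover have "norm_closed A I'"
      unfolding norm_closed_def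
    proof (intro allI impI)
      fix X x assume X: "\<forall>k. X k \<in> I'" "x \<in> carrier A" "tends X x"
      then have "tends (\<lambda>k. adj A (X k)) (adj A x)"
        by (intro tends_adj) (auto simp: I'_def)
      then have "adj A x \<in> I"
        using closed[unfolded norm_closed_def, rule_format, of "\<lambda>k. adj A (X k)" "adj A x"] X
        by (simp add: I'_def)
      then show "x \<in> I'" using X by (simp add: I'_def)
    qed
    moreover have "S \<subseteq> I'"
      using S I by (auto simp: I'_def F_def)
    ultimately have "I' \<in> F" by (simp add: F_def)
    then show "adj A x \<in> I" using x by (auto simp: I'_def)
  qed
  ultimately show ?thesis
    unfolding F
    by (intro closed_star_ideal.intro star_ideal.intro star_ideal_axioms.intro
        closed_star_ideal_axioms.intro id cstar_algebra_axioms star_algebra_axioms)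
qed

section \<open>Kernels and uniqueness of contractive homomorphisms\<close>

locale star_homomorphism = A: star_algebra A + B: star_algebra B
  for A :: "('a, 'm) cstar_scheme" and B :: "('b, 'k) cstar_scheme" +
  fixes f :: "'a \<Rightarrow> 'b"
  assumes star_hom: "f \<in> star_hom A B"
begin

sublocale H: ring_hom_ring A B f
  by unfold_locales (use star_hom in \<open>simp add: star_hom_def\<close>)

lemma hom_smult: "x \<in> carrier A \<Longrightarrow> f (c \<odot>\<^bsub>A\<^esub> x) = c \<odot>\<^bsub>B\<^esub> f x"
  and hom_adj: "x \<in> carrier A \<Longrightarrow> f (adj A x) = adj B (f x)"
  using star_hom by (auto simp: star_hom_def)

lemma hom_diff: "x \<in> carrier A \<Longrightarrow> y \<in> carrier A \<Longrightarrow> f (x \<ominus>\<^bsub>A\<^esub> y) = f x \<ominus>\<^bsub>B\<^esub> f y"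
  by (simp add: a_minus_def)

lemma magic_unitary_hom:
  assumes u: "magic_unitary A N u"
  shows "magic_unitary B N (\<lambda>i j. f (u i j))"
proof -
  have c: "u i j \<in> carrier A" if "i < N" "j < N" for i j
    using u that by (simp add: magic_unitary_def projection_def)
  have "projection B (f (u i j))" if "i < N" "j < N" for i j
    using u that by (simp add: magic_unitary_def projection_def flip: hom_adj H.hom_mult)
  moreover have "f (u i j) \<otimes>\<^bsub>B\<^esub> f (u i k) = \<zero>\<^bsub>B\<^esub>" "f (u j i) \<otimes>\<^bsub>B\<^esub> f (u k i) = \<zero>\<^bsub>B\<^esub>"
    if "i < N" "j < N" "k < N" "j \<noteq> k" for i j k
    using u that c by (simp_all add: magic_unitary_def flip: H.hom_mult)
  moreover have "(\<Oplus>\<^bsub>B\<^esub>j\<in>{..<N}. f (u i j)) = \<one>\<^bsub>B\<^esub>" "(\<Oplus>\<^bsub>B\<^esub>j\<in>{..<N}. f (u j i)) = \<one>\<^bsub>B\<^esub>"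
    if "i < N" for i
    using u that c H.hom_finsum[of "u i" "{..<N}"] H.hom_finsum[of "\<lambda>j. u j i" "{..<N}"]
    by (simp_all add: magic_unitary_def comp_def Pi_def)
  ultimately show ?thesis by (simp add: magic_unitary_def)
qed

end

text \<open>By contractivity the kernel is a closed ideal; containing \<open>S\<close>, it is one of
  the ideals in the intersection.\<close>

lemma closed_ideal_generated_hom_zero:
  fixes A :: "('a, 'm) cstar_scheme" and B :: "('b, 'k) cstar_scheme"
  assumes A: "cstar_algebra A" and B: "cstar_algebra B"
    and f: "f \<in> star_hom A B" "\<And>x. x \<in> carrier A \<Longrightarrow> nrm B (f x) \<le> nrm A x"
    and S: "S \<subseteq> carrier A" "\<And>s. s \<in> S \<Longrightarrow> f s = \<zero>\<^bsub>B\<^esub>"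
    and x: "x \<in> closed_ideal_generated A S"
  shows "f x = \<zero>\<^bsub>B\<^esub>"
proof -
  interpret A: cstar_algebra A by (rule A)
  interpret B: cstar_algebra B by (rule B)
  interpret f: star_homomorphism A B f by unfold_locales (rule f(1))
  let ?K = "a_kernel A B f"
  have K: "x \<in> ?K \<longleftrightarrow> x \<in> carrier A \<and> f x = \<zero>\<^bsub>B\<^esub>" for x
    unfolding a_kernel_def' by (rule mem_Collect_eq)
  have "norm_closed A ?K"
    unfolding norm_closed_def
  proof (intro allI impI)
    fix X x assume X: "\<forall>k. X k \<in> ?K" "x \<in> carrier A" "A.tends X x"
    have Xk: "X k \<in> carrier A" "f (X k) = \<zero>\<^bsub>B\<^esub>" for k
      using X(1) K by blast+
    have fx: "f x \<in> carrier B" using X(2) by (rule f.H.hom_closed)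
    have "nrm B (\<zero>\<^bsub>B\<^esub> \<ominus>\<^bsub>B\<^esub> f x) \<le> nrm A (X k \<ominus>\<^bsub>A\<^esub> x)" for k
      using f(2)[OF A.minus_closed[OF Xk(1)[of k] X(2)]] f.hom_diff[OF Xk(1)[of k] X(2)] Xk(2)[of k]
      by metis
    then have "B.tends (\<lambda>k. \<zero>\<^bsub>B\<^esub>) (f x)"
      by (rule B.tends_compare[OF X(3) _ B.zero_closed fx])
    moreover have "B.tends (\<lambda>k. \<zero>\<^bsub>B\<^esub>) \<zero>\<^bsub>B\<^esub>"
      by (simp add: a_minus_def)
    ultimately have "f x = \<zero>\<^bsub>B\<^esub>"
      by (rule B.tends_unique) (use fx in auto)
    then show "x \<in> ?K"
      using K X(2) by blast
  qed
  moreover have "S \<subseteq> ?K"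
    using S K by blast
  ultimately have "x \<in> ?K"
    using x f.H.kernel_is_ideal unfolding closed_ideal_generated_def by blast
  then show ?thesis
    using K by blast
qed

text \<open>Agreement spreads from generators to words and polynomials, and by contractivity to
  limits. Density is asked only at the point \<open>z\<close>, the form in which
  \<open>A_s_generated\<close> and \<open>A_h_generated\<close> supply it.\<close>

lemma star_hom_eqI:
  fixes A :: "('a, 'm) cstar_scheme" and B :: "('b, 'k) cstar_scheme"
  assumes A: "cstar_algebra A" and B: "cstar_algebra B"
    and f: "f \<in> star_hom A B" "\<And>x. x \<in> carrier A \<Longrightarrow> nrm B (f x) \<le> nrm A x"
    and g: "g \<in> star_hom A B" "\<And>x. x \<in> carrier A \<Longrightarrow> nrm B (g x) \<le> nrm A x"
    and v: "\<And>h. h \<in> G \<Longrightarrow> v h \<in> carrier A" "\<And>h. h \<in> G \<Longrightarrow> f (v h) = g (v h)"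
    and z: "z \<in> carrier A" "\<exists>X. (\<forall>k. X k \<in> free_star_algebra G) \<and>
      (\<lambda>k. nrm A (poly_eval A v (X k) \<ominus>\<^bsub>A\<^esub> z)) \<longlonglongrightarrow> 0"
  shows "f z = g z"
proof -
  interpret A: cstar_algebra A by (rule A)
  interpret B: cstar_algebra B by (rule B)
  interpret A: cstar_family A G v by unfold_locales (rule v(1))
  interpret f: star_homomorphism A B f by unfold_locales (rule f(1))
  interpret g: star_homomorphism A B g by unfold_locales (rule g(1))
  have word: "f (A.wev (Word l)) = g (A.wev (Word l))" if "fst ` set l \<subseteq> G" for l
    using that
  proof (induction l)
    case Nil
    then show ?case by (simp add: word_eval_def)
  next
    case (Cons a l)
    obtain h b where a: "a = (h, b)" by (cases a)
    then have "h \<in> G" "A.wordG (Word l)" using Cons.prems by auto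
    then show ?case
      using Cons v[of h] by (simp add: a A.wev_Cons f.hom_adj g.hom_adj)
  qed
  have ev: "f (A.ev x) = g (A.ev x)" if "x \<in> A.FG" for x
    using that
  proof (induction x rule: free_induct)
    case (single w c)
    then show ?case
      using word[of "letters w"] by (simp add: A.ev_single f.hom_smult g.hom_smult)
  qed (simp add: A.ev_add)
  obtain X where X: "\<And>k. X k \<in> A.FG" "A.tends (\<lambda>k. A.ev (X k)) z"
    using z(2) by blast
  have tends: "B.tends (\<lambda>k. h (A.ev (X k))) (h z)"
    if h: "h \<in> star_hom A B" "\<And>x. x \<in> carrier A \<Longrightarrow> nrm B (h x) \<le> nrm A x" for h
  proof -
    interpret h: star_homomorphism A B h by unfold_locales (rule h(1))
    show ?thesis
      by (rule B.tends_compare[OF X(2)]) (use X z h(2) in \<open>simp_all flip: h.hom_diff\<close>)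
  qed
  show ?thesis
    using B.tends_unique[of "\<lambda>k. f (A.ev (X k))" "f z" "g z"] tends[OF f] tends[OF g] X z ev by simp
qed

lemma star_hom_comp:
  assumes "f \<in> star_hom A B" "g \<in> star_hom B C"
  shows "(\<lambda>x. g (f x)) \<in> star_hom A C"
  using assms by (auto simp: star_hom_def ring_hom_def Pi_def)

section \<open>Universal maps with their norm bound\<close>

text \<open>Keeps the norm bound of \<open>completion_extend\<close>, which
  \<open>universal_property\<close> drops.\<close>

lemma (in universal_relations) universal_property_contractive:
  fixes A :: "('a, 'm) cstar_scheme"
  assumes "cstar_algebra A" "\<And>g. g \<in> G \<Longrightarrow> v g \<in> carrier A"
    and rel: "\<And>r. r \<in> R \<Longrightarrow> poly_eval A v r = \<zero>\<^bsub>A\<^esub>"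
  obtains f where "f \<in> star_hom (universal_cstar G P) A"
    "\<And>g. g \<in> G \<Longrightarrow> f (universal_gen G P g) = v g"
    "\<And>z. z \<in> carrier (universal_cstar G P) \<Longrightarrow> nrm A (f z) \<le> nrm (universal_cstar G P) z"
proof -
  interpret A: cstar_algebra A by fact
  interpret A: cstar_family A G v by unfold_locales (rule assms(2))
  have "(\<lambda>x. nrm A (A.ev x)) \<in> adm"
    using A.ev_seminorm rel by (simp add: adm_def)
  then have "nrm A (A.ev x) \<le> U x" if "x \<in> free_star_algebra G" for x
    using adm_le_U that by blast
  from A.completion_extend[OF U_seminorm this] that show ?thesis
    unfolding universal_cstar_def universal_gen_def
    by (metis (no_types, lifting) A.ev_gen free_gen)
qed

lemma A_s_contractive_hom:
  assumes A: "cstar_algebra A" and u: "magic_unitary A N u"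
  obtains f where "f \<in> star_hom (A_s N) A" "\<And>i j. i < N \<Longrightarrow> j < N \<Longrightarrow> f (A_s_gen N i j) = u i j"
    "\<And>z. z \<in> carrier (A_s N) \<Longrightarrow> nrm A (f z) \<le> nrm (A_s N) z"
proof -
  interpret cstar_algebra A by (rule A)
  interpret star_family A "{..<N} \<times> {..<N}" "case_prod u"
    by unfold_locales (use u in \<open>auto simp: magic_unitary_def projection_def\<close>)
  have rel: "poly_eval A (case_prod u) r = \<zero>\<^bsub>A\<^esub>" if "r \<in> magic_relators N" for r
    using magic_unitary_iff[OF star_family_axioms] u that by simp
  obtain f where f: "f \<in> star_hom (A_s N) A"
    "\<And>g. g \<in> {..<N} \<times> {..<N} \<Longrightarrow> f (universal_gen ({..<N} \<times> {..<N})
      (\<lambda>A u. magic_unitary A N (curry u)) g) = case_prod u g"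
    "\<And>z. z \<in> carrier (A_s N) \<Longrightarrow> nrm A (f z) \<le> nrm (A_s N) z"
    using A_s.universal_property_contractive[OF A v_in rel] unfolding A_s_def by blast
  show ?thesis
    by (rule that[OF f(1) _ f(3)]) (simp_all add: A_s_gen_def f(2))
qed

lemma A_h_contractive_hom:
  assumes A: "cstar_algebra A" and w: "sudoku_unitary A n w"
  obtains f where "f \<in> star_hom (A_h n) A"
    "\<And>i j. i < 2 * n \<Longrightarrow> j < 2 * n \<Longrightarrow> f (A_h_gen n i j) = w i j"
    "\<And>z. z \<in> carrier (A_h n) \<Longrightarrow> nrm A (f z) \<le> nrm (A_h n) z"
proof -
  interpret cstar_algebra A by (rule A)
  interpret star_family A "{..<2 * n} \<times> {..<2 * n}" "case_prod w"
    by unfold_locales (use w in \<open>auto simp: sudoku_unitary_def magic_unitary_def projection_def\<close>)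
  have rel: "poly_eval A (case_prod w) r = \<zero>\<^bsub>A\<^esub>" if "r \<in> sudoku_relators n" for r
    using sudoku_unitary_iff[OF star_family_axioms] w that by simp
  obtain f where f: "f \<in> star_hom (A_h n) A"
    "\<And>g. g \<in> {..<2 * n} \<times> {..<2 * n} \<Longrightarrow> f (universal_gen ({..<2 * n} \<times> {..<2 * n})
      (\<lambda>A w. sudoku_unitary A n (curry w)) g) = case_prod w g"
    "\<And>z. z \<in> carrier (A_h n) \<Longrightarrow> nrm A (f z) \<le> nrm (A_h n) z"
    using A_h.universal_property_contractive[OF A v_in rel] unfolding A_h_def by blast
  show ?thesis
    by (rule that[OF f(1) _ f(3)]) (simp_all add: A_h_gen_def f(2))
qed

section \<open>Commutation with the adjacency matrix of the segments\<close>

text \<open>On the vertices, the involution exchanging the ends of each segment; the adjacency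
  matrix is its permutation matrix.\<close>

definition opposite :: "nat \<Rightarrow> nat \<Rightarrow> nat" where
  "opposite n i = (if i < n then n + i else i - n)"

lemma opposite_less: "i < 2 * n \<Longrightarrow> opposite n i < 2 * n"
  by (auto simp: opposite_def)

lemma adjacency_matrix_segments:
  assumes "i < 2 * n" "k < 2 * n"
  shows "adjacency_matrix (segments_graph n) i k = (if opposite n i = k then 1 else 0)"
    and "adjacency_matrix (segments_graph n) k i = (if opposite n i = k then 1 else 0)"
proof -
  have "{i, k} \<in> segments_graph n \<longleftrightarrow> opposite n i = k"
    using assms unfolding segments_graph_def opposite_def
    by (auto simp: doubleton_eq_iff intro: exI[of _ i] exI[of _ k])
  then show "adjacency_matrix (segments_graph n) i k = (if opposite n i = k then 1 else 0)"
    "adjacency_matrix (segments_graph n) k i = (if opposite n i = k then 1 else 0)"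
    by (simp_all add: adjacency_matrix_def insert_commute)
qed

text \<open>Each row and column of a permutation matrix has one nonzero entry, so both sums collapse
  to a single term.\<close>

lemma (in star_algebra) commutator_entries_segments:
  assumes u: "\<And>i j. i < 2 * n \<Longrightarrow> j < 2 * n \<Longrightarrow> u i j \<in> carrier A"
  shows "commutator_entries A (2 * n) (adjacency_matrix (segments_graph n)) u =
    {u (opposite n i) j \<ominus> u i (opposite n j) | i j. i < 2 * n \<and> j < 2 * n}"
proof -
  let ?d = "adjacency_matrix (segments_graph n)"
  have "(\<Oplus>k\<in>{..<2 * n}. ?d i k \<odot> u k j) = u (opposite n i) j"
    if "i < 2 * n" "j < 2 * n" for i j
  proof -
    have "(\<Oplus>k\<in>{..<2 * n}. ?d i k \<odot> u k j) = (\<Oplus>k\<in>{..<2 * n}. if opposite n i = k then u k j else \<zero>)"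
      using that u by (intro finsum_cong') (auto simp: adjacency_matrix_segments(1))
    then show ?thesis
      using that u finsum_singleton[of "opposite n i" "{..<2 * n}" "\<lambda>k. u k j"]
      by (simp add: opposite_less Pi_def)
  qed
  moreover have "(\<Oplus>k\<in>{..<2 * n}. ?d k j \<odot> u i k) = u i (opposite n j)"
    if "i < 2 * n" "j < 2 * n" for i j
  proof -
    have "(\<Oplus>k\<in>{..<2 * n}. ?d k j \<odot> u i k) = (\<Oplus>k\<in>{..<2 * n}. if opposite n j = k then u i k else \<zero>)"
      using that u by (intro finsum_cong') (auto simp: adjacency_matrix_segments(2))
    then show ?thesis
      using that u finsum_singleton[of "opposite n j" "{..<2 * n}" "\<lambda>k. u i k"]
      by (simp add: opposite_less Pi_def)
  qed
  ultimately show ?thesis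
    unfolding commutator_entries_def by (intro Collect_cong) (metis (no_types, lifting))
qed

text \<open>Brings the block form into the shape of the commutator entries, indexed by all vertices
  at once.\<close>

lemma sudoku_unitary_opposite:
  "sudoku_unitary A n w \<longleftrightarrow> magic_unitary A (2 * n) w \<and>
    (\<forall>i<2 * n. \<forall>j<2 * n. w (opposite n i) j = w i (opposite n j))"
proof -
  have "(\<exists>a b. \<forall>i<n. \<forall>j<n. w i j = a i j \<and> w i (n + j) = b i j \<and>
      w (n + i) j = b i j \<and> w (n + i) (n + j) = a i j) \<longleftrightarrow>
    (\<forall>i<n. \<forall>j<n. w (n + i) j = w i (n + j) \<and> w (n + i) (n + j) = w i j)" (is "?l \<longleftrightarrow> ?m")
  proof
    assume ?m
    then show ?l
      by (intro exI[of _ w] exI[of _ "\<lambda>i j. w i (n + j)"]) simp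
  qed auto
  also have "\<dots> \<longleftrightarrow> (\<forall>i<2 * n. \<forall>j<2 * n. w (opposite n i) j = w i (opposite n j))" (is "_ \<longleftrightarrow> ?r")
  proof
    assume m: ?m
    show ?r
    proof (intro allI impI)
      fix i j assume "i < 2 * n" "j < 2 * n"
      then show "w (opposite n i) j = w i (opposite n j)"
        \<comment> \<open>Both indices are reduced to the first half, giving four cases.\<close>
        using m[rule_format, of "if i < n then i else i - n" "if j < n then j else j - n"]
        by (auto simp: opposite_def split: if_splits)
    qed
  next
    assume r: ?r
    show ?m
    proof (intro allI impI conjI)
      fix i j assume "i < n" "j < n"
      then show "w (n + i) j = w i (n + j)" "w (n + i) (n + j) = w i j"
        using r[rule_format, of i j] r[rule_format, of i "n + j"] by (auto simp: opposite_def)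
    qed
  qed
  finally show ?thesis by (simp add: sudoku_unitary_def)
qed

section \<open>The isomorphism\<close>

theorem proposition5p3:
  fixes n :: nat
  shows "\<exists>f \<in> cstar_iso (quantum_symmetry_algebra (2 * n) (segments_graph n)) (A_h n).
    \<forall>i<2 * n. \<forall>j<2 * n.
      f (quantum_symmetry_gen (2 * n) (segments_graph n) i j) = A_h_gen n i j"
proof -
  let ?A = "A_s (2 * n)" and ?u = "A_s_gen (2 * n)" and ?w = "A_h_gen n"
  define J where "J = symmetry_ideal (2 * n) (segments_graph n)"
  define S where "S = commutator_entries ?A (2 * n) (adjacency_matrix (segments_graph n)) ?u"
  interpret A: cstar_algebra ?A by (rule A_s_cstar_algebra)
  interpret H: cstar_algebra "A_h n" by (rule A_h_cstar_algebra)
  note magic = A_s_magic_unitary[of "2 * n"] and sudoku = A_h_sudoku_unitary[of n]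
  have u: "?u i j \<in> carrier ?A" "adj ?A (?u i j) = ?u i j" if "i < 2 * n" "j < 2 * n" for i j
    using magic that by (simp_all add: magic_unitary_def projection_def)
  have w: "?w i j \<in> carrier (A_h n)" if "i < 2 * n" "j < 2 * n" for i j
    using sudoku that by (simp add: sudoku_unitary_def magic_unitary_def projection_def)
  have S: "S = {?u (opposite n i) j \<ominus>\<^bsub>?A\<^esub> ?u i (opposite n j) | i j. i < 2 * n \<and> j < 2 * n}"
    unfolding S_def by (rule A.commutator_entries_segments[OF u(1)])
  have S_in: "S \<subseteq> carrier ?A"
    unfolding S using u opposite_less by fastforce
  have S_adj: "adj ?A s = s" if "s \<in> S" for s
    using that unfolding S by (auto simp: A.adj_diff' u opposite_less)
  have J: "J = closed_ideal_generated ?A S"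
    by (simp add: J_def S_def symmetry_ideal_def)
  interpret J: closed_star_ideal ?A J
    unfolding J by (rule A.closed_ideal_generated_closed_star_ideal[OF S_in]) (simp add: S_adj)
  interpret Q: cstar_algebra J.Q by (rule J.Q_cstar_algebra)
  interpret \<pi>: star_homomorphism ?A J.Q "\<lambda>x. J +>\<^bsub>?A\<^esub> x"
    by unfold_locales (rule J.coset_star_hom)
  \<comment> \<open>The generators of the ideal are the differences that must vanish, so the
    generating matrix becomes sudoku in the quotient.\<close>
  have Q_sudoku: "sudoku_unitary J.Q n (\<lambda>i j. J +>\<^bsub>?A\<^esub> ?u i j)"
    unfolding sudoku_unitary_opposite
  proof (intro conjI allI impI)
    show "magic_unitary J.Q (2 * n) (\<lambda>i j. J +>\<^bsub>?A\<^esub> ?u i j)"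
      by (rule \<pi>.magic_unitary_hom[OF magic])
    fix i j assume ij: "i < 2 * n" "j < 2 * n"
    then have "?u (opposite n i) j \<ominus>\<^bsub>?A\<^esub> ?u i (opposite n j) \<in> J"
      unfolding J closed_ideal_generated_def S by blast
    then show "J +>\<^bsub>?A\<^esub> ?u (opposite n i) j = J +>\<^bsub>?A\<^esub> ?u i (opposite n j)"
      using ij by (simp add: J.coset_eq_iff u opposite_less)
  qed
  obtain \<psi> where \<psi>: "\<psi> \<in> star_hom (A_h n) J.Q"
    "\<And>i j. i < 2 * n \<Longrightarrow> j < 2 * n \<Longrightarrow> \<psi> (?w i j) = J +>\<^bsub>?A\<^esub> ?u i j"
    "\<And>z. z \<in> carrier (A_h n) \<Longrightarrow> nrm J.Q (\<psi> z) \<le> nrm (A_h n) z"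
    by (rule A_h_contractive_hom[OF J.Q_cstar_algebra Q_sudoku]) (rule that)
  have w_magic: "magic_unitary (A_h n) (2 * n) ?w"
    using sudoku by (simp add: sudoku_unitary_def)
  obtain \<phi> where \<phi>: "\<phi> \<in> star_hom ?A (A_h n)"
    "\<And>i j. i < 2 * n \<Longrightarrow> j < 2 * n \<Longrightarrow> \<phi> (?u i j) = ?w i j"
    "\<And>z. z \<in> carrier ?A \<Longrightarrow> nrm (A_h n) (\<phi> z) \<le> nrm ?A z"
    by (rule A_s_contractive_hom[OF H.cstar_algebra_axioms w_magic]) (rule that)
  \<comment> \<open>A sudoku matrix commutes with the adjacency matrix, so \<open>\<phi>\<close>
    kills the generators of \<open>J\<close> and descends to \<open>f\<close>.\<close>
  have ker: "\<phi> x = \<zero>\<^bsub>A_h n\<^esub>" if "x \<in> J" for x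
  proof (rule closed_ideal_generated_hom_zero[OF A.cstar_algebra_axioms H.cstar_algebra_axioms \<phi>(1,3) S_in])
    fix s assume "s \<in> S"
    then obtain i j where ij: "i < 2 * n" "j < 2 * n"
      "s = ?u (opposite n i) j \<ominus>\<^bsub>?A\<^esub> ?u i (opposite n j)"
      unfolding S by blast
    have "\<phi> s = ?w (opposite n i) j \<ominus>\<^bsub>A_h n\<^esub> ?w i (opposite n j)"
      unfolding ij(3) using ij(1,2)
      by (subst star_homomorphism.hom_diff[OF star_homomorphism.intro[OF A.star_algebra_axioms
            H.star_algebra_axioms star_homomorphism_axioms.intro[OF \<phi>(1)]]])
        (simp_all add: \<phi>(2) u opposite_less)
    moreover have "?w (opposite n i) j = ?w i (opposite n j)"
      using sudoku ij by (simp add: sudoku_unitary_opposite)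
    ultimately show "\<phi> s = \<zero>\<^bsub>A_h n\<^esub>"
      using ij by (simp add: w opposite_less H.eq_diff_zero)
  qed (use that J in simp_all)
  obtain f where f: "f \<in> star_hom J.Q (A_h n)" "\<And>x. x \<in> carrier ?A \<Longrightarrow> f (J +>\<^bsub>?A\<^esub> x) = \<phi> x"
    "\<And>X. X \<in> carrier J.Q \<Longrightarrow> nrm (A_h n) (f X) \<le> nrm J.Q X"
    by (rule J.Q_factor[OF \<phi>(1,3) H.cstar_algebra_axioms ker]) (assumption, assumption, rule that)
  have \<phi>_in: "\<phi> x \<in> carrier (A_h n)" if "x \<in> carrier ?A" for x
    using \<phi>(1) that by (auto simp: star_hom_def ring_hom_def)
  have f_in: "f X \<in> carrier (A_h n)" if "X \<in> carrier J.Q" for X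
    using f(1) that by (auto simp: star_hom_def ring_hom_def)
  have \<psi>_in: "\<psi> z \<in> carrier J.Q" if "z \<in> carrier (A_h n)" for z
    using \<psi>(1) that by (auto simp: star_hom_def ring_hom_def)
  \<comment> \<open>The composite and the identity are contractive and agree on the generators of
    \<open>A_h n\<close>.\<close>
  have f_\<psi>: "f (\<psi> z) = z" if z: "z \<in> carrier (A_h n)" for z
  proof (rule star_hom_eqI[OF H.cstar_algebra_axioms H.cstar_algebra_axioms,
        where v = "case_prod ?w" and G = "{..<2 * n} \<times> {..<2 * n}"])
    show "(\<lambda>z. f (\<psi> z)) \<in> star_hom (A_h n) (A_h n)"
      by (rule star_hom_comp[OF \<psi>(1) f(1)])
    show "(\<lambda>z. z) \<in> star_hom (A_h n) (A_h n)"
      by (simp add: star_hom_def ring_hom_def)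
    show "nrm (A_h n) (f (\<psi> x)) \<le> nrm (A_h n) x" if "x \<in> carrier (A_h n)" for x
      by (rule order_trans[OF f(3)[OF \<psi>_in[OF that]] \<psi>(3)[OF that]])
    show "case_prod ?w h \<in> carrier (A_h n)" "f (\<psi> (case_prod ?w h)) = case_prod ?w h"
      if hG: "h \<in> {..<2 * n} \<times> {..<2 * n}" for h
    proof -
      obtain i j where h: "h = (i, j)" "i < 2 * n" "j < 2 * n"
        using hG by (metis SigmaE lessThan_iff)
      show "case_prod ?w h \<in> carrier (A_h n)"
        using h by (simp add: w)
      have "f (\<psi> (?w i j)) = ?w i j"
        unfolding \<psi>(2)[OF h(2,3)] f(2)[OF u(1)[OF h(2,3)]] by (rule \<phi>(2)[OF h(2,3)])
      then show "f (\<psi> (case_prod ?w h)) = case_prod ?w h"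
        by (simp add: h(1))
    qed
  qed (rule order_refl z A_h_generated[OF z])+
  have \<psi>_f: "\<psi> (f X) = X" if X: "X \<in> carrier J.Q" for X
  proof -
    obtain x where x: "x \<in> carrier ?A" "X = J +>\<^bsub>?A\<^esub> x"
      using X by (rule J.Q_carrierE)
    \<comment> \<open>The comparison is made on \<open>A_s (2 * n)\<close>, where the polynomials in
      the generators are known to be dense.\<close>
    have "\<psi> (\<phi> x) = J +>\<^bsub>?A\<^esub> x"
    proof (rule star_hom_eqI[OF A.cstar_algebra_axioms J.Q_cstar_algebra _ _ J.coset_star_hom J.Q_nrm_le,
          where v = "case_prod ?u" and G = "{..<2 * n} \<times> {..<2 * n}"])
      show "(\<lambda>x. \<psi> (\<phi> x)) \<in> star_hom ?A J.Q"
        by (rule star_hom_comp[OF \<phi>(1) \<psi>(1)])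
      show "nrm J.Q (\<psi> (\<phi> x)) \<le> nrm ?A x" if "x \<in> carrier ?A" for x
        by (rule order_trans[OF \<psi>(3)[OF \<phi>_in[OF that]] \<phi>(3)[OF that]])
      show "case_prod ?u h \<in> carrier ?A" "\<psi> (\<phi> (case_prod ?u h)) = J +>\<^bsub>?A\<^esub> case_prod ?u h"
        if hG: "h \<in> {..<2 * n} \<times> {..<2 * n}" for h
      proof -
        obtain i j where h: "h = (i, j)" "i < 2 * n" "j < 2 * n"
          using hG by (metis SigmaE lessThan_iff)
        show "case_prod ?u h \<in> carrier ?A"
          using h by (simp add: u)
        have "\<psi> (\<phi> (?u i j)) = J +>\<^bsub>?A\<^esub> ?u i j"
          unfolding \<phi>(2)[OF h(2,3)] by (rule \<psi>(2)[OF h(2,3)])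
        then show "\<psi> (\<phi> (case_prod ?u h)) = J +>\<^bsub>?A\<^esub> case_prod ?u h"
          by (simp add: h(1))
      qed
    qed (assumption | rule x(1) A_s_generated[OF x(1)])+
    then show ?thesis using x f(2) by simp
  qed
  have "f \<in> cstar_iso J.Q (A_h n)"
    unfolding cstar_iso_def
  proof (intro CollectI conjI ballI f(1))
    show "bij_betw f (carrier J.Q) (carrier (A_h n))"
      by (rule bij_betw_byWitness[where f' = \<psi>]) (use f_in \<psi>_in f_\<psi> \<psi>_f in auto)
    \<comment> \<open>Two mutually inverse contractions are isometric.\<close>
    show "nrm (A_h n) (f X) = nrm J.Q X" if "X \<in> carrier J.Q" for X
      using f(3)[OF that] \<psi>(3)[OF f_in[OF that]] \<psi>_f[OF that] by simp
  qed
  then show ?thesis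
    by (intro bexI[of _ f])
      (simp_all add: quantum_symmetry_algebra_def quantum_symmetry_gen_def f(2) u \<phi>(2) flip: J_def)
qed

end
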